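(* Let $f\in F_r$, $\varphi\in(0,1)$, and let $\phi$ be a method satisfying assumption A (see context) with $\bar\beta=2$. Then for all sufficiently small $\varepsilon>0$ $$m^*(\varepsilon)\le\bar m\Bigl(\tfrac{1-\varphi}{2(1+\varphi)}\,\varepsilon\Bigr)\le\bar m^{\mathrm{equid}}\Bigl(\tfrac{1-\varphi}{2(1+\varphi)}\,\varepsilon\Bigr),$$ and, as $\varepsilon\to0$, $$\bar m^{\mathrm{equid}}\Bigl(\tfrac{1-\varphi}{2(1+\varphi)}\,\varepsilon\Bigr)=\Theta\left(\left\lceil(b-a)\Bigl(\frac{\bar N(f)}{\varepsilon}\Bigr)^{1/(r+1)}\right\rceil\right)=\Theta\bigl(\hat m^{\mathrm{equid}}(\varepsilon)\bigr),$$ where the constants in the $\Theta$-notation depend only on $\varphi$.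
   Context: **Problem.** Let $a<b$, $d,r\ge1$ integers, $\eta\in\mathbb R^d$, $\|\cdot\|$ the maximum norm in $\mathbb R^d$. Consider $z'(t)=f(t,z(t))$, $t\in[a,b]$, $z(a)=\eta$. $F_r$ is the class of continuous $f:[a,b]\times\mathbb R^d\to\mathbb R^d$ such that for some $L\ge0$, $\|f(t,y)-f(t,\bar y)\|\le L\|y-\bar y\|$ for all $t\in[a,b]$, $y,\bar y\in\mathbb R^d$, and $f\in C^r([a,b]\times D)$, where $D=\{y\in\mathbb R^d:\|y\|\le\sup_{t\in[a,b]}\|z(t)\|+1\}$ and $z$ is the unique solution. **Meshes.** For a mesh $a=x_0<\dots<x_m=b$ let $h_i=x_{i+1}-x_i$. Fix a nonincreasing sequence $\ell(m)\to0$ and constants $K,k_0$ (possibly depending on $f,a,b,\eta$). A mesh with $m$ subintervals is admissible if, when $m\ge k_0$, $\max_ih_i\le K\ell(m)$. It is assumed that $\ell,K$ are such that the uniform meshes, and the meshes produced by ADAPT-MESH below for all sufficiently small $\varepsilon$, are admissible. **Methods.** A method $\phi$ computes successively, for a mesh and starting with $y_0=\eta$, in each $[x_i,x_{i+1}]$ an approximation $l_i$ with $l_i(x_i)=y_i$, and sets $y_{i+1}=l_i(x_{i+1})$. The local solution $z_i$ satisfies $z_i'(t)=f(t,z_i(t))$, $z_i(x_i)=y_i$. **Assumption A** (with $\bar\beta,\beta>0$ independent of $f$): for any $f\in F_r$ there is $m_0$ such that for all $m\ge m_0$ and any admissible $\{x_i\}_{i=0}^m$, $\sup_{t\in[x_i,x_{i+1}]}\|z_i(t)-l_i(t)\|\le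 c_ih_i^{r+1}$, $i=0,\dots,m-1$, where $c_i=\bar\beta\bigl(\frac1{r!}\sup_{\alpha\in[x_i,x_{i+1}]}\|z_i^{(r+1)}(\alpha)\|+\beta\bigr)$ (read as $+\infty$ if $z_i^{(r+1)}$ does not exist on the whole interval). **Quantities.** With $\bar\beta=2$ put $$\bar c_i=\bar\beta\Bigl(\frac1{r!}\sup_{\alpha\in[x_i,x_{i+1}]}\|z^{(r+1)}(\alpha)\|+\beta\Bigr)(1+\varphi),\qquad \bar N(f)=\bar\beta\Bigl(\frac1{r!}\sup_{t\in[a,b]}\|z^{(r+1)}(t)\|+\beta\Bigr)(1+\varphi),$$ $$\bar k(m)=\inf\Bigl\{\max_{0\le i\le m-1}\bar c_ih_i^{r+1}:\ a=x_0\le x_1\le\dots\le x_m=b\ \text{admissible}\Bigr\},\quad \bar m(\varepsilon)=\min\{m\in\mathbb N:\bar k(m)\le\varepsilon\},$$ $$\bar m^{\mathrm{equid}}(\varepsilon)=\min\Bigl\{m\in\mathbb N:\bar N(f)\Bigl(\frac{b-a}m\Bigr)^{r+1}\le\varepsilon\Bigr\},$$ and $\hat m^{\mathrm{equid}}(\varepsilon)$ is the minimal $m\in\mathbb N$ such that $\max_{0\le i\le m-1}c_ih_i^{r+1}\le\varepsilon$ for $\phi$ on the uniform mesh with $m$ subintervals. **Algorithm ADAPT-MESH** (parameters $\varepsilon\in(0,1)$, $\varphi$, and the same constant $\beta>0$ that appears in the definitions of $c_i$, $\bar c_i$ and $\bar N(f)$; $h:(0,1)\to\mathbb R_+$ fixed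 with $h(\varepsilon)=O(\varepsilon^{1/(r+1)})$ as $\varepsilon\to0^+$). Basic iteration on $[\sigma,\tau]$ with initial vector $y$ and nodes $s_0,\dots,s_{r-1}$: $l_0\equiv y$, $l_{j+1}(t)=y+\int_\sigma^tq_j(\xi)\,d\xi$, where $q_j$ is the Lagrange interpolation polynomial of degree at most $r-1$ of $t\mapsto f(t,l_j(t))$ at $s_0,\dots,s_{r-1}$; output $l_{r+1}$. Set $x_0^*=a$, $y_0^*=\eta$. Given $x_i^*<b$, $y_i^*$: (1) $\bar x_{i+1}=x_i^*+\min\{h(\varepsilon),b-x_i^*\}$, with equidistant points $\bar t_0=x_i^*,\dots,\bar t_r=\bar x_{i+1}$. (2) $\bar l_{i,r+1}$ is the output of the basic iteration on $[x_i^*,\bar x_{i+1}]$ with $y=y_i^*$ and nodes $\bar t_0,\dots,\bar t_{r-1}$. (3) $G_i=\frac83\bigl(\|\tilde H_i[\bar t_0,\dots,\bar t_r]\|+\beta\bigr)(1+\varphi)$, where $\tilde H_i[\bar t_0,\dots,\bar t_r]$ is the componentwise divided difference of $\tilde H_i(t)=f(t,\bar l_{i,r+1}(t))$. (4) $x_{i+1}^*=x_i^*+\min\{(\varepsilon/G_i)^{1/(r+1)},b-x_i^*\}$. (5) $l_{i,r+1}$ is the output of the basic iteration on $[x_i^*,x_{i+1}^*]$ with $y=y_i^*$ and equidistant nodes $t_0,\dots,t_{r-1}$ ($t_0=x_i^*$ if $r=1$; $t_0=x_i^*$, $t_{r-1}=x_{i+1}^*$ if $r\ge2$); $y_{i+1}^*=l_{i,r+1}(x_{i+1}^*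 )$. Stop if $x_{i+1}^*=b$; otherwise continue. $m^*(\varepsilon)$ is the number of subintervals produced. *)

theory Defs
  imports "HOL-Analysis.Analysis" "HOL-Library.Landau_Symbols"
begin

(* R^d with the maximum norm, for a dimension d that is a natural number and not a type:
   the constants in the theorem must not depend on d, so d has to be quantified inside the
   formula.  The ambient type carries the supremum norm over all coordinates, which on
   Rd d is max_{i<d} |v_i|; Rd d is the isometric copy of R^d in it.  Vector operations,
   derivatives, integrals and divided differences of curves in Rd d are componentwise. *)

type_synonym rvec = "nat \<Rightarrow>\<^sub>C real"

definition Rd :: "nat \<Rightarrow> rvec set" where
  "Rd d = {v. \<forall>i\<ge>d. apply_bcontfun v i = 0}"

(* C^k on S, with one-sided derivatives at boundary points.  U is the set of admissible
   directions (the linear span of S - S); only g' x restricted to U is determined by g. *)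

primrec Ck_on :: "nat \<Rightarrow> 'a::real_normed_vector set \<Rightarrow> 'a set \<Rightarrow> ('a \<Rightarrow> 'b::real_normed_vector) \<Rightarrow> bool" where
  "Ck_on 0 U S g = continuous_on S g"
| "Ck_on (Suc k) U S g =
     (\<exists>g'. (\<forall>x\<in>S. (g has_derivative g' x) (at x within S)) \<and> (\<forall>u\<in>U. Ck_on k U S (\<lambda>x. g' x u)))"

primrec hderiv :: "real set \<Rightarrow> nat \<Rightarrow> (real \<Rightarrow> 'b::real_normed_vector) \<Rightarrow> real \<Rightarrow> 'b" where
  "hderiv S 0 g = g"
| "hderiv S (Suc k) g = (\<lambda>t. vector_derivative (hderiv S k g) (at t within S))"

definition hdifferentiable_on :: "real set \<Rightarrow> nat \<Rightarrow> (real \<Rightarrow> 'b::real_normed_vector) \<Rightarrow> bool" where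
  "hdifferentiable_on S k g \<longleftrightarrow> (\<forall>j<k. \<forall>t\<in>S. hderiv S j g differentiable (at t within S))"


definition ivp_solution ::
  "nat \<Rightarrow> (real \<Rightarrow> rvec \<Rightarrow> rvec) \<Rightarrow> real \<Rightarrow> real \<Rightarrow> rvec \<Rightarrow> (real \<Rightarrow> rvec) \<Rightarrow> bool" where
  "ivp_solution d f s T y z \<longleftrightarrow>
     z s = y \<and> (\<forall>t\<in>{s..T}. z t \<in> Rd d \<and> (z has_vector_derivative f t (z t)) (at t within {s..T}))"

(* For f in F_class below the solution on {s..T} exists and is unique there. *)

definition ivp_sol :: "nat \<Rightarrow> (real \<Rightarrow> rvec \<Rightarrow> rvec) \<Rightarrow> real \<Rightarrow> real \<Rightarrow> rvec \<Rightarrow> real \<Rightarrow> rvec" where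
  "ivp_sol d f s T y = (SOME z. ivp_solution d f s T y z)"

definition F_class :: "nat \<Rightarrow> nat \<Rightarrow> real \<Rightarrow> real \<Rightarrow> rvec \<Rightarrow> (real \<Rightarrow> rvec \<Rightarrow> rvec) set" where
  "F_class d r a b \<eta> = {f.
     (\<forall>t\<in>{a..b}. \<forall>y\<in>Rd d. f t y \<in> Rd d) \<and>
     continuous_on ({a..b} \<times> Rd d) (\<lambda>(t, y). f t y) \<and>
     (\<exists>L\<ge>0. \<forall>t\<in>{a..b}. \<forall>y\<in>Rd d. \<forall>y'\<in>Rd d. norm (f t y - f t y') \<le> L * norm (y - y')) \<and>
     (let z = ivp_sol d f a b \<eta>;
          D = {y \<in> Rd d. norm y \<le> (SUP t\<in>{a..b}. norm (z t)) + 1}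
      in Ck_on r (UNIV \<times> Rd d) ({a..b} \<times> D) (\<lambda>(t, y). f t y))}"


definition is_mesh :: "real \<Rightarrow> real \<Rightarrow> nat \<Rightarrow> (nat \<Rightarrow> real) \<Rightarrow> bool" where
  "is_mesh a b m x \<longleftrightarrow> x 0 = a \<and> x m = b \<and> (\<forall>i<m. x i < x (Suc i))"

definition is_weak_mesh :: "real \<Rightarrow> real \<Rightarrow> nat \<Rightarrow> (nat \<Rightarrow> real) \<Rightarrow> bool" where
  "is_weak_mesh a b m x \<longleftrightarrow> x 0 = a \<and> x m = b \<and> (\<forall>i<m. x i \<le> x (Suc i))"

definition mesh_step :: "(nat \<Rightarrow> real) \<Rightarrow> nat \<Rightarrow> real" where
  "mesh_step x i = x (Suc i) - x i"

definition uniform_mesh :: "real \<Rightarrow> real \<Rightarrow> nat \<Rightarrow> nat \<Rightarrow> real" where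
  "uniform_mesh a b m i = a + real i * ((b - a) / real m)"

definition admissible :: "(nat \<Rightarrow> real) \<Rightarrow> real \<Rightarrow> nat \<Rightarrow> nat \<Rightarrow> (nat \<Rightarrow> real) \<Rightarrow> bool" where
  "admissible ell K k0 m x \<longleftrightarrow> (k0 \<le> m \<longrightarrow> (\<forall>i<m. mesh_step x i \<le> K * ell m))"


(* M f m x i is the approximation l_i produced for f on the mesh x_0 < ... < x_m. *)

type_synonym ivp_method =
  "(real \<Rightarrow> rvec \<Rightarrow> rvec) \<Rightarrow> nat \<Rightarrow> (nat \<Rightarrow> real) \<Rightarrow> nat \<Rightarrow> real \<Rightarrow> rvec"

definition node_value ::
  "ivp_method \<Rightarrow> rvec \<Rightarrow> (real \<Rightarrow> rvec \<Rightarrow> rvec) \<Rightarrow> nat \<Rightarrow> (nat \<Rightarrow> real) \<Rightarrow> nat \<Rightarrow> rvec" where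
  "node_value M \<eta> f m x i = (case i of 0 \<Rightarrow> \<eta> | Suc j \<Rightarrow> M f m x j (x (Suc j)))"

definition is_method :: "nat \<Rightarrow> nat \<Rightarrow> real \<Rightarrow> real \<Rightarrow> rvec \<Rightarrow> ivp_method \<Rightarrow> bool" where
  "is_method d r a b \<eta> M \<longleftrightarrow>
     (\<forall>f\<in>F_class d r a b \<eta>. \<forall>m x. is_mesh a b m x \<longrightarrow>
        (\<forall>i<m. M f m x i (x i) = node_value M \<eta> f m x i \<and>
               (\<forall>t\<in>{x i..x (Suc i)}. M f m x i t \<in> Rd d)))"

definition local_sol ::
  "nat \<Rightarrow> ivp_method \<Rightarrow> rvec \<Rightarrow> (real \<Rightarrow> rvec \<Rightarrow> rvec) \<Rightarrow> nat \<Rightarrow> (nat \<Rightarrow> real) \<Rightarrow> nat \<Rightarrow> real \<Rightarrow> rvec" where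
  "local_sol d M \<eta> f m x i = ivp_sol d f (x i) (x (Suc i)) (node_value M \<eta> f m x i)"

definition c_coef ::
  "nat \<Rightarrow> nat \<Rightarrow> real \<Rightarrow> real \<Rightarrow> ivp_method \<Rightarrow> rvec \<Rightarrow> (real \<Rightarrow> rvec \<Rightarrow> rvec) \<Rightarrow> nat \<Rightarrow> (nat \<Rightarrow> real) \<Rightarrow> nat \<Rightarrow> ereal" where
  "c_coef d r \<beta>bar \<beta> M \<eta> f m x i =
     (let S = {x i..x (Suc i)}; z = local_sol d M \<eta> f m x i in
      if hdifferentiable_on S (r + 1) z
      then ereal \<beta>bar * (ereal (1 / fact r) * (SUP \<alpha>\<in>S. ereal (norm (hderiv S (r + 1) z \<alpha>))) + ereal \<beta>)
      else \<infinity>)"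

(* K and k0 may depend on the right-hand side. *)

definition assumption_A ::
  "nat \<Rightarrow> nat \<Rightarrow> real \<Rightarrow> real \<Rightarrow> rvec \<Rightarrow> (nat \<Rightarrow> real) \<Rightarrow> ((real \<Rightarrow> rvec \<Rightarrow> rvec) \<Rightarrow> real) \<Rightarrow>
   ((real \<Rightarrow> rvec \<Rightarrow> rvec) \<Rightarrow> nat) \<Rightarrow> real \<Rightarrow> real \<Rightarrow> ivp_method \<Rightarrow> bool" where
  "assumption_A d r a b \<eta> ell K k0 \<beta>bar \<beta> M \<longleftrightarrow>
     (\<forall>f\<in>F_class d r a b \<eta>. \<exists>m0. \<forall>m\<ge>m0. \<forall>x.
        is_mesh a b m x \<and> admissible ell (K f) (k0 f) m x \<longrightarrow>
        (\<forall>i<m. (SUP t\<in>{x i..x (Suc i)}. ereal (norm (local_sol d M \<eta> f m x i t - M f m x i t)))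
                 \<le> c_coef d r \<beta>bar \<beta> M \<eta> f m x i * ereal (mesh_step x i ^ (r + 1))))"


definition cbar_coef ::
  "nat \<Rightarrow> nat \<Rightarrow> real \<Rightarrow> real \<Rightarrow> rvec \<Rightarrow> real \<Rightarrow> real \<Rightarrow> real \<Rightarrow> (real \<Rightarrow> rvec \<Rightarrow> rvec) \<Rightarrow> (nat \<Rightarrow> real) \<Rightarrow> nat \<Rightarrow> real" where
  "cbar_coef d r a b \<eta> \<beta>bar \<beta> \<phi> f x i =
     \<beta>bar * (1 / fact r * (SUP \<alpha>\<in>{x i..x (Suc i)}. norm (hderiv {a..b} (r + 1) (ivp_sol d f a b \<eta>) \<alpha>)) + \<beta>)
       * (1 + \<phi>)"

definition Nbar ::
  "nat \<Rightarrow> nat \<Rightarrow> real \<Rightarrow> real \<Rightarrow> rvec \<Rightarrow> real \<Rightarrow> real \<Rightarrow> real \<Rightarrow> (real \<Rightarrow> rvec \<Rightarrow> rvec) \<Rightarrow> real" where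
  "Nbar d r a b \<eta> \<beta>bar \<beta> \<phi> f =
     \<beta>bar * (1 / fact r * (SUP t\<in>{a..b}. norm (hderiv {a..b} (r + 1) (ivp_sol d f a b \<eta>) t)) + \<beta>) * (1 + \<phi>)"

definition kbar ::
  "nat \<Rightarrow> nat \<Rightarrow> real \<Rightarrow> real \<Rightarrow> rvec \<Rightarrow> (nat \<Rightarrow> real) \<Rightarrow> real \<Rightarrow> nat \<Rightarrow> real \<Rightarrow> real \<Rightarrow> real \<Rightarrow>
   (real \<Rightarrow> rvec \<Rightarrow> rvec) \<Rightarrow> nat \<Rightarrow> real" where
  "kbar d r a b \<eta> ell K k0 \<beta>bar \<beta> \<phi> f m =
     Inf {Max ((\<lambda>i. cbar_coef d r a b \<eta> \<beta>bar \<beta> \<phi> f x i * mesh_step x i ^ (r + 1)) ` {..<m}) | x.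
            is_weak_mesh a b m x \<and> admissible ell K k0 m x}"

definition mbar ::
  "nat \<Rightarrow> nat \<Rightarrow> real \<Rightarrow> real \<Rightarrow> rvec \<Rightarrow> (nat \<Rightarrow> real) \<Rightarrow> real \<Rightarrow> nat \<Rightarrow> real \<Rightarrow> real \<Rightarrow> real \<Rightarrow>
   (real \<Rightarrow> rvec \<Rightarrow> rvec) \<Rightarrow> real \<Rightarrow> nat" where
  "mbar d r a b \<eta> ell K k0 \<beta>bar \<beta> \<phi> f \<epsilon> =
     (LEAST m. 1 \<le> m \<and> kbar d r a b \<eta> ell K k0 \<beta>bar \<beta> \<phi> f m \<le> \<epsilon>)"

definition mbar_equid ::
  "nat \<Rightarrow> nat \<Rightarrow> real \<Rightarrow> real \<Rightarrow> rvec \<Rightarrow> real \<Rightarrow> real \<Rightarrow> real \<Rightarrow> (real \<Rightarrow> rvec \<Rightarrow> rvec) \<Rightarrow> real \<Rightarrow> nat" where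
  "mbar_equid d r a b \<eta> \<beta>bar \<beta> \<phi> f \<epsilon> =
     (LEAST m. 1 \<le> m \<and> Nbar d r a b \<eta> \<beta>bar \<beta> \<phi> f * ((b - a) / real m) ^ (r + 1) \<le> \<epsilon>)"

definition mhat_equid ::
  "nat \<Rightarrow> nat \<Rightarrow> real \<Rightarrow> real \<Rightarrow> rvec \<Rightarrow> real \<Rightarrow> real \<Rightarrow> ivp_method \<Rightarrow> (real \<Rightarrow> rvec \<Rightarrow> rvec) \<Rightarrow> real \<Rightarrow> nat" where
  "mhat_equid d r a b \<eta> \<beta>bar \<beta> M f \<epsilon> =
     (LEAST m. 1 \<le> m \<and>
        (let x = uniform_mesh a b m in
         Max ((\<lambda>i. c_coef d r \<beta>bar \<beta> M \<eta> f m x i * ereal (mesh_step x i ^ (r + 1))) ` {..<m}) \<le> ereal \<epsilon>))"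


(* Lagrange interpolation polynomial of degree at most r - 1 at s 0, ..., s (r - 1). *)

definition lagrange_interp ::
  "nat \<Rightarrow> (nat \<Rightarrow> real) \<Rightarrow> (real \<Rightarrow> 'b::real_normed_vector) \<Rightarrow> real \<Rightarrow> 'b" where
  "lagrange_interp r s g t = (\<Sum>j<r. (\<Prod>k\<in>{..<r} - {j}. (t - s k) / (s j - s k)) *\<^sub>R g (s j))"

primrec basic_iter ::
  "nat \<Rightarrow> (real \<Rightarrow> rvec \<Rightarrow> rvec) \<Rightarrow> real \<Rightarrow> rvec \<Rightarrow> (nat \<Rightarrow> real) \<Rightarrow> nat \<Rightarrow> real \<Rightarrow> rvec" where
  "basic_iter r f \<sigma> y s 0 = (\<lambda>t. y)"
| "basic_iter r f \<sigma> y s (Suc j) =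
     (\<lambda>t. y + integral {\<sigma>..t} (lagrange_interp r s (\<lambda>u. f u (basic_iter r f \<sigma> y s j u))))"

(* divided_diff g s k i = g[s i, ..., s (i + k)] *)

primrec divided_diff :: "(real \<Rightarrow> 'b::real_normed_vector) \<Rightarrow> (nat \<Rightarrow> real) \<Rightarrow> nat \<Rightarrow> nat \<Rightarrow> 'b" where
  "divided_diff g s 0 i = g (s i)"
| "divided_diff g s (Suc k) i =
     (divided_diff g s k (Suc i) - divided_diff g s k i) /\<^sub>R (s (i + Suc k) - s i)"

(* Equidistant points; for n = 0 the only one is the left endpoint, since x / 0 = 0. *)

definition equid_nodes :: "nat \<Rightarrow> real \<Rightarrow> real \<Rightarrow> nat \<Rightarrow> real" where
  "equid_nodes n \<sigma> \<tau> j = \<sigma> + real j * ((\<tau> - \<sigma>) / real n)"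

definition adapt_step ::
  "nat \<Rightarrow> real \<Rightarrow> real \<Rightarrow> real \<Rightarrow> (real \<Rightarrow> real) \<Rightarrow> (real \<Rightarrow> rvec \<Rightarrow> rvec) \<Rightarrow> real \<Rightarrow> real \<times> rvec \<Rightarrow> real \<times> rvec" where
  "adapt_step r b \<beta> \<phi> h f \<epsilon> = (\<lambda>(x, y).
     let xbar = x + min (h \<epsilon>) (b - x);
         tbar = equid_nodes r x xbar;
         lbar = basic_iter r f x y tbar (r + 1);
         G = 8 / 3 * (norm (divided_diff (\<lambda>t. f t (lbar t)) tbar r 0) + \<beta>) * (1 + \<phi>);
         x' = x + min ((\<epsilon> / G) powr (1 / (real r + 1))) (b - x);
         l = basic_iter r f x y (equid_nodes (r - 1) x x') (r + 1)
     in (x', l x'))"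

definition adapt_state ::
  "nat \<Rightarrow> real \<Rightarrow> real \<Rightarrow> rvec \<Rightarrow> real \<Rightarrow> real \<Rightarrow> (real \<Rightarrow> real) \<Rightarrow> (real \<Rightarrow> rvec \<Rightarrow> rvec) \<Rightarrow> real \<Rightarrow> nat \<Rightarrow> real \<times> rvec" where
  "adapt_state r a b \<eta> \<beta> \<phi> h f \<epsilon> i = (adapt_step r b \<beta> \<phi> h f \<epsilon> ^^ i) (a, \<eta>)"

definition adapt_mesh ::
  "nat \<Rightarrow> real \<Rightarrow> real \<Rightarrow> rvec \<Rightarrow> real \<Rightarrow> real \<Rightarrow> (real \<Rightarrow> real) \<Rightarrow> (real \<Rightarrow> rvec \<Rightarrow> rvec) \<Rightarrow> real \<Rightarrow> nat \<Rightarrow> real" where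
  "adapt_mesh r a b \<eta> \<beta> \<phi> h f \<epsilon> i = fst (adapt_state r a b \<eta> \<beta> \<phi> h f \<epsilon> i)"

(* The index at which b is first reached; infinity if the algorithm does not stop. *)

definition mstar ::
  "nat \<Rightarrow> real \<Rightarrow> real \<Rightarrow> rvec \<Rightarrow> real \<Rightarrow> real \<Rightarrow> (real \<Rightarrow> real) \<Rightarrow> (real \<Rightarrow> rvec \<Rightarrow> rvec) \<Rightarrow> real \<Rightarrow> enat" where
  "mstar r a b \<eta> \<beta> \<phi> h f \<epsilon> = (INF i\<in>{i. adapt_mesh r a b \<eta> \<beta> \<phi> h f \<epsilon> i = b}. enat i)"


(* u = Theta(v) as the argument tends to 0 from the right, with constants c and C. *)

definition theta_with :: "real \<Rightarrow> real \<Rightarrow> (real \<Rightarrow> real) \<Rightarrow> (real \<Rightarrow> real) \<Rightarrow> bool" where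
  "theta_with c C u v \<longleftrightarrow> (\<forall>\<^sub>F \<epsilon> in at_right 0. c * v \<epsilon> \<le> u \<epsilon> \<and> u \<epsilon> \<le> C * v \<epsilon>)"

end

theory Submission
  imports Defs "HOL-Computational_Algebra.Polynomial"
begin

text \<open>
  The theorem compares three ways of counting subintervals, and everything rests on one fact: for
  every numerical trajectory that stays near the exact solution \<open>z\<close>, the quantity that steers the step
  size is \<open>\<parallel>z\<^sup>(\<^sup>r\<^sup>+\<^sup>1\<^sup>)\<parallel> / r!\<close> up to an error that vanishes uniformly as the steps shrink.

  Differentiating \<open>z' = f(t, z)\<close> repeatedly expresses \<open>z\<^sup>(\<^sup>j\<^sup>+\<^sup>1\<^sup>)(t)\<close> as \<open>\<Phi>\<^sub>j(t, z(t))\<close>, where the total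
  derivative \<open>\<Phi>\<^sub>j\<close> of \<open>f\<close> depends on \<open>f\<close> only (\<open>total_derivatives_exist\<close>, \<open>hderiv_along_trajectory\<close>).
  The same formula holds for every local solution in the domain of smoothness, so closeness of two
  solutions turns into closeness of their derivatives of order \<open>r + 1\<close> by continuity of \<open>\<Phi>\<^sub>r\<close>
  (\<open>total_deriv_near_z\<close>); no derivative of a numerical approximation is ever compared.
  Each sweep of the basic iteration gains one power of the step, until the interpolation error of
  order \<open>r + 1\<close> is reached (\<open>basic_iter_consistent\<close>). Since the error \<open>O(h\<^sup>r\<^sup>+\<^sup>1)\<close> survives division by
  \<open>h\<^sup>r\<close> as \<open>O(h)\<close>, the divided difference computed by the algorithm converges to
  \<open>z\<^sup>(\<^sup>r\<^sup>+\<^sup>1\<^sup>) / r!\<close> (\<open>divided_diff_consistent\<close>). Local errors accumulate to at most a constant times the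
  largest step (\<open>accumulated_error_bound\<close>), which keeps the adaptive algorithm, and any method
  satisfying the local error assumption, near \<open>z\<close>.

  For the first inequality take a mesh with costs \<open>c\<^sub>i h\<^sub>i\<^sup>r\<^sup>+\<^sup>1 \<le> (5/4) \<kappa> \<epsilon>\<close>, where \<open>\<kappa> \<le> 1/2\<close>.
  If the \<open>i\<close>-th adaptive node lies in the \<open>i\<close>-th cell, the coefficient used by the algorithm there is
  at most \<open>(4/3)(6/5) c\<^sub>i\<close>, so the remainder of the cell is an allowed step; hence the \<open>i\<close>-th
  adaptive node never falls behind the \<open>i\<close>-th node of the mesh (\<open>adapt_dominates\<close>), and the endpoint is
  reached at least as early. Uniform meshes are among the competitors of the optimal mesh, which
  gives the second inequality (\<open>mbar_properties\<close>).

  The equidistant count is exactly a ceiling, so scaling \<open>\<epsilon>\<close> by \<open>\<kappa>\<close> changes it by a factor depending on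
  \<open>\<kappa>\<close> only (\<open>mbar_equid_theta\<close>). For the method itself the factor \<open>1 + \<phi>\<close> together with \<open>\<beta> > 0\<close> leaves
  room for replacing local solutions by \<open>z\<close>, and the cell in which \<open>\<parallel>z\<^sup>(\<^sup>r\<^sup>+\<^sup>1\<^sup>)\<parallel>\<close> is maximal
  bounds its count from below (\<open>mhat_bounds\<close>).
\<close>


section \<open>Coordinates on the finite-dimensional space\<close>

text \<open>Vectors are bounded continuous functions on the natural numbers. Such function spaces are
  complete over metric domains; the usual distance, which induces the discrete topology, makes
  integrals of continuous curves available.\<close>

instantiation nat :: metric_space
begin

definition dist_nat :: "nat \<Rightarrow> nat \<Rightarrow> real" where
  "dist_nat m n = \<bar>real m - real n\<bar>"

definition uniformity_nat :: "(nat \<times> nat) filter" where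
  "uniformity_nat = (INF e\<in>{0<..}. principal {(x, y). dist x y < e})"

instance
proof
  show "uniformity = (INF e\<in>{0<..}. principal {(x::nat, y). dist x y < e})"
    by (rule uniformity_nat_def)
  have diag: "\<forall>\<^sub>F (x', y) in uniformity. x' = x \<longrightarrow> y = (x::nat)" for x
  proof -
    have "\<forall>\<^sub>F (x', y) in principal {(x::nat, y). dist x y < 1}. x' = x \<longrightarrow> y = x"
      unfolding eventually_principal by (auto simp: dist_nat_def)
    then show ?thesis
      unfolding uniformity_nat_def by (rule filter_leD[rotated]) (intro INF_lower, simp)
  qed
  have "\<forall>\<^sub>F (x', y) in uniformity. x' = x \<longrightarrow> y \<in> U" if "x \<in> U" for x and U :: "nat set"
    by (rule eventually_mono[OF diag[of x]]) (use that in auto)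
  then show "open U \<longleftrightarrow> (\<forall>x\<in>U. \<forall>\<^sub>F (x', y) in uniformity. x' = x \<longrightarrow> y \<in> U)" for U :: "nat set"
    by (simp add: open_discrete)
qed (auto simp: dist_nat_def)

end

instance bcontfun :: (metric_space, banach) banach ..

lemma bounded_linear_coord: "bounded_linear (\<lambda>v::rvec. apply_bcontfun v i)"
  by (rule bounded_linear_intro[where K = 1]) (use norm_bounded[of _ i, where 'b = real] in auto)

lemma subspace_Rd: "subspace (Rd d)"
  by (auto simp: subspace_def Rd_def)

lemma Rd_zero [simp]: "0 \<in> Rd d"
  by (simp add: Rd_def)

lemma Rd_add: "u \<in> Rd d \<Longrightarrow> v \<in> Rd d \<Longrightarrow> u + v \<in> Rd d"
  by (simp add: Rd_def)

lemma Rd_scaleR: "u \<in> Rd d \<Longrightarrow> c *\<^sub>R u \<in> Rd d"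
  by (simp add: Rd_def)

lemma Rd_sum: "(\<And>i. i \<in> I \<Longrightarrow> g i \<in> Rd d) \<Longrightarrow> sum g I \<in> Rd d"
  by (rule subspace_sum[OF subspace_Rd])

lemma Rd_integral:
  fixes s t :: real
  assumes "continuous_on {s..t} g" "\<And>u. u \<in> {s..t} \<Longrightarrow> g u \<in> Rd d"
  shows "integral {s..t} g \<in> Rd d"
proof -
  have "apply_bcontfun (integral {s..t} g) i = 0" if "d \<le> i" for i
  proof -
    have "apply_bcontfun (integral {s..t} g) i = integral {s..t} (\<lambda>u. apply_bcontfun (g u) i)"
      using integral_linear[OF integrable_continuous_real[OF assms(1)] bounded_linear_coord[of i]]
      by (simp add: o_def)
    also have "\<dots> = integral {s..t} (\<lambda>u. 0)"
      using assms(2) that by (intro integral_cong) (auto simp: Rd_def)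
    finally show ?thesis by simp
  qed
  then show ?thesis by (simp add: Rd_def)
qed

definition coord_vec :: "nat \<Rightarrow> rvec" where
  "coord_vec i = Bcontfun (\<lambda>j. if j = i then 1 else 0)"

lemma apply_coord_vec: "apply_bcontfun (coord_vec i) j = (if j = i then 1 else 0)"
  unfolding coord_vec_def
  by (subst Bcontfun_inverse) (auto intro!: bcontfun_normI[where b = 1])

lemma coord_vec_in_Rd: "i < d \<Longrightarrow> coord_vec i \<in> Rd d"
  by (auto simp: Rd_def apply_coord_vec)

definition truncate :: "nat \<Rightarrow> rvec \<Rightarrow> rvec" where
  "truncate d v = (\<Sum>i<d. apply_bcontfun v i *\<^sub>R coord_vec i)"

lemma apply_sum_bcontfun: "apply_bcontfun (sum g I) j = (\<Sum>i\<in>I. apply_bcontfun (g i :: rvec) j)"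
  by (induction I rule: infinite_finite_induct) auto

lemma apply_truncate: "apply_bcontfun (truncate d v) j = (if j < d then apply_bcontfun v j else 0)"
  by (simp add: truncate_def apply_sum_bcontfun apply_coord_vec if_distrib cong: if_cong)

lemma truncate_in_Rd: "truncate d v \<in> Rd d"
  by (simp add: Rd_def apply_truncate)

lemma truncate_Rd: "v \<in> Rd d \<Longrightarrow> truncate d v = v"
  by (rule bcontfun_eqI) (auto simp: apply_truncate Rd_def)

lemma norm_truncate_diff: "norm (truncate d v - truncate d w) \<le> norm (v - w)"
proof (rule norm_bound)
  fix j
  have "norm (apply_bcontfun (truncate d v - truncate d w) j) \<le> norm (apply_bcontfun (v - w) j)"
    by (simp add: apply_truncate)
  also have "\<dots> \<le> norm (v - w)" by (rule norm_bounded)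
  finally show "norm (apply_bcontfun (truncate d v - truncate d w) j) \<le> norm (v - w)" .
qed

lemma continuous_on_truncate [continuous_intros]:
  "continuous_on S g \<Longrightarrow> continuous_on S (\<lambda>x. truncate d (g x))"
  unfolding truncate_def
  by (intro continuous_intros bounded_linear.continuous_on[OF bounded_linear_coord])

section \<open>Existence and stability of solutions\<close>

text \<open>A weighted supremum norm turns the Picard operator into a contraction on the whole interval, so
  that no gluing of short solutions is needed. The unknown is \<open>exp (- \<mu> (t - s)) z(t)\<close>, extended
  constantly beyond the interval to be a bounded continuous function on the line.\<close>

lemma picard_lindelof:
  fixes F :: "real \<Rightarrow> 'a::banach \<Rightarrow> 'a"
  assumes "s \<le> T" and cont: "continuous_on ({s..T} \<times> UNIV) (\<lambda>(t, y). F t y)"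
    and lip: "\<And>t y y'. t \<in> {s..T} \<Longrightarrow> norm (F t y - F t y') \<le> L * norm (y - y')"
  obtains z where "z s = y" "continuous_on {s..T} z"
    "\<And>t. t \<in> {s..T} \<Longrightarrow> z t = y + integral {s..t} (\<lambda>u. F u (z u))"
    "\<And>t. t \<in> {s..T} \<Longrightarrow> (z has_vector_derivative F t (z t)) (at t within {s..T})"
proof -
  \<comment> \<open>Twice the Lipschitz constant makes the contraction factor \<open>1/2\<close>; the summand 1 covers \<open>L = 0\<close>.\<close>
  define \<mu> where "\<mu> = 2 * \<bar>L\<bar> + 1"
  have \<mu>: "0 < \<mu>" "\<bar>L\<bar> / \<mu> \<le> 1/2" by (auto simp: \<mu>_def field_simps)
  define W :: "(real \<Rightarrow>\<^sub>C 'a) \<Rightarrow> real \<Rightarrow> 'a" where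
    "W v t = exp (- \<mu> * (t - s)) *\<^sub>R
       (y + integral {s..t} (\<lambda>u. F u (exp (\<mu> * (u - s)) *\<^sub>R apply_bcontfun v u)))" for v t
  have contF: "continuous_on {s..T} (\<lambda>u. F u (w u))" if "continuous_on {s..T} w" for w
  proof -
    have "continuous_on {s..T} (\<lambda>u. (\<lambda>(t, y). F t y) (u, w u))"
      by (rule continuous_on_compose2[OF cont]) (auto intro!: continuous_intros that)
    then show ?thesis by simp
  qed
  have contI: "continuous_on {s..T} (\<lambda>u. F u (exp (\<mu> * (u - s)) *\<^sub>R apply_bcontfun v u))" for v
    by (intro contF continuous_intros continuous_on_apply_bcontfun)
  have "\<forall>v. \<exists>g::real \<Rightarrow>\<^sub>C 'a. (\<forall>t\<in>{s..T}. apply_bcontfun g t = W v t) \<and>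
      (\<forall>t. apply_bcontfun g t = W v (clamp s T t))"
  proof
    fix v
    have "continuous_on (cbox s T) (W v)"
      unfolding W_def cbox_interval
      by (intro continuous_intros indefinite_integral_continuous_1 integrable_continuous_real contI)
    then show "\<exists>g::real \<Rightarrow>\<^sub>C 'a. (\<forall>t\<in>{s..T}. apply_bcontfun g t = W v t) \<and>
      (\<forall>t. apply_bcontfun g t = W v (clamp s T t))"
      by (rule continuous_on_cbox_bcontfunE) (metis cbox_interval)
  qed
  then obtain \<Phi> :: "(real \<Rightarrow>\<^sub>C 'a) \<Rightarrow> (real \<Rightarrow>\<^sub>C 'a)" where
    \<Phi>: "\<And>v t. t \<in> {s..T} \<Longrightarrow> apply_bcontfun (\<Phi> v) t = W v t"
       "\<And>v t. apply_bcontfun (\<Phi> v) t = W v (clamp s T t)"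
    by metis
  have contr: "dist (W v t) (W w t) \<le> 1/2 * dist v w" if t: "t \<in> {s..T}" for v w t
  proof -
    let ?I = "\<lambda>v u. F u (exp (\<mu> * (u - s)) *\<^sub>R apply_bcontfun v u)"
    let ?D = "dist v w"
    have sub: "{s..t} \<subseteq> {s..T}" using t by auto
    have int: "(?I v) integrable_on {s..t}" for v
      using continuous_on_subset[OF contI sub] by (rule integrable_continuous_real)
    have ex: "((\<lambda>u. \<bar>L\<bar> * ?D * exp (\<mu> * (u - s))) has_integral
        (\<bar>L\<bar> * ?D / \<mu> * exp (\<mu> * (t - s)) - \<bar>L\<bar> * ?D / \<mu> * exp (\<mu> * (s - s)))) {s..t}"
      using t \<mu> by (intro fundamental_theorem_of_calculus)
        (auto intro!: derivative_eq_intros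
          simp flip: has_real_derivative_iff_has_vector_derivative)
    have "norm (integral {s..t} (?I v) - integral {s..t} (?I w))
        = norm (integral {s..t} (\<lambda>u. ?I v u - ?I w u))"
      using int by (simp add: integral_diff)
    also have "\<dots> \<le> integral {s..t} (\<lambda>u. \<bar>L\<bar> * ?D * exp (\<mu> * (u - s)))"
    proof (rule integral_norm_bound_integral)
      show "(\<lambda>u. ?I v u - ?I w u) integrable_on {s..t}" using int by (intro integrable_diff)
      show "(\<lambda>u. \<bar>L\<bar> * ?D * exp (\<mu> * (u - s))) integrable_on {s..t}" using ex by blast
      fix u assume u: "u \<in> {s..t}"
      have "norm (?I v u - ?I w u) \<le>
          L * norm (exp (\<mu> * (u - s)) *\<^sub>R apply_bcontfun v u - exp (\<mu> * (u - s)) *\<^sub>R apply_bcontfun w u)"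
        using u sub by (intro lip) auto
      also have "\<dots> = L * (exp (\<mu> * (u - s)) * dist (apply_bcontfun v u) (apply_bcontfun w u))"
        by (simp add: dist_norm flip: scaleR_diff_right)
      also have "\<dots> \<le> \<bar>L\<bar> * (exp (\<mu> * (u - s)) * ?D)"
        by (intro mult_mono) (auto intro: dist_bounded)
      finally show "norm (?I v u - ?I w u) \<le> \<bar>L\<bar> * ?D * exp (\<mu> * (u - s))"
        by (simp add: mult_ac)
    qed
    also have "\<dots> = \<bar>L\<bar> * ?D / \<mu> * exp (\<mu> * (t - s)) - \<bar>L\<bar> * ?D / \<mu>"
      using integral_unique[OF ex] by simp
    also have "\<dots> \<le> \<bar>L\<bar> / \<mu> * ?D * exp (\<mu> * (t - s))"
      using \<mu> by simp
    also have "\<dots> \<le> 1/2 * ?D * exp (\<mu> * (t - s))"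
      using \<mu> by (intro mult_right_mono) auto
    finally have *: "norm (integral {s..t} (?I v) - integral {s..t} (?I w))
        \<le> 1/2 * ?D * exp (\<mu> * (t - s))" .
    have "dist (W v t) (W w t) = exp (- \<mu> * (t - s)) *
        norm (integral {s..t} (?I v) - integral {s..t} (?I w))"
      by (simp add: W_def dist_norm flip: scaleR_diff_right)
    also have "\<dots> \<le> exp (- \<mu> * (t - s)) * (1/2 * ?D * exp (\<mu> * (t - s)))"
      by (intro mult_left_mono *) auto
    also have "\<dots> = 1/2 * ?D" by (simp add: exp_minus)
    finally show ?thesis .
  qed
  have "\<exists>!v. \<Phi> v = v"
  proof (rule banach_fix_type[where c = "1/2"])
    have cl: "clamp s T t \<in> {s..T}" for t
      using clamp_in_interval[of s T t] \<open>s \<le> T\<close> by simp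
    show "\<forall>v w. dist (\<Phi> v) (\<Phi> w) \<le> 1/2 * dist v w"
      by (intro allI dist_bound) (auto simp only: \<Phi>(2) intro!: contr cl)
  qed auto
  then obtain v where v: "\<Phi> v = v" by blast
  define z where "z t = exp (\<mu> * (t - s)) *\<^sub>R apply_bcontfun v t" for t
  have z_eq: "z t = y + integral {s..t} (\<lambda>u. F u (z u))" if "t \<in> {s..T}" for t
  proof -
    have "apply_bcontfun v t = W v t" using \<Phi>(1)[OF that, of v] v by simp
    then show ?thesis by (simp add: z_def W_def exp_minus)
  qed
  have z_cont: "continuous_on {s..T} z"
    unfolding z_def by (intro continuous_intros continuous_on_apply_bcontfun)
  have "((\<lambda>t. y + integral {s..t} (\<lambda>u. F u (z u))) has_vector_derivative F t (z t)) (at t within {s..T})"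
    if "t \<in> {s..T}" for t
    using integral_has_vector_derivative[OF contF[OF z_cont] that]
    by (auto intro!: derivative_eq_intros)
  then have "(z has_vector_derivative F t (z t)) (at t within {s..T})" if "t \<in> {s..T}" for t
    using that z_eq by (metis (no_types, lifting) has_vector_derivative_transform)
  with z_eq z_cont \<open>s \<le> T\<close> show ?thesis by (intro that[of z]) auto
qed

lemma vector_derivative_norm_bound:
  fixes w :: "real \<Rightarrow> 'a::real_normed_vector"
  assumes "\<And>u. u \<in> {s..T} \<Longrightarrow> (w has_vector_derivative w' u) (at u within {s..T})"
    and "\<And>u. u \<in> {s..T} \<Longrightarrow> norm (w' u) \<le> B" and "t \<in> {s..T}"
  shows "norm (w t - w s) \<le> B * (t - s)"
proof -
  have "norm (w t - w s) \<le> B * norm (t - s)"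
  proof (rule differentiable_bound[of "{s..T}" w "\<lambda>u h. h *\<^sub>R w' u"])
    show "onorm (\<lambda>h. h *\<^sub>R w' x) \<le> B" if "x \<in> {s..T}" for x
    proof (rule onorm_bound)
      show "0 \<le> B" using assms(2)[OF that] norm_ge_zero[of "w' x"] by linarith
      show "norm (h *\<^sub>R w' x) \<le> B * norm h" for h
        using mult_left_mono[OF assms(2)[OF that], of "\<bar>h\<bar>"] by (simp add: mult.commute)
    qed
  qed (use assms in \<open>auto simp: has_vector_derivative_def\<close>)
  then show ?thesis using assms(3) by simp
qed

text \<open>This replaces Gronwall's inequality: if the maximum of \<open>\<parallel>w\<parallel>\<close> is \<open>m\<close>, then \<open>w\<close> moves by at most
  \<open>L (T - s) m \<le> m / 2\<close>, which bounds \<open>m\<close> by twice the initial value. Feeding this back gives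
  the one-step factor \<open>1 + O(T - s)\<close>, the form in which errors can be accumulated over a mesh.\<close>

lemma short_interval_stability:
  fixes w :: "real \<Rightarrow> 'a::real_normed_vector"
  assumes der: "\<And>u. u \<in> {s..T} \<Longrightarrow> (w has_vector_derivative w' u) (at u within {s..T})"
    and lip: "\<And>u. u \<in> {s..T} \<Longrightarrow> norm (w' u) \<le> L * norm (w u)"
    and "s \<le> T" "0 \<le> L" "L * (T - s) \<le> 1/2"
  shows "t \<in> {s..T} \<Longrightarrow> norm (w t) \<le> 2 * norm (w s)"
    and "norm (w T) \<le> (1 + 2 * L * (T - s)) * norm (w s)"
proof -
  have "continuous_on {s..T} (\<lambda>u. norm (w u))"
    using der by (intro continuous_intros) (meson continuous_on_vector_derivative)
  then obtain m where m: "m \<in> {s..T}" "\<And>u. u \<in> {s..T} \<Longrightarrow> norm (w u) \<le> norm (w m)"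
    using continuous_attains_sup[of "{s..T}" "\<lambda>u. norm (w u)"] \<open>s \<le> T\<close> by force
  have inc: "norm (w u - w s) \<le> L * norm (w m) * (u - s)" if "u \<in> {s..T}" for u
    by (rule vector_derivative_norm_bound[OF der _ that])
       (use lip m(2) \<open>0 \<le> L\<close> in \<open>blast intro: order_trans mult_left_mono\<close>)+
  have "norm (w m - w s) \<le> L * norm (w m) * (T - s)"
    using inc[OF m(1)] m(1) \<open>0 \<le> L\<close>
    by (meson atLeastAtMost_iff diff_right_mono mult_left_mono mult_nonneg_nonneg norm_ge_zero order_trans)
  also have "\<dots> \<le> norm (w m) / 2"
    using mult_right_mono[OF assms(5) norm_ge_zero[of "w m"]] by (simp add: mult_ac)
  finally have wm: "norm (w m) \<le> 2 * norm (w s)"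
    using norm_triangle_ineq2[of "w m" "w s"] by linarith
  then show "norm (w t) \<le> 2 * norm (w s)" if "t \<in> {s..T}"
    using m(2)[OF that] by linarith
  have "norm (w T - w s) \<le> L * norm (w m) * (T - s)" using inc \<open>s \<le> T\<close> by auto
  also have "\<dots> \<le> L * (2 * norm (w s)) * (T - s)"
    using wm \<open>0 \<le> L\<close> \<open>s \<le> T\<close> by (intro mult_right_mono mult_left_mono) auto
  finally show "norm (w T) \<le> (1 + 2 * L * (T - s)) * norm (w s)"
    using norm_triangle_ineq2[of "w T" "w s"] by (simp add: algebra_simps)
qed

section \<open>Derivatives along trajectories\<close>

lemma Ck_on_Suc_imp: "Ck_on (Suc k) U S g \<Longrightarrow> Ck_on k U S g"
proof (induction k arbitrary: g)
  case 0
  then show ?case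
    by (auto simp: continuous_on_eq_continuous_within intro: has_derivative_continuous)
next
  case (Suc k)
  then show ?case by (metis Ck_on.simps(2))
qed

lemma Ck_on_continuous: "Ck_on k U S g \<Longrightarrow> continuous_on S g"
  by (induction k) (auto dest: Ck_on_Suc_imp simp del: Ck_on.simps(2))

lemma Ck_on_zero: "Ck_on k U S (\<lambda>x. 0)"
proof (induction k)
  case (Suc k)
  then show ?case by (auto intro!: exI[of _ "\<lambda>x h. 0"])
qed auto

lemma Ck_on_add:
  "Ck_on k U S g \<Longrightarrow> Ck_on k U S h \<Longrightarrow> Ck_on k U S (\<lambda>x. g x + h x)"
proof (induction k arbitrary: g h)
  case 0
  then show ?case by (auto intro: continuous_intros)
next
  case (Suc k)
  obtain g' where g': "\<And>x. x \<in> S \<Longrightarrow> (g has_derivative g' x) (at x within S)"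
    "\<And>u. u \<in> U \<Longrightarrow> Ck_on k U S (\<lambda>x. g' x u)" using Suc.prems(1) by auto
  obtain h' where h': "\<And>x. x \<in> S \<Longrightarrow> (h has_derivative h' x) (at x within S)"
    "\<And>u. u \<in> U \<Longrightarrow> Ck_on k U S (\<lambda>x. h' x u)" using Suc.prems(2) by auto
  show ?case
    using g' h' by (auto intro!: exI[of _ "\<lambda>x v. g' x v + h' x v"] has_derivative_add Suc.IH)
qed

lemma Ck_on_sum:
  "finite I \<Longrightarrow> (\<And>i. i \<in> I \<Longrightarrow> Ck_on k U S (g i)) \<Longrightarrow> Ck_on k U S (\<lambda>x. \<Sum>i\<in>I. g i x)"
  by (induction I rule: finite_induct) (auto intro: Ck_on_zero Ck_on_add)

lemma Ck_on_scaleR: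
  "Ck_on k U S (g :: _ \<Rightarrow> real) \<Longrightarrow> Ck_on k U S h \<Longrightarrow> Ck_on k U S (\<lambda>x. g x *\<^sub>R h x)"
proof (induction k arbitrary: g h)
  case 0
  then show ?case by (auto intro: continuous_intros)
next
  case (Suc k)
  obtain g' where g': "\<And>x. x \<in> S \<Longrightarrow> (g has_derivative g' x) (at x within S)"
    "\<And>u. u \<in> U \<Longrightarrow> Ck_on k U S (\<lambda>x. g' x u)" using Suc.prems(1) by auto
  obtain h' where h': "\<And>x. x \<in> S \<Longrightarrow> (h has_derivative h' x) (at x within S)"
    "\<And>u. u \<in> U \<Longrightarrow> Ck_on k U S (\<lambda>x. h' x u)" using Suc.prems(2) by auto
  show ?case
    unfolding Ck_on.simps
    using g' h' Ck_on_Suc_imp[OF Suc.prems(1)] Ck_on_Suc_imp[OF Suc.prems(2)]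
    by (intro exI[of _ "\<lambda>x v. g x *\<^sub>R h' x v + g' x v *\<^sub>R h x"] conjI ballI has_derivative_scaleR
        Ck_on_add Suc.IH) auto
qed

lemma Ck_on_bounded_linear:
  assumes "bounded_linear A"
  shows "Ck_on k U S g \<Longrightarrow> Ck_on k U S (\<lambda>x. A (g x))"
proof (induction k arbitrary: g)
  case 0
  then show ?case by (auto intro: bounded_linear.continuous_on[OF assms])
next
  case (Suc k)
  obtain g' where g': "\<And>x. x \<in> S \<Longrightarrow> (g has_derivative g' x) (at x within S)"
    "\<And>u. u \<in> U \<Longrightarrow> Ck_on k U S (\<lambda>x. g' x u)" using Suc.prems by auto
  then show ?case
    by (auto intro!: exI[of _ "\<lambda>x v. A (g' x v)"] bounded_linear.has_derivative[OF assms] Suc.IH)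
qed

definition trajectory_in ::
  "(real \<Rightarrow> rvec \<Rightarrow> rvec) \<Rightarrow> (real \<times> rvec) set \<Rightarrow> real \<Rightarrow> real \<Rightarrow> (real \<Rightarrow> rvec) \<Rightarrow> bool" where
  "trajectory_in f S s T w \<longleftrightarrow>
     (\<forall>u\<in>{s..T}. (u, w u) \<in> S \<and> (w has_vector_derivative f u (w u)) (at u within {s..T}))"

text \<open>The chain rule along a trajectory needs the derivative of \<open>\<Phi>\<close> in the direction \<open>(1, f(t, y))\<close>, which
  varies with the point, whereas smoothness is given for fixed directions. Splitting the direction
  into coordinates expresses the result by finitely many fixed directions.\<close>

lemma total_derivative_exists:
  fixes \<Phi> :: "real \<times> rvec \<Rightarrow> 'b::real_normed_vector"
  assumes \<Phi>: "Ck_on (Suc k) (UNIV \<times> Rd d) S \<Phi>" and f: "Ck_on k (UNIV \<times> Rd d) S (\<lambda>(t, y). f t y)"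
    and fRd: "\<And>t y. (t, y) \<in> S \<Longrightarrow> f t y \<in> Rd d"
  obtains \<Psi> where "Ck_on k (UNIV \<times> Rd d) S \<Psi>"
    "\<forall>s T w. trajectory_in f S s T w \<longrightarrow> (\<forall>t\<in>{s..T}.
       ((\<lambda>u. \<Phi> (u, w u)) has_vector_derivative \<Psi> (t, w t)) (at t within {s..T}))"
proof -
  obtain \<Phi>' where \<Phi>': "\<And>p. p \<in> S \<Longrightarrow> (\<Phi> has_derivative \<Phi>' p) (at p within S)"
    "\<And>u. u \<in> UNIV \<times> Rd d \<Longrightarrow> Ck_on k (UNIV \<times> Rd d) S (\<lambda>p. \<Phi>' p u)"
    using \<Phi> by auto
  define \<Psi> where "\<Psi> p = \<Phi>' p (1, 0) +
      (\<Sum>i<d. apply_bcontfun (case p of (t, y) \<Rightarrow> f t y) i *\<^sub>R \<Phi>' p (0, coord_vec i))" for p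
  have \<Psi>_eq: "\<Phi>' (t, y) (h, h *\<^sub>R f t y) = h *\<^sub>R \<Psi> (t, y)" if "(t, y) \<in> S" for t y h
  proof -
    interpret bounded_linear "\<Phi>' (t, y)"
      using \<Phi>'(1)[OF that] by (rule has_derivative_bounded_linear)
    have "(h, h *\<^sub>R f t y) = h *\<^sub>R ((1, 0) + (\<Sum>i<d. apply_bcontfun (f t y) i *\<^sub>R (0, coord_vec i)))"
      using truncate_Rd[OF fRd[OF that]]
      by (simp add: prod_eq_iff fst_sum snd_sum truncate_def)
    then show ?thesis by (simp only: scaleR add sum) (simp add: \<Psi>_def)
  qed
  have "((\<lambda>u. \<Phi> (u, w u)) has_vector_derivative \<Psi> (t, w t)) (at t within {s..T})"
    if w: "trajectory_in f S s T w" and t: "t \<in> {s..T}" for s T w t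
  proof -
    have tS: "(t, w t) \<in> S" using w t by (auto simp: trajectory_in_def)
    have sub: "(\<lambda>u. (u, w u)) ` {s..T} \<subseteq> S" using w by (auto simp: trajectory_in_def)
    have "((\<lambda>u. (u, w u)) has_derivative (\<lambda>h. (h, h *\<^sub>R f t (w t)))) (at t within {s..T})"
      using w t unfolding trajectory_in_def has_vector_derivative_def
      by (intro has_derivative_Pair has_derivative_ident) blast
    from diff_chain_within[OF this has_derivative_subset[OF \<Phi>'(1)[OF tS] sub]]
    show ?thesis using \<Psi>_eq[OF tS] by (simp add: has_vector_derivative_def o_def)
  qed
  moreover have "Ck_on k (UNIV \<times> Rd d) S \<Psi>"
    unfolding \<Psi>_def
    by (intro Ck_on_add Ck_on_sum Ck_on_scaleR \<Phi>' Ck_on_bounded_linear[OF bounded_linear_coord] f)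
       (auto intro: coord_vec_in_Rd)
  ultimately show ?thesis using that by blast
qed

lemma total_derivatives_exist:
  fixes \<Phi>0 :: "real \<times> rvec \<Rightarrow> 'b::real_normed_vector"
  assumes "Ck_on k (UNIV \<times> Rd d) S \<Phi>0" "Ck_on k (UNIV \<times> Rd d) S (\<lambda>(t, y). f t y)"
    and fRd: "\<And>t y. (t, y) \<in> S \<Longrightarrow> f t y \<in> Rd d"
  shows "\<exists>\<Phi>. \<Phi> 0 = \<Phi>0 \<and> (\<forall>j\<le>k. continuous_on S (\<Phi> j)) \<and>
    (\<forall>j<k. \<forall>s T w. trajectory_in f S s T w \<longrightarrow> (\<forall>t\<in>{s..T}.
       ((\<lambda>u. \<Phi> j (u, w u)) has_vector_derivative \<Phi> (Suc j) (t, w t)) (at t within {s..T})))"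
  using assms(1,2)
proof (induction k arbitrary: \<Phi>0)
  case 0
  then show ?case by (intro exI[of _ "\<lambda>_. \<Phi>0"]) auto
next
  case (Suc k)
  obtain \<Psi> where \<Psi>: "Ck_on k (UNIV \<times> Rd d) S \<Psi>"
    "\<forall>s T w. trajectory_in f S s T w \<longrightarrow> (\<forall>t\<in>{s..T}.
       ((\<lambda>u. \<Phi>0 (u, w u)) has_vector_derivative \<Psi> (t, w t)) (at t within {s..T}))"
    by (rule total_derivative_exists[OF Suc.prems(1) Ck_on_Suc_imp[OF Suc.prems(2)] fRd]) blast
  from Suc.IH[OF \<Psi>(1) Ck_on_Suc_imp[OF Suc.prems(2)]]
  obtain \<Phi> where \<Phi>: "\<Phi> 0 = \<Psi>" "\<forall>j\<le>k. continuous_on S (\<Phi> j)"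
    "\<forall>j<k. \<forall>s T w. trajectory_in f S s T w \<longrightarrow> (\<forall>t\<in>{s..T}.
       ((\<lambda>u. \<Phi> j (u, w u)) has_vector_derivative \<Phi> (Suc j) (t, w t)) (at t within {s..T}))"
    by blast
  show ?case
  proof (intro exI[of _ "case_nat \<Phi>0 \<Phi>"] conjI allI impI ballI)
    fix j assume "j \<le> Suc k"
    then show "continuous_on S (case_nat \<Phi>0 \<Phi> j)"
      using \<Phi>(2) Ck_on_continuous[OF Suc.prems(1)] by (cases j) auto
  next
    fix j s T w t
    assume "j < Suc k" "trajectory_in f S s T w" "t \<in> {s..T}"
    then show "((\<lambda>u. case_nat \<Phi>0 \<Phi> j (u, w u)) has_vector_derivative
        case_nat \<Phi>0 \<Phi> (Suc j) (t, w t)) (at t within {s..T})"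
      using \<Phi> \<Psi>(2) by (cases j) auto
  qed simp
qed

text \<open>One-sided derivatives of any order of a trajectory are functions of its current position, the
  same functions for all trajectories and all intervals. This is what makes derivatives of local
  solutions on different meshes comparable.\<close>

lemma hderiv_along_trajectory:
  fixes \<Phi> :: "nat \<Rightarrow> real \<times> rvec \<Rightarrow> rvec"
  assumes "s < T" and w: "trajectory_in f S s T w"
    and \<Phi>0: "\<And>t y. \<Phi> 0 (t, y) = f t y"
    and \<Phi>: "\<And>j t. j < r \<Longrightarrow> t \<in> {s..T} \<Longrightarrow>
      ((\<lambda>u. \<Phi> j (u, w u)) has_vector_derivative \<Phi> (Suc j) (t, w t)) (at t within {s..T})"
  shows "j \<le> r \<Longrightarrow> t \<in> {s..T} \<Longrightarrow> hderiv {s..T} (Suc j) w t = \<Phi> j (t, w t)"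
    and "hdifferentiable_on {s..T} (Suc r) w"
proof -
  have vd: "vector_derivative g (at t within {s..T}) = g'"
    if "(g has_vector_derivative g') (at t within {s..T})" "t \<in> {s..T}" for g g' t
    using vector_derivative_within_cbox[of s T t g g'] that \<open>s < T\<close> by (simp add: cbox_interval)
  have hd: "\<forall>t\<in>{s..T}. hderiv {s..T} (Suc j) w t = \<Phi> j (t, w t)" if "j \<le> r" for j
    using that
  proof (induction j)
    case 0
    then show ?case using w by (auto simp: trajectory_in_def \<Phi>0 intro!: vd)
  next
    case (Suc j)
    show ?case
    proof
      fix t assume t: "t \<in> {s..T}"
      have "(hderiv {s..T} (Suc j) w has_vector_derivative \<Phi> (Suc j) (t, w t)) (at t within {s..T})"
        using \<Phi>[of j t] t Suc by (intro has_vector_derivative_transform[OF t _ \<Phi>]) auto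
      from vd[OF this t] show "hderiv {s..T} (Suc (Suc j)) w t = \<Phi> (Suc j) (t, w t)" by simp
    qed
  qed
  then show "j \<le> r \<Longrightarrow> t \<in> {s..T} \<Longrightarrow> hderiv {s..T} (Suc j) w t = \<Phi> j (t, w t)" by blast
  show "hdifferentiable_on {s..T} (Suc r) w"
    unfolding hdifferentiable_on_def
  proof (intro allI impI ballI)
    fix j t assume j: "j < Suc r" and t: "t \<in> {s..T}"
    show "hderiv {s..T} j w differentiable at t within {s..T}"
    proof (cases j)
      case 0
      then show ?thesis using w t by (auto simp: trajectory_in_def intro: differentiableI_vector)
    next
      case (Suc i)
      have "(hderiv {s..T} (Suc i) w has_vector_derivative \<Phi> (Suc i) (t, w t)) (at t within {s..T})"
        using j t Suc hd[of i] by (intro has_vector_derivative_transform[OF t _ \<Phi>]) auto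
      then show ?thesis using Suc by (auto intro: differentiableI_vector)
    qed
  qed
qed

section \<open>Polynomial interpolation and divided differences at equidistant nodes\<close>

lemma equid_nodes_in:
  assumes "\<sigma> \<le> \<tau>" "j \<le> n"
  shows "equid_nodes n \<sigma> \<tau> j \<in> {\<sigma>..\<tau>}"
proof (cases "n = 0")
  case False
  have "real j * ((\<tau> - \<sigma>) / real n) \<le> real n * ((\<tau> - \<sigma>) / real n)"
    using assms by (intro mult_right_mono) auto
  also have "\<dots> = \<tau> - \<sigma>" using False by simp
  finally show ?thesis using assms by (simp add: equid_nodes_def)
qed (use assms in \<open>simp add: equid_nodes_def\<close>)

lemma equid_nodes_diff:
  "equid_nodes n \<sigma> \<tau> i - equid_nodes n \<sigma> \<tau> j = (real i - real j) * ((\<tau> - \<sigma>) / real n)"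
  by (simp add: equid_nodes_def left_diff_distrib diff_divide_distrib)

lemma equid_nodes_inj:
  assumes "\<sigma> < \<tau>" "r \<le> Suc n"
  shows "inj_on (equid_nodes n \<sigma> \<tau>) {..<r}"
proof (rule inj_onI)
  fix i j assume *: "i \<in> {..<r}" "j \<in> {..<r}" "equid_nodes n \<sigma> \<tau> i = equid_nodes n \<sigma> \<tau> j"
  show "i = j"
  proof (cases "n = 0")
    case False
    then show ?thesis using equid_nodes_diff[of n \<sigma> \<tau> i j] * assms by simp
  qed (use * assms in auto)
qed

text \<open>The condition \<open>n \<le> r \<le> n + 1\<close> covers both node families of the algorithm: the first \<open>r\<close> of \<open>r + 1\<close>
  equidistant points, and \<open>r\<close> equidistant points including both ends. For \<open>n = 0\<close> there is a single
  node and the product is empty.\<close>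

lemma lagrange_weight_bound:
  assumes "\<sigma> < \<tau>" "n \<le> r" "r \<le> Suc n" "j < r" "t \<in> {\<sigma>..\<tau>}"
  shows "\<bar>\<Prod>k\<in>{..<r} - {j}. (t - equid_nodes n \<sigma> \<tau> k) / (equid_nodes n \<sigma> \<tau> j - equid_nodes n \<sigma> \<tau> k)\<bar>
    \<le> real r ^ r"
proof -
  let ?s = "equid_nodes n \<sigma> \<tau>"
  have "\<bar>(t - ?s k) / (?s j - ?s k)\<bar> \<le> real r" if k: "k \<in> {..<r} - {j}" for k
  proof -
    have n: "0 < n" using k assms by auto
    have "?s k \<in> {\<sigma>..\<tau>}" using k assms by (intro equid_nodes_in) auto
    then have num: "\<bar>t - ?s k\<bar> \<le> \<tau> - \<sigma>" using assms by auto
    have "1 \<le> \<bar>real j - real k\<bar>" using k by auto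
    then have "1 * ((\<tau> - \<sigma>) / real n) \<le> \<bar>real j - real k\<bar> * ((\<tau> - \<sigma>) / real n)"
      using assms by (intro mult_right_mono) auto
    then have den: "(\<tau> - \<sigma>) / real n \<le> \<bar>?s j - ?s k\<bar>"
      using assms by (simp add: equid_nodes_diff abs_mult abs_divide)
    have "\<bar>(t - ?s k) / (?s j - ?s k)\<bar> \<le> (\<tau> - \<sigma>) / ((\<tau> - \<sigma>) / real n)"
      unfolding abs_divide using num den assms n by (intro frac_le) auto
    also have "\<dots> \<le> real r" using assms n by simp
    finally show ?thesis .
  qed
  then show ?thesis
    unfolding abs_prod using assms by (intro prod_le_power) (auto simp del: abs_divide)
qed

text \<open>The Lebesgue constant of equidistant interpolation is bounded independently of the interval.\<close>

lemma lagrange_interp_bound: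
  assumes "\<sigma> < \<tau>" "n \<le> r" "r \<le> Suc n" "t \<in> {\<sigma>..\<tau>}"
    and "\<And>u. u \<in> {\<sigma>..\<tau>} \<Longrightarrow> norm (g u) \<le> B"
  shows "norm (lagrange_interp r (equid_nodes n \<sigma> \<tau>) g t) \<le> real r ^ Suc r * B"
proof -
  have "norm (lagrange_interp r (equid_nodes n \<sigma> \<tau>) g t) \<le> (\<Sum>j<r. real r ^ r * B)"
    unfolding lagrange_interp_def
  proof (rule sum_norm_le)
    fix j assume j: "j \<in> {..<r}"
    have "equid_nodes n \<sigma> \<tau> j \<in> {\<sigma>..\<tau>}" using j assms by (intro equid_nodes_in) auto
    then show "norm ((\<Prod>k\<in>{..<r} - {j}. (t - equid_nodes n \<sigma> \<tau> k) /
        (equid_nodes n \<sigma> \<tau> j - equid_nodes n \<sigma> \<tau> k)) *\<^sub>R g (equid_nodes n \<sigma> \<tau> j)) \<le> real r ^ r * B"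
      unfolding norm_scaleR using j assms
      by (intro mult_mono lagrange_weight_bound) auto
  qed
  then show ?thesis by simp
qed

lemma lagrange_interp_diff:
  "lagrange_interp r s (\<lambda>u. g u - h u) t = lagrange_interp r s g t - lagrange_interp r s h t"
  by (simp add: lagrange_interp_def scaleR_diff_right sum_subtractf)

lemma continuous_on_lagrange_interp: "continuous_on S (lagrange_interp r s g)"
  unfolding lagrange_interp_def divide_inverse by (intro continuous_intros)

text \<open>Interpolation reproduces polynomials of degree below \<open>r\<close>: the two sides agree at \<open>r\<close> distinct
  nodes, and both have degree below \<open>r\<close>.\<close>

lemma lagrange_interp_monomial:
  fixes s :: "nat \<Rightarrow> real"
  assumes inj: "inj_on s {..<r}" and "i < r"
  shows "(\<Sum>j<r. (\<Prod>k\<in>{..<r} - {j}. (t - s k) / (s j - s k)) * (s j - c) ^ i) = (t - c) ^ i"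
proof -
  define q where "q j = (\<Prod>k\<in>{..<r} - {j}. smult (1 / (s j - s k)) [:- s k, 1:])" for j
  define p where "p = (\<Sum>j<r. smult ((s j - c) ^ i) (q j))"
  have q: "poly (q j) x = (\<Prod>k\<in>{..<r} - {j}. (x - s k) / (s j - s k))" for j x
    unfolding q_def poly_prod by (intro prod.cong) (auto simp: diff_divide_distrib)
  have p: "poly p x = (\<Sum>j<r. (\<Prod>k\<in>{..<r} - {j}. (x - s k) / (s j - s k)) * (s j - c) ^ i)" for x
    unfolding p_def poly_sum by (intro sum.cong) (auto simp: q)
  have dq: "degree (q j) < r" if "j < r" for j
  proof -
    have "degree (q j) \<le> (\<Sum>k\<in>{..<r} - {j}. degree (smult (1 / (s j - s k)) [:- s k, 1:]))"
      unfolding q_def by (rule degree_prod_sum_le[unfolded o_def]) auto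
    also have "\<dots> \<le> (\<Sum>k\<in>{..<r} - {j}. 1)"
      by (intro sum_mono) (auto intro: order_trans[OF degree_smult_le])
    also have "\<dots> < r" using that by simp
    finally show ?thesis .
  qed
  have "p = [:- c, 1:] ^ i"
  proof (rule poly_eqI_degree[of "s ` {..<r}"])
    fix x assume "x \<in> s ` {..<r}"
    then obtain l where l: "l < r" "x = s l" by auto
    have z: "(\<Prod>k\<in>{..<r} - {j}. (s l - s k) / (s j - s k)) = (if j = l then 1 else 0)" if "j < r" for j
    proof (cases "j = l")
      case True
      have "(s l - s k) / (s l - s k) = 1" if "k \<in> {..<r} - {l}" for k
        using inj_onD[OF inj, of l k] that l by auto
      then show ?thesis using True by (simp add: prod.neutral)
    qed (use l in \<open>auto intro!: prod_zero\<close>)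
    have "poly p x = (\<Sum>j<r. (if j = l then 1 else 0) * (s j - c) ^ i)"
      unfolding p l(2) by (intro sum.cong) (auto simp: z)
    also have "\<dots> = (s l - c) ^ i" using l by (simp add: if_distrib[of "\<lambda>x. x * _"] cong: if_cong)
    finally show "poly p x = poly ([:- c, 1:] ^ i) x" using l by (simp add: poly_power)
  next
    have c: "card (s ` {..<r}) = r" using card_image[OF inj] by simp
    show "degree p < card (s ` {..<r})"
      unfolding c p_def using \<open>i < r\<close>
      by (intro degree_sum_less) (auto intro: dq)
    show "degree ([:- c, 1:] ^ i) < card (s ` {..<r})"
      unfolding c using \<open>i < r\<close> degree_power_le[of "[:- c, 1:]" i] by simp
  qed
  from arg_cong[OF this, of "\<lambda>p. poly p t"] show ?thesis by (simp add: p poly_power)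
qed

text \<open>Comparing with a fixed vector \<open>V\<close> in place of the top derivative serves two purposes: \<open>V = 0\<close> yields the
  interpolation error, and \<open>V\<close> equal to the value at the left endpoint yields the divided difference.\<close>

lemma taylor_remainder_bound:
  fixes Df :: "nat \<Rightarrow> real \<Rightarrow> 'a::banach"
  assumes "0 < p" and der: "\<And>i u. i < p \<Longrightarrow> u \<in> {\<sigma>..\<tau>} \<Longrightarrow>
      (Df i has_vector_derivative Df (Suc i) u) (at u within {\<sigma>..\<tau>})"
    and bd: "\<And>u. u \<in> {\<sigma>..\<tau>} \<Longrightarrow> norm (Df p u - V) \<le> \<omega>" and t: "t \<in> {\<sigma>..\<tau>}"
  shows "norm (Df 0 t - (\<Sum>i<p. ((t - \<sigma>) ^ i / fact i) *\<^sub>R Df i \<sigma>) - ((t - \<sigma>) ^ p / fact p) *\<^sub>R V)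
    \<le> \<omega> * (\<tau> - \<sigma>) ^ p"
proof -
  \<comment> \<open>Subtracting the monomial of order \<open>p\<close> reduces the claim to a small top derivative.\<close>
  define E where "E i u = Df i u - ((u - \<sigma>) ^ (p - i) / fact (p - i)) *\<^sub>R V" for i u
  have E: "(E i has_vector_derivative E (Suc i) u) (at u within {\<sigma>..t})"
    if "i < p" "\<sigma> \<le> u" "u \<le> t" for i u
  proof -
    obtain m where m: "p - i = Suc m" using \<open>i < p\<close> by (cases "p - i") auto
    then have m': "p - Suc i = m" by simp
    have "((\<lambda>u. (u - \<sigma>) ^ Suc m / fact (Suc m)) has_real_derivative (u - \<sigma>) ^ m / fact m)
        (at u within {\<sigma>..t})"
      by (rule derivative_eq_intros refl | simp)+
    then have "((\<lambda>u. ((u - \<sigma>) ^ Suc m / fact (Suc m)) *\<^sub>R V) has_vector_derivative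
        ((u - \<sigma>) ^ m / fact m) *\<^sub>R V) (at u within {\<sigma>..t})"
      using has_vector_derivative_scaleR[OF _ has_vector_derivative_const, of _ _ u "{\<sigma>..t}" V] by fastforce
    moreover have "(Df i has_vector_derivative Df (Suc i) u) (at u within {\<sigma>..t})"
      by (rule has_vector_derivative_within_subset[OF der]) (use that t in auto)
    ultimately show ?thesis
      unfolding E_def[abs_def] m m'
      by (intro has_vector_derivative_diff)
  qed
  define R where "R u = ((t - u) ^ (p - 1) / fact (p - 1)) *\<^sub>R E p u" for u
  have R: "(R has_integral E 0 t - (\<Sum>i<p. ((t - \<sigma>) ^ i / fact i) *\<^sub>R E i \<sigma>)) {\<sigma>..t}"
    unfolding R_def using t \<open>0 < p\<close> E by (intro Taylor_has_integral) auto
  have \<omega>: "0 \<le> \<omega>" using bd[OF t] norm_ge_zero order_trans by blast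
  have Rb: "norm (R u) \<le> \<omega> * (\<tau> - \<sigma>) ^ (p - 1)" if "u \<in> {\<sigma>..t}" for u
  proof -
    have "\<bar>(t - u) ^ (p - 1) / fact (p - 1)\<bar> \<le> (\<tau> - \<sigma>) ^ (p - 1) / 1"
      unfolding abs_divide power_abs using that t
      by (intro frac_le power_mono) (auto simp: fact_ge_1)
    moreover have "norm (E p u) \<le> \<omega>" using bd[of u] that t by (simp add: E_def)
    ultimately have "\<bar>(t - u) ^ (p - 1) / fact (p - 1)\<bar> * norm (E p u) \<le> (\<tau> - \<sigma>) ^ (p - 1) * \<omega>"
      using t by (intro mult_mono) auto
    then show ?thesis by (simp add: R_def mult.commute)
  qed
  have "norm (E 0 t - (\<Sum>i<p. ((t - \<sigma>) ^ i / fact i) *\<^sub>R E i \<sigma>))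
      \<le> \<omega> * (\<tau> - \<sigma>) ^ (p - 1) * measure lborel (cbox \<sigma> t)"
    using R Rb \<omega> t by (intro has_integral_bound[of _ R]) (auto simp: cbox_interval)
  also have "\<dots> \<le> \<omega> * (\<tau> - \<sigma>) ^ (p - 1) * (\<tau> - \<sigma>)"
    using t \<omega> by (intro mult_left_mono) auto
  also have "\<dots> = \<omega> * (\<tau> - \<sigma>) ^ p" using \<open>0 < p\<close> by (cases p) auto
  finally have *: "norm (E 0 t - (\<Sum>i<p. ((t - \<sigma>) ^ i / fact i) *\<^sub>R E i \<sigma>)) \<le> \<omega> * (\<tau> - \<sigma>) ^ p" .
  have "E i \<sigma> = Df i \<sigma>" if "i < p" for i using that by (simp add: E_def power_0_left)
  then have "(\<Sum>i<p. ((t - \<sigma>) ^ i / fact i) *\<^sub>R E i \<sigma>) = (\<Sum>i<p. ((t - \<sigma>) ^ i / fact i) *\<^sub>R Df i \<sigma>)"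
    by simp
  with * show ?thesis by (simp add: E_def algebra_simps)
qed

text \<open>The Taylor polynomial is reproduced exactly, so only the remainder contributes, once directly and
  once through the bounded interpolation operator.\<close>

lemma lagrange_interp_error:
  fixes Df :: "nat \<Rightarrow> real \<Rightarrow> 'a::banach"
  assumes "\<sigma> < \<tau>" "0 < r" "n \<le> r" "r \<le> Suc n"
    and der: "\<And>i u. i < r \<Longrightarrow> u \<in> {\<sigma>..\<tau>} \<Longrightarrow>
      (Df i has_vector_derivative Df (Suc i) u) (at u within {\<sigma>..\<tau>})"
    and bd: "\<And>u. u \<in> {\<sigma>..\<tau>} \<Longrightarrow> norm (Df r u) \<le> B" and t: "t \<in> {\<sigma>..\<tau>}"
  shows "norm (lagrange_interp r (equid_nodes n \<sigma> \<tau>) (Df 0) t - Df 0 t)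
    \<le> (1 + real r ^ Suc r) * B * (\<tau> - \<sigma>) ^ r"
proof -
  let ?s = "equid_nodes n \<sigma> \<tau>"
  define P where "P u = (\<Sum>i<r. ((u - \<sigma>) ^ i / fact i) *\<^sub>R Df i \<sigma>)" for u
  have R: "norm (Df 0 u - P u) \<le> B * (\<tau> - \<sigma>) ^ r" if "u \<in> {\<sigma>..\<tau>}" for u
  proof -
    have "norm (Df 0 u - P u - ((u - \<sigma>) ^ r / fact r) *\<^sub>R 0) \<le> B * (\<tau> - \<sigma>) ^ r"
      unfolding P_def by (rule taylor_remainder_bound) (use assms that in auto)
    then show ?thesis by simp
  qed
  have inj: "inj_on ?s {..<r}" using assms by (intro equid_nodes_inj)
  have "lagrange_interp r ?s P t = (\<Sum>j<r. \<Sum>i<r. ((\<Prod>k\<in>{..<r} - {j}. (t - ?s k) / (?s j - ?s k))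
      * (?s j - \<sigma>) ^ i) *\<^sub>R (Df i \<sigma> /\<^sub>R fact i))"
    by (simp add: lagrange_interp_def P_def scaleR_sum_right divide_inverse mult_ac)
  also have "\<dots> = (\<Sum>i<r. (\<Sum>j<r. (\<Prod>k\<in>{..<r} - {j}. (t - ?s k) / (?s j - ?s k))
      * (?s j - \<sigma>) ^ i) *\<^sub>R (Df i \<sigma> /\<^sub>R fact i))"
    by (subst sum.swap) (simp only: scaleR_sum_left)
  also have "\<dots> = P t"
    unfolding P_def
    by (intro sum.cong) (simp_all add: lagrange_interp_monomial[OF inj], simp add: divide_inverse)
  finally have LP: "lagrange_interp r ?s P t = P t" .
  have "norm (lagrange_interp r ?s (\<lambda>u. Df 0 u - P u) t) \<le> real r ^ Suc r * (B * (\<tau> - \<sigma>) ^ r)"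
    by (intro lagrange_interp_bound R assms)
  moreover have "lagrange_interp r ?s (Df 0) t - Df 0 t
      = lagrange_interp r ?s (\<lambda>u. Df 0 u - P u) t - (Df 0 t - P t)"
    by (simp add: lagrange_interp_diff LP)
  ultimately show ?thesis
    using R[OF t] norm_triangle_ineq4[of "lagrange_interp r ?s (\<lambda>u. Df 0 u - P u) t" "Df 0 t - P t"]
    by (simp add: algebra_simps)
qed

lemma divided_diff_diff:
  "divided_diff (\<lambda>t. g t - h t) s k i = divided_diff g s k i - divided_diff h s k i"
proof (induction k arbitrary: i)
  case (Suc k)
  show ?case by (simp add: Suc.IH) (simp add: algebra_simps)
qed auto

lemma divided_diff_sum:
  "divided_diff (\<lambda>t. \<Sum>l\<in>I. g l t) s k i = (\<Sum>l\<in>I. divided_diff (g l) s k i)"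
  by (induction k arbitrary: i) (auto simp: scaleR_diff_right scaleR_sum_right sum_subtractf)

lemma divided_diff_scaleR_const:
  "divided_diff (\<lambda>t. p t *\<^sub>R c) s k i = divided_diff p s k i *\<^sub>R c"
  by (induction k arbitrary: i) (auto simp flip: scaleR_diff_left)

lemma divided_diff_const: "divided_diff (\<lambda>t. c) s (Suc k) i = 0"
proof (induction k arbitrary: i)
  case (Suc k)
  show ?case by (subst divided_diff.simps(2)) (simp only: Suc.IH diff_self scaleR_zero_right)
qed auto

text \<open>The Leibniz rule with a linear factor, from which the divided differences of monomials follow.\<close>

lemma divided_diff_linear_factor:
  fixes g :: "real \<Rightarrow> real"
  assumes "\<And>i k. s (i + Suc k) \<noteq> s i"
  shows "divided_diff (\<lambda>t. (t - c) * g t) s (Suc k) i =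
    (s i - c) * divided_diff g s (Suc k) i + divided_diff g s k (Suc i)"
proof (induction k arbitrary: i)
  case 0
  have "s (Suc i) - s i \<noteq> 0" using assms[of i 0] by simp
  then show ?case by (simp add: field_simps)
next
  case (Suc k)
  let ?N = "s (i + Suc (Suc k)) - s i" and ?M = "s (Suc i + Suc k) - s (Suc i)"
  let ?G = "divided_diff g s"
  have N: "?N \<noteq> 0" using assms[of i "Suc k"] by simp
  have M: "?M \<noteq> 0" using assms[of "Suc i" k] by simp
  \<comment> \<open>Both identities are the defining recursion, solved for the undivided terms.\<close>
  have 1: "?G k (Suc (Suc i)) = ?M * ?G (Suc k) (Suc i) + ?G k (Suc i)"
    using M by (subst divided_diff.simps(2)) (simp add: field_simps)
  have 2: "?G (Suc (Suc k)) i = (?G (Suc k) (Suc i) - ?G (Suc k) i) / ?N"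
    by (subst divided_diff.simps(2)) (simp add: divide_inverse mult.commute)
  have "divided_diff (\<lambda>t. (t - c) * g t) s (Suc (Suc k)) i =
      (((s (Suc i) - c) * ?G (Suc k) (Suc i) + ?G k (Suc (Suc i)))
        - ((s i - c) * ?G (Suc k) i + ?G k (Suc i))) / ?N"
    by (subst divided_diff.simps(2)) (simp only: Suc.IH real_scaleR_def divide_inverse mult.commute[of "inverse ?N"])
  also have "\<dots> = ((s (i + Suc (Suc k)) - c) * ?G (Suc k) (Suc i) - (s i - c) * ?G (Suc k) i) / ?N"
    unfolding 1 by (simp add: algebra_simps del: divided_diff.simps)
  also have "\<dots> = (s i - c) * ?G (Suc (Suc k)) i + ?G (Suc k) (Suc i)"
    unfolding 2 using N by (simp add: field_simps del: divided_diff.simps)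
  finally show ?case .
qed

lemma divided_diff_monomial:
  fixes s :: "nat \<Rightarrow> real"
  assumes s: "\<And>i k. s (i + Suc k) \<noteq> s i"
  shows "m \<le> k \<Longrightarrow> divided_diff (\<lambda>t. (t - c) ^ m) s k i = (if m = k then 1 else 0)"
proof (induction m arbitrary: k i)
  case 0
  then show ?case using divided_diff_const[of "1::real" s "k - 1" i] by (cases k) auto
next
  case (Suc m)
  then obtain k' where k': "k = Suc k'" by (cases k) auto
  show ?case
    using Suc divided_diff_linear_factor[OF s, of c "\<lambda>t. (t - c) ^ m" k' i]
    unfolding k' by (simp del: divided_diff.simps)
qed

text \<open>Each level of the recursion divides a difference by at least one mesh width. The growth \<open>h\<^sup>-\<^sup>k\<close> is
  harmless below because it meets perturbations of order \<open>h\<^sup>k\<^sup>+\<^sup>1\<close>.\<close>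

lemma divided_diff_bound:
  assumes "\<sigma> < \<tau>" "0 < n" and "\<And>j. i \<le> j \<Longrightarrow> j \<le> i + k \<Longrightarrow> norm (g (equid_nodes n \<sigma> \<tau> j)) \<le> B"
  shows "norm (divided_diff g (equid_nodes n \<sigma> \<tau>) k i) \<le> (2 * real n / (\<tau> - \<sigma>)) ^ k * B"
  using assms(3)
proof (induction k arbitrary: i)
  case (Suc k)
  let ?s = "equid_nodes n \<sigma> \<tau>" and ?C = "2 * real n / (\<tau> - \<sigma>)"
  have C: "0 < ?C" using assms by simp
  have a: "norm (divided_diff g ?s k (Suc i)) \<le> ?C ^ k * B"
    and b: "norm (divided_diff g ?s k i) \<le> ?C ^ k * B" using Suc by auto
  then have B: "0 \<le> ?C ^ k * B" using norm_ge_zero order_trans by blast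
  have "?s (i + Suc k) - ?s i = real (Suc k) * ((\<tau> - \<sigma>) / real n)"
    by (simp add: equid_nodes_diff)
  moreover have "1 * ((\<tau> - \<sigma>) / real n) \<le> real (Suc k) * ((\<tau> - \<sigma>) / real n)"
    using assms by (intro mult_right_mono) auto
  ultimately have *: "(\<tau> - \<sigma>) / real n \<le> ?s (i + Suc k) - ?s i" by simp
  have "norm (divided_diff g ?s (Suc k) i)
      = norm (divided_diff g ?s k (Suc i) - divided_diff g ?s k i) / \<bar>?s (i + Suc k) - ?s i\<bar>"
    by (simp add: divide_inverse mult.commute)
  also have "\<dots> \<le> (2 * (?C ^ k * B)) / ((\<tau> - \<sigma>) / real n)"
    using * a b assms B norm_triangle_ineq4[of "divided_diff g ?s k (Suc i)" "divided_diff g ?s k i"]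
    by (intro frac_le) auto
  also have "\<dots> = ?C ^ Suc k * B" using assms by (simp add: field_simps)
  finally show ?case .
qed auto

text \<open>The divided difference of order \<open>r\<close> annihilates all lower Taylor terms and maps the term of order
  \<open>r\<close> to its coefficient; the oscillation of the top derivative controls the remainder.\<close>

lemma divided_diff_derivative:
  fixes Df :: "nat \<Rightarrow> real \<Rightarrow> 'a::banach"
  assumes "\<sigma> < \<tau>" "0 < r"
    and der: "\<And>i u. i < r \<Longrightarrow> u \<in> {\<sigma>..\<tau>} \<Longrightarrow>
      (Df i has_vector_derivative Df (Suc i) u) (at u within {\<sigma>..\<tau>})"
    and bd: "\<And>u. u \<in> {\<sigma>..\<tau>} \<Longrightarrow> norm (Df r u - Df r \<sigma>) \<le> \<omega>"
  shows "norm (divided_diff (Df 0) (equid_nodes r \<sigma> \<tau>) r 0 - Df r \<sigma> /\<^sub>R fact r) \<le> (2 * real r) ^ r * \<omega>"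
proof -
  let ?s = "equid_nodes r \<sigma> \<tau>"
  define P where "P u = (\<Sum>i<Suc r. ((u - \<sigma>) ^ i) *\<^sub>R (Df i \<sigma> /\<^sub>R fact i))" for u
  have s: "?s (i + Suc k) \<noteq> ?s i" for i k
    using assms equid_nodes_diff[of r \<sigma> \<tau> "i + Suc k" i] by auto
  have R: "norm (Df 0 u - P u) \<le> \<omega> * (\<tau> - \<sigma>) ^ r" if "u \<in> {\<sigma>..\<tau>}" for u
  proof -
    have "norm (Df 0 u - (\<Sum>i<r. ((u - \<sigma>) ^ i / fact i) *\<^sub>R Df i \<sigma>)
        - ((u - \<sigma>) ^ r / fact r) *\<^sub>R Df r \<sigma>) \<le> \<omega> * (\<tau> - \<sigma>) ^ r"
      by (rule taylor_remainder_bound) (use assms that in auto)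
    then show ?thesis by (simp add: P_def divide_inverse diff_diff_eq)
  qed
  have "divided_diff P ?s r 0 = (\<Sum>i<Suc r. (if i = r then 1 else 0) *\<^sub>R (Df i \<sigma> /\<^sub>R fact i))"
    unfolding P_def divided_diff_sum divided_diff_scaleR_const
    by (intro sum.cong) (auto simp: divided_diff_monomial[OF s])
  also have "\<dots> = Df r \<sigma> /\<^sub>R fact r" by (simp add: if_distrib[of "\<lambda>x. x *\<^sub>R _"] cong: if_cong)
  finally have P: "divided_diff P ?s r 0 = Df r \<sigma> /\<^sub>R fact r" .
  have "norm (divided_diff (\<lambda>u. Df 0 u - P u) ?s r 0)
      \<le> (2 * real r / (\<tau> - \<sigma>)) ^ r * (\<omega> * (\<tau> - \<sigma>) ^ r)"
    using assms by (intro divided_diff_bound R equid_nodes_in) auto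
  also have "\<dots> = (2 * real r) ^ r * \<omega>" using assms by (simp add: power_divide)
  finally show ?thesis by (simp add: divided_diff_diff P)
qed

section \<open>The initial value problem near its exact solution\<close>

text \<open>Uniform continuity needs compactness of the curve only, not of the set \<open>S\<close> in which the nearby
  points vary.\<close>

lemma uniform_continuity_near_curve:
  fixes z :: "real \<Rightarrow> 'a::metric_space" and \<Phi> :: "real \<times> 'a \<Rightarrow> 'b::metric_space"
  assumes z: "continuous_on {a..b} z" and \<Phi>: "continuous_on S \<Phi>"
    and zS: "\<And>t. t \<in> {a..b} \<Longrightarrow> (t, z t) \<in> S" and "0 < e"
  obtains \<delta> where "0 < \<delta>"
    "\<And>t t' y. t \<in> {a..b} \<Longrightarrow> t' \<in> {a..b} \<Longrightarrow> (t', y) \<in> S \<Longrightarrow> \<bar>t' - t\<bar> < \<delta> \<Longrightarrow> dist y (z t') < \<delta> \<Longrightarrow>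
       dist (\<Phi> (t', y)) (\<Phi> (t, z t)) < e"
proof (rule ccontr)
  assume "\<not> thesis"
  with that have "\<forall>\<delta>>0. \<exists>t t' y. t \<in> {a..b} \<and> t' \<in> {a..b} \<and> (t', y) \<in> S \<and> \<bar>t' - t\<bar> < \<delta> \<and>
      dist y (z t') < \<delta> \<and> e \<le> dist (\<Phi> (t', y)) (\<Phi> (t, z t))"
    by (meson not_le)
  then have "\<forall>n::nat. \<exists>t t' y. t \<in> {a..b} \<and> t' \<in> {a..b} \<and> (t', y) \<in> S \<and> \<bar>t' - t\<bar> < inverse (real (Suc n)) \<and>
      dist y (z t') < inverse (real (Suc n)) \<and> e \<le> dist (\<Phi> (t', y)) (\<Phi> (t, z t))"
    by simp
  then obtain t t' y where *: "\<And>n::nat. t n \<in> {a..b}" "\<And>n. t' n \<in> {a..b}" "\<And>n. (t' n, y n) \<in> S"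
    "\<And>n. \<bar>t' n - t n\<bar> < inverse (real (Suc n))" "\<And>n. dist (y n) (z (t' n)) < inverse (real (Suc n))"
    "\<And>n. e \<le> dist (\<Phi> (t' n, y n)) (\<Phi> (t n, z (t n)))"
    by metis
  obtain c \<sigma> where c: "c \<in> {a..b}" "strict_mono \<sigma>" "(t \<circ> \<sigma>) \<longlonglongrightarrow> c"
    using *(1) compact_Icc[of a b] unfolding compact_def by metis
  have small: "(\<lambda>n. inverse (real (Suc (\<sigma> n)))) \<longlonglongrightarrow> 0"
    using LIMSEQ_subseq_LIMSEQ[OF LIMSEQ_inverse_real_of_nat c(2)] by (simp add: o_def)
  have "(\<lambda>n. t' (\<sigma> n) - t (\<sigma> n)) \<longlonglongrightarrow> 0"
    by (rule Lim_null_comparison[OF _ small]) (intro always_eventually allI, simp only: real_norm_def less_imp_le[OF *(4)])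
  from tendsto_add[OF this c(3)] have t': "(\<lambda>n. t' (\<sigma> n)) \<longlonglongrightarrow> c" by (simp add: o_def)
  have zlim: "(\<lambda>n. z (u n)) \<longlonglongrightarrow> z c" if "u \<longlonglongrightarrow> c" "\<And>n. u n \<in> {a..b}" for u
    using continuous_on_tendsto_compose[OF z that(1) c(1)] that(2) by simp
  have "(\<lambda>n. dist (y (\<sigma> n)) (z (t' (\<sigma> n)))) \<longlonglongrightarrow> 0"
    by (rule Lim_null_comparison[OF _ small])
       (intro always_eventually allI, simp only: real_norm_def abs_of_nonneg zero_le_dist less_imp_le[OF *(5)])
  from tendsto_add[OF this tendsto_dist[OF zlim[OF t' *(2)] tendsto_const[of "z c"]]]
  have "(\<lambda>n. dist (y (\<sigma> n)) (z (t' (\<sigma> n))) + dist (z (t' (\<sigma> n))) (z c)) \<longlonglongrightarrow> 0" by simp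
  then have "(\<lambda>n. dist (y (\<sigma> n)) (z c)) \<longlonglongrightarrow> 0"
    by (rule Lim_null_comparison[rotated])
       (intro always_eventually allI, simp only: real_norm_def abs_of_nonneg zero_le_dist dist_triangle)
  then have y: "(\<lambda>n. y (\<sigma> n)) \<longlonglongrightarrow> z c" by (rule iffD2[OF tendsto_dist_iff])
  have \<Phi>lim: "(\<lambda>n. \<Phi> (p n)) \<longlonglongrightarrow> \<Phi> (c, z c)" if "p \<longlonglongrightarrow> (c, z c)" "\<And>n. p n \<in> S" for p
    using continuous_on_tendsto_compose[OF \<Phi> that(1) zS[OF c(1)]] that(2) by simp
  have "(\<lambda>n. dist (\<Phi> (t' (\<sigma> n), y (\<sigma> n))) (\<Phi> (t (\<sigma> n), z (t (\<sigma> n))))) \<longlonglongrightarrow> dist (\<Phi> (c, z c)) (\<Phi> (c, z c))"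
    using t' y c(3) *(1,3) zS by (intro tendsto_dist \<Phi>lim tendsto_Pair zlim) (auto simp: o_def)
  then have "e \<le> dist (\<Phi> (c, z c)) (\<Phi> (c, z c))"
    by (rule LIMSEQ_le_const) (use *(6) in auto)
  with \<open>0 < e\<close> show False by simp
qed

locale smooth_ivp =
  fixes d r :: nat and a b :: real and \<eta> :: rvec and f :: "real \<Rightarrow> rvec \<Rightarrow> rvec"
  assumes ab: "a < b" and r: "0 < r" and \<eta>: "\<eta> \<in> Rd d" and f: "f \<in> F_class d r a b \<eta>"
begin

definition z :: "real \<Rightarrow> rvec" where "z = ivp_sol d f a b \<eta>"

text \<open>The region in which \<open>f\<close> is assumed to be of class \<open>C\<^sup>r\<close>; it contains the tube of radius \<open>1\<close> around \<open>z\<close>.\<close>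

definition smooth_dom :: "(real \<times> rvec) set" where
  "smooth_dom = {a..b} \<times> {y \<in> Rd d. norm y \<le> (SUP t\<in>{a..b}. norm (z t)) + 1}"

definition lip_const :: real where
  "lip_const = (SOME L. 0 \<le> L \<and>
     (\<forall>t\<in>{a..b}. \<forall>y\<in>Rd d. \<forall>y'\<in>Rd d. norm (f t y - f t y') \<le> L * norm (y - y')))"

abbreviation "L \<equiv> lip_const"

lemma lip_const: "0 \<le> L"
  "\<And>t y y'. t \<in> {a..b} \<Longrightarrow> y \<in> Rd d \<Longrightarrow> y' \<in> Rd d \<Longrightarrow> norm (f t y - f t y') \<le> L * norm (y - y')"
proof -
  have "\<exists>L\<ge>0. \<forall>t\<in>{a..b}. \<forall>y\<in>Rd d. \<forall>y'\<in>Rd d. norm (f t y - f t y') \<le> L * norm (y - y')"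
    using f by (simp add: F_class_def)
  from someI_ex[OF this, folded lip_const_def] show "0 \<le> L"
    "\<And>t y y'. t \<in> {a..b} \<Longrightarrow> y \<in> Rd d \<Longrightarrow> y' \<in> Rd d \<Longrightarrow> norm (f t y - f t y') \<le> L * norm (y - y')"
    by blast+
qed

lemma f_Rd: "t \<in> {a..b} \<Longrightarrow> y \<in> Rd d \<Longrightarrow> f t y \<in> Rd d"
  using f by (simp add: F_class_def)

lemma f_Ck: "Ck_on r (UNIV \<times> Rd d) smooth_dom (\<lambda>(t, y). f t y)"
  using f by (simp add: F_class_def Let_def smooth_dom_def z_def)

lemma ivp_sol:
  assumes "a \<le> s" "s \<le> T" "T \<le> b" "y \<in> Rd d"
  shows "ivp_solution d f s T y (ivp_sol d f s T y)"
proof -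
  define F where "F t y = f t (truncate d y)" for t y
  have "continuous_on ({a..b} \<times> Rd d) (\<lambda>(t, y). f t y)" using f by (simp add: F_class_def)
  then have "continuous_on ({s..T} \<times> UNIV) (\<lambda>p. (\<lambda>(t, y). f t y) (fst p, truncate d (snd p)))"
    by (rule continuous_on_compose2)
       (use assms in \<open>auto intro!: continuous_intros simp: truncate_in_Rd\<close>)
  then have cont: "continuous_on ({s..T} \<times> UNIV) (\<lambda>(t, y). F t y)"
    by (simp add: F_def case_prod_beta)
  have lip: "norm (F t y - F t y') \<le> L * norm (y - y')" if "t \<in> {s..T}" for t y y'
  proof -
    have "norm (F t y - F t y') \<le> L * norm (truncate d y - truncate d y')"
      unfolding F_def using that assms by (intro lip_const(2)) (auto simp: truncate_in_Rd)
    also have "\<dots> \<le> L * norm (y - y')" by (intro mult_left_mono norm_truncate_diff lip_const(1))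
    finally show ?thesis .
  qed
  show ?thesis
  proof (rule picard_lindelof[OF \<open>s \<le> T\<close> cont lip, where y = y])
    fix w assume w: "w s = y" "continuous_on {s..T} w"
      "\<And>t. t \<in> {s..T} \<Longrightarrow> w t = y + integral {s..t} (\<lambda>u. F u (w u))"
      "\<And>t. t \<in> {s..T} \<Longrightarrow> (w has_vector_derivative F t (w t)) (at t within {s..T})"
    have wRd: "w t \<in> Rd d" if t: "t \<in> {s..T}" for t
    proof -
      have "continuous_on {s..t} (\<lambda>u. (\<lambda>(t, y). F t y) (u, w u))"
        by (rule continuous_on_compose2[OF cont])
           (use t in \<open>auto intro!: continuous_intros continuous_on_subset[OF w(2)]\<close>)
      then have "integral {s..t} (\<lambda>u. F u (w u)) \<in> Rd d"
        by (intro Rd_integral) (use t assms in \<open>auto simp: F_def intro!: f_Rd truncate_in_Rd\<close>)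
      then show ?thesis using w(3)[OF t] assms(4) by (simp add: Rd_add)
    qed
    then have "ivp_solution d f s T y w"
      using w(1,4) by (simp add: ivp_solution_def F_def truncate_Rd)
    then show ?thesis unfolding ivp_sol_def by (rule someI[of "ivp_solution d f s T y"])
  qed
qed

lemma z_sol: "ivp_solution d f a b \<eta> z"
  unfolding z_def using ab \<eta> by (intro ivp_sol) auto

lemma z_start: "z a = \<eta>"
  using z_sol by (simp add: ivp_solution_def)

lemma z_cont: "continuous_on {a..b} z"
  using z_sol by (auto simp: ivp_solution_def intro!: continuous_on_vector_derivative)

lemma near_z_smooth_dom:
  assumes "t \<in> {a..b}" "y \<in> Rd d" "norm (y - z t) \<le> 1"
  shows "(t, y) \<in> smooth_dom"
proof -
  have "bdd_above ((\<lambda>t. norm (z t)) ` {a..b})"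
    by (intro bounded_imp_bdd_above compact_imp_bounded compact_continuous_image
        continuous_on_norm z_cont compact_Icc)
  then have "norm (z t) \<le> (SUP t\<in>{a..b}. norm (z t))" using assms(1) by (intro cSUP_upper)
  then show ?thesis using assms norm_triangle_sub[of y "z t"] by (auto simp: smooth_dom_def)
qed

lemma z_smooth_dom: "t \<in> {a..b} \<Longrightarrow> (t, z t) \<in> smooth_dom"
  using z_sol by (intro near_z_smooth_dom) (auto simp: ivp_solution_def)

definition total_deriv :: "nat \<Rightarrow> real \<times> rvec \<Rightarrow> rvec" where
  "total_deriv = (SOME \<Phi>. \<Phi> 0 = (\<lambda>(t, y). f t y) \<and> (\<forall>j\<le>r. continuous_on smooth_dom (\<Phi> j)) \<and>
    (\<forall>j<r. \<forall>s T w. trajectory_in f smooth_dom s T w \<longrightarrow> (\<forall>t\<in>{s..T}.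
       ((\<lambda>u. \<Phi> j (u, w u)) has_vector_derivative \<Phi> (Suc j) (t, w t)) (at t within {s..T}))))"

lemma total_deriv: "total_deriv 0 (t, y) = f t y"
  "j \<le> r \<Longrightarrow> continuous_on smooth_dom (total_deriv j)"
  "j < r \<Longrightarrow> trajectory_in f smooth_dom s T w \<Longrightarrow> t \<in> {s..T} \<Longrightarrow>
     ((\<lambda>u. total_deriv j (u, w u)) has_vector_derivative total_deriv (Suc j) (t, w t)) (at t within {s..T})"
proof -
  have "\<exists>\<Phi>. \<Phi> 0 = (\<lambda>(t, y). f t y) \<and> (\<forall>j\<le>r. continuous_on smooth_dom (\<Phi> j)) \<and>
    (\<forall>j<r. \<forall>s T w. trajectory_in f smooth_dom s T w \<longrightarrow> (\<forall>t\<in>{s..T}.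
       ((\<lambda>u. \<Phi> j (u, w u)) has_vector_derivative \<Phi> (Suc j) (t, w t)) (at t within {s..T})))"
    by (rule total_derivatives_exist[OF f_Ck f_Ck]) (auto simp: smooth_dom_def intro: f_Rd)
  from someI_ex[OF this, folded total_deriv_def]
  have *: "total_deriv 0 = (\<lambda>(t, y). f t y)" "\<forall>j\<le>r. continuous_on smooth_dom (total_deriv j)"
    "\<forall>j<r. \<forall>s T w. trajectory_in f smooth_dom s T w \<longrightarrow> (\<forall>t\<in>{s..T}.
       ((\<lambda>u. total_deriv j (u, w u)) has_vector_derivative total_deriv (Suc j) (t, w t)) (at t within {s..T}))"
    by blast+
  show "total_deriv 0 (t, y) = f t y" by (simp add: *(1))
  show "j \<le> r \<Longrightarrow> continuous_on smooth_dom (total_deriv j)" using *(2) by blast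
  show "j < r \<Longrightarrow> trajectory_in f smooth_dom s T w \<Longrightarrow> t \<in> {s..T} \<Longrightarrow>
     ((\<lambda>u. total_deriv j (u, w u)) has_vector_derivative total_deriv (Suc j) (t, w t)) (at t within {s..T})"
    using *(3) by blast
qed

lemma z_trajectory: "trajectory_in f smooth_dom a b z"
  using z_sol z_smooth_dom by (auto simp: trajectory_in_def ivp_solution_def)

lemma hderiv_trajectory:
  assumes "s < T" "trajectory_in f smooth_dom s T w"
  shows "t \<in> {s..T} \<Longrightarrow> hderiv {s..T} (r + 1) w t = total_deriv r (t, w t)"
    and "hdifferentiable_on {s..T} (r + 1) w"
  using hderiv_along_trajectory[of s T f smooth_dom w total_deriv r, OF assms total_deriv(1) total_deriv(3)] assms(2) by auto

text \<open>The situation of one step of a numerical scheme: a short interval, a starting vector within \<open>\<rho>\<close> of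
  the exact solution, and the local solution \<open>w\<close> issuing from it.\<close>

definition local_ivp :: "real \<Rightarrow> real \<Rightarrow> real \<Rightarrow> rvec \<Rightarrow> (real \<Rightarrow> rvec) \<Rightarrow> bool" where
  "local_ivp \<rho> s T y w \<longleftrightarrow> a \<le> s \<and> s < T \<and> T \<le> b \<and> T - s \<le> \<rho> \<and> L * (T - s) \<le> 1/2 \<and>
     y \<in> Rd d \<and> norm (y - z s) \<le> \<rho> \<and> ivp_solution d f s T y w"

lemma local_ivp_mono: "local_ivp \<rho> s T y w \<Longrightarrow> \<rho> \<le> \<rho>' \<Longrightarrow> local_ivp \<rho>' s T y w"
  by (auto simp: local_ivp_def)

lemma local_ivp_stable:
  assumes "local_ivp \<rho> s T y w"
  shows "t \<in> {s..T} \<Longrightarrow> norm (w t - z t) \<le> 2 * \<rho>"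
    and "norm (w T - z T) \<le> (1 + 2 * L * (T - s)) * norm (y - z s)"
proof -
  let ?w' = "\<lambda>u. f u (w u) - f u (z u)"
  note * = assms[unfolded local_ivp_def ivp_solution_def]
  have sub: "{s..T} \<subseteq> {a..b}" using * by auto
  have der: "((\<lambda>u. w u - z u) has_vector_derivative ?w' u) (at u within {s..T})"
    if u: "u \<in> {s..T}" for u
  proof (rule has_vector_derivative_diff)
    show "(w has_vector_derivative f u (w u)) (at u within {s..T})" using * u by blast
    have "(z has_vector_derivative f u (z u)) (at u within {a..b})"
      using z_sol u sub unfolding ivp_solution_def by blast
    then show "(z has_vector_derivative f u (z u)) (at u within {s..T})"
      using sub by (rule has_vector_derivative_within_subset)
  qed
  have lip: "norm (?w' u) \<le> L * norm (w u - z u)" if "u \<in> {s..T}" for u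
    using * z_sol that sub unfolding ivp_solution_def by (intro lip_const(2)) blast+
  have ws: "w s = y" "s \<le> T" "L * (T - s) \<le> 1/2" using * by auto
  note st = short_interval_stability[OF der lip ws(2) lip_const(1) ws(3)]
  show "norm (w t - z t) \<le> 2 * \<rho>" if "t \<in> {s..T}" using st(1)[OF _ _ that] * ws by force
  show "norm (w T - z T) \<le> (1 + 2 * L * (T - s)) * norm (y - z s)" using st(2) ws by simp
qed

lemma local_ivp_trajectory:
  assumes w: "local_ivp \<rho> s T y w" and "\<rho> \<le> 1/2"
  shows "trajectory_in f smooth_dom s T w"
proof -
  have "(u, w u) \<in> smooth_dom" if "u \<in> {s..T}" for u
    using local_ivp_stable(1)[OF w that] w that \<open>\<rho> \<le> 1/2\<close>
    by (intro near_z_smooth_dom) (auto simp: local_ivp_def ivp_solution_def)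
  then show ?thesis using w by (auto simp: trajectory_in_def local_ivp_def ivp_solution_def)
qed

text \<open>Derivatives of order \<open>j + 1\<close> of local solutions are uniformly close to those of \<open>z\<close>, even when the two
  are evaluated at different points of the step.\<close>

lemma total_deriv_near_z:
  assumes "0 < e" "j \<le> r"
  obtains \<rho> where "0 < \<rho>" "\<rho> \<le> 1/2"
    "\<And>s T y w t t'. local_ivp \<rho> s T y w \<Longrightarrow> t \<in> {s..T} \<Longrightarrow> t' \<in> {s..T} \<Longrightarrow>
       norm (total_deriv j (t', w t') - total_deriv j (t, z t)) \<le> e"
proof -
  obtain \<delta> where \<delta>: "0 < \<delta>"
    "\<And>t t' y. t \<in> {a..b} \<Longrightarrow> t' \<in> {a..b} \<Longrightarrow> (t', y) \<in> smooth_dom \<Longrightarrow> \<bar>t' - t\<bar> < \<delta> \<Longrightarrow> dist y (z t') < \<delta> \<Longrightarrow>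
       dist (total_deriv j (t', y)) (total_deriv j (t, z t)) < e"
    by (rule uniform_continuity_near_curve[OF z_cont total_deriv(2)[OF \<open>j \<le> r\<close>] _ \<open>0 < e\<close>], erule z_smooth_dom) (rule that)
  show ?thesis
  proof (rule that[of "min (1/2) (\<delta> / 3)"])
    fix s T y w t t'
    assume w: "local_ivp (min (1/2) (\<delta> / 3)) s T y w" and t: "t \<in> {s..T}" "t' \<in> {s..T}"
    have "(t', w t') \<in> smooth_dom" using local_ivp_trajectory[OF w] t(2) by (auto simp: trajectory_in_def)
    moreover have "dist (w t') (z t') < \<delta>"
      using local_ivp_stable(1)[OF w t(2)] \<open>0 < \<delta>\<close> by (simp add: dist_norm min_def split: if_splits)
    moreover have "\<bar>t' - t\<bar> < \<delta>" using w t \<open>0 < \<delta>\<close> by (auto simp: local_ivp_def)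
    ultimately have "dist (total_deriv j (t', w t')) (total_deriv j (t, z t)) < e"
      using w t by (intro \<delta>(2)) (auto simp: local_ivp_def)
    then show "norm (total_deriv j (t', w t') - total_deriv j (t, z t)) \<le> e" by (simp add: dist_norm)
  qed (use \<open>0 < \<delta>\<close> in auto)
qed

lemma total_deriv_z_bounded:
  assumes "j \<le> r"
  obtains B where "0 \<le> B" "\<And>t. t \<in> {a..b} \<Longrightarrow> norm (total_deriv j (t, z t)) \<le> B"
proof -
  have "continuous_on {a..b} (\<lambda>t. total_deriv j (t, z t))"
    by (rule continuous_on_compose2[OF total_deriv(2)[OF assms]])
       (auto intro!: continuous_intros z_cont z_smooth_dom)
  then have "bounded ((\<lambda>t. total_deriv j (t, z t)) ` {a..b})"
    by (intro compact_imp_bounded compact_continuous_image compact_Icc)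
  then obtain B where "0 < B" "\<And>t. t \<in> {a..b} \<Longrightarrow> norm (total_deriv j (t, z t)) \<le> B"
    by (auto simp: bounded_pos)
  then show ?thesis by (intro that[of B]) auto
qed

lemma total_deriv_bounded:
  assumes "j \<le> r"
  obtains B \<rho> where "0 \<le> B" "0 < \<rho>" "\<rho> \<le> 1/2"
    "\<And>s T y w t. local_ivp \<rho> s T y w \<Longrightarrow> t \<in> {s..T} \<Longrightarrow> norm (total_deriv j (t, w t)) \<le> B"
proof -
  obtain \<rho> where \<rho>: "0 < \<rho>" "\<rho> \<le> 1/2"
    "\<And>s T y w t t'. local_ivp \<rho> s T y w \<Longrightarrow> t \<in> {s..T} \<Longrightarrow> t' \<in> {s..T} \<Longrightarrow>
       norm (total_deriv j (t', w t') - total_deriv j (t, z t)) \<le> 1"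
    by (rule total_deriv_near_z[OF zero_less_one assms]) (rule that)
  obtain B where B: "0 \<le> B" "\<And>t. t \<in> {a..b} \<Longrightarrow> norm (total_deriv j (t, z t)) \<le> B"
    by (rule total_deriv_z_bounded[OF assms]) (rule that)
  show ?thesis
  proof (rule that[of "B + 1" \<rho>])
    fix s T y w t assume w: "local_ivp \<rho> s T y w" and t: "t \<in> {s..T}"
    have "norm (total_deriv j (t, z t)) \<le> B" using w t by (intro B) (auto simp: local_ivp_def)
    with \<rho>(3)[OF w t t] show "norm (total_deriv j (t, w t)) \<le> B + 1"
      using norm_triangle_sub[of "total_deriv j (t, w t)" "total_deriv j (t, z t)"] by linarith
  qed (use B \<rho> in auto)
qed

lemma local_ivp_norm_start:
  assumes w: "local_ivp \<rho> s T y w" and "t \<in> {s..T}"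
    and B: "\<And>u. u \<in> {s..T} \<Longrightarrow> norm (f u (w u)) \<le> B"
  shows "norm (w t - y) \<le> B * (t - s)"
  using vector_derivative_norm_bound[of s T w "\<lambda>u. f u (w u)" B t] assms
  by (auto simp: local_ivp_def ivp_solution_def)

lemma basic_iter_Rd:
  assumes "a \<le> s" "s < T" "T \<le> b" "y \<in> Rd d" "n \<le> r" "r \<le> Suc n"
  shows "t \<in> {s..T} \<Longrightarrow> basic_iter r f s y (equid_nodes n s T) j t \<in> Rd d"
proof (induction j arbitrary: t)
  case (Suc j)
  let ?l = "basic_iter r f s y (equid_nodes n s T) j"
  have "lagrange_interp r (equid_nodes n s T) (\<lambda>u. f u (?l u)) v \<in> Rd d" for v
    unfolding lagrange_interp_def
  proof (intro Rd_sum Rd_scaleR)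
    fix i assume "i \<in> {..<r}"
    then have i: "equid_nodes n s T i \<in> {s..T}" using assms by (intro equid_nodes_in) auto
    then show "f (equid_nodes n s T i) (?l (equid_nodes n s T i)) \<in> Rd d"
      using Suc.IH[OF i] assms by (intro f_Rd) auto
  qed
  then show ?case
    using assms(4) by (auto intro!: Rd_add Rd_integral continuous_on_lagrange_interp)
qed (use assms in auto)

text \<open>One sweep multiplies the error by the length of the step, up to constants, and adds the
  interpolation error for the derivative of the local solution.\<close>

lemma basic_iter_error:
  assumes w: "local_ivp \<rho> s T y w" and "\<rho> \<le> 1/2" "n \<le> r" "r \<le> Suc n" "0 \<le> C"
    and B: "\<And>u. u \<in> {s..T} \<Longrightarrow> norm (total_deriv r (u, w u)) \<le> B"
    and l: "\<And>u. u \<in> {s..T} \<Longrightarrow> norm (basic_iter r f s y (equid_nodes n s T) j u - w u) \<le> C"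
    and t: "t \<in> {s..T}"
  shows "norm (basic_iter r f s y (equid_nodes n s T) (Suc j) t - w t)
    \<le> (real r ^ Suc r * (L * C) + (1 + real r ^ Suc r) * B * (T - s) ^ r) * (T - s)"
proof -
  let ?s = "equid_nodes n s T" and ?l = "basic_iter r f s y (equid_nodes n s T) j"
  let ?E = "real r ^ Suc r * (L * C) + (1 + real r ^ Suc r) * B * (T - s) ^ r"
  note * = w[unfolded local_ivp_def ivp_solution_def]
  have sT: "s < T" using * by simp
  have B0: "0 \<le> B" using B[OF t] norm_ge_zero order_trans by blast
  have E0: "0 \<le> ?E" using lip_const(1) \<open>0 \<le> C\<close> B0 sT by (intro add_nonneg_nonneg mult_nonneg_nonneg) auto
  have traj: "trajectory_in f smooth_dom s T w" using local_ivp_trajectory[OF w] assms by simp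
  have 1: "norm (lagrange_interp r ?s (\<lambda>u. f u (?l u) - f u (w u)) u) \<le> real r ^ Suc r * (L * C)"
    if "u \<in> {s..T}" for u
  proof (rule lagrange_interp_bound[OF sT _ _ that])
    fix v assume v: "v \<in> {s..T}"
    have "norm (f v (?l v) - f v (w v)) \<le> L * norm (?l v - w v)"
      using * v assms by (intro lip_const(2) basic_iter_Rd) auto
    also have "\<dots> \<le> L * C" by (intro mult_left_mono l[OF v] lip_const(1))
    finally show "norm (f v (?l v) - f v (w v)) \<le> L * C" .
  qed (use assms in auto)
  have 2: "norm (lagrange_interp r ?s (\<lambda>u. f u (w u)) u - f u (w u)) \<le> (1 + real r ^ Suc r) * B * (T - s) ^ r"
    if "u \<in> {s..T}" for u
    using lagrange_interp_error[of s T r n "\<lambda>j u. total_deriv j (u, w u)" B u] sT r assms that total_deriv(3)[OF _ traj]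
    by (simp add: total_deriv(1))
  have 3: "norm (lagrange_interp r ?s (\<lambda>u. f u (?l u)) u - f u (w u)) \<le> ?E" if "u \<in> {s..T}" for u
    using 1[OF that] 2[OF that]
      norm_triangle_ineq[of "lagrange_interp r ?s (\<lambda>u. f u (?l u) - f u (w u)) u"
        "lagrange_interp r ?s (\<lambda>u. f u (w u)) u - f u (w u)"]
    by (simp add: lagrange_interp_diff)
  have wI: "((\<lambda>u. f u (w u)) has_integral w t - w s) {s..t}"
    using * t by (intro fundamental_theorem_of_calculus)
      (auto intro: has_vector_derivative_within_subset[of w _ _ "{s..T}"])
  have lI: "(lagrange_interp r ?s (\<lambda>u. f u (?l u)) has_integral
      integral {s..t} (lagrange_interp r ?s (\<lambda>u. f u (?l u)))) {s..t}"
    by (intro integrable_integral integrable_continuous_real continuous_on_lagrange_interp)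
  have "norm (integral {s..t} (lagrange_interp r ?s (\<lambda>u. f u (?l u))) - (w t - w s))
      \<le> ?E * measure lborel (cbox s t)"
    using has_integral_diff[OF lI wI] 3 t E0
    by (intro has_integral_bound[where f = "\<lambda>u. lagrange_interp r ?s (\<lambda>u. f u (?l u)) u - f u (w u)"])
       (auto simp: cbox_interval)
  also have "\<dots> \<le> ?E * (T - s)" using t E0 by (intro mult_left_mono) auto
  finally show ?thesis using * by (simp add: algebra_simps)
qed

text \<open>The starting error of the constant approximation is of order one in the step, so after \<open>j\<close> sweeps the
  order is \<open>j + 1\<close>, until it saturates at \<open>r + 1\<close>.\<close>

lemma basic_iter_consistent:
  obtains C \<rho> where "0 \<le> C" "0 < \<rho>" "\<rho> \<le> 1/2"
    "\<And>s T y w n t. local_ivp \<rho> s T y w \<Longrightarrow> n \<le> r \<Longrightarrow> r \<le> Suc n \<Longrightarrow> t \<in> {s..T} \<Longrightarrow>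
       norm (basic_iter r f s y (equid_nodes n s T) (r + 1) t - w t) \<le> C * (T - s) ^ (r + 1)"
proof -
  obtain B0 \<rho>0 where B0: "0 \<le> B0" "0 < \<rho>0" "\<rho>0 \<le> 1/2"
    "\<And>s T y w t. local_ivp \<rho>0 s T y w \<Longrightarrow> t \<in> {s..T} \<Longrightarrow> norm (total_deriv 0 (t, w t)) \<le> B0"
    by (rule total_deriv_bounded[OF le0]) (rule that)
  obtain B \<rho>1 where B: "0 \<le> B" "0 < \<rho>1" "\<rho>1 \<le> 1/2"
    "\<And>s T y w t. local_ivp \<rho>1 s T y w \<Longrightarrow> t \<in> {s..T} \<Longrightarrow> norm (total_deriv r (t, w t)) \<le> B"
    by (rule total_deriv_bounded[OF order_refl]) (rule that)
  define \<rho> where "\<rho> = min \<rho>0 \<rho>1"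
  have \<rho>: "0 < \<rho>" "\<rho> \<le> 1/2" using B0 B by (auto simp: \<rho>_def)
  have "\<exists>C\<ge>0. \<forall>s T y w n t. local_ivp \<rho> s T y w \<longrightarrow> n \<le> r \<longrightarrow> r \<le> Suc n \<longrightarrow> t \<in> {s..T} \<longrightarrow>
       norm (basic_iter r f s y (equid_nodes n s T) j t - w t) \<le> C * (T - s) ^ min (Suc j) (Suc r)" for j
  proof (induction j)
    case 0
    have "norm (y - w t) \<le> B0 * (T - s) ^ min (Suc 0) (Suc r)"
      if w: "local_ivp \<rho> s T y w" and t: "t \<in> {s..T}" for s T y w t
    proof -
      have w0: "local_ivp \<rho>0 s T y w" using local_ivp_mono[OF w] by (simp add: \<rho>_def)
      have "norm (w t - y) \<le> B0 * (t - s)"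
        using B0(4)[OF w0] by (intro local_ivp_norm_start[OF w t]) (simp add: total_deriv)
      also have "\<dots> \<le> B0 * (T - s)" using t B0 by (intro mult_left_mono) auto
      finally show ?thesis by (simp add: norm_minus_commute)
    qed
    then show ?case using B0(1) by auto
  next
    case (Suc j)
    then obtain C where C: "0 \<le> C" "\<And>s T y w n t. local_ivp \<rho> s T y w \<Longrightarrow> n \<le> r \<Longrightarrow> r \<le> Suc n \<Longrightarrow> t \<in> {s..T} \<Longrightarrow>
       norm (basic_iter r f s y (equid_nodes n s T) j t - w t) \<le> C * (T - s) ^ min (Suc j) (Suc r)"
      by blast
    let ?C' = "real r ^ Suc r * (L * C) + (1 + real r ^ Suc r) * B"
    have C': "0 \<le> ?C'" using C B lip_const(1) by (intro add_nonneg_nonneg mult_nonneg_nonneg) auto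
    have "norm (basic_iter r f s y (equid_nodes n s T) (Suc j) t - w t) \<le> ?C' * (T - s) ^ min (Suc (Suc j)) (Suc r)"
      if w: "local_ivp \<rho> s T y w" and n: "n \<le> r" "r \<le> Suc n" and t: "t \<in> {s..T}" for s T y w n t
    proof -
      let ?m = "min (Suc j) (Suc r)" and ?m' = "min (Suc (Suc j)) (Suc r)"
      have w1: "local_ivp \<rho>1 s T y w" using local_ivp_mono[OF w] by (simp add: \<rho>_def)
      have h: "0 \<le> T - s" "T - s \<le> 1" using w \<rho> by (auto simp: local_ivp_def)
      have "norm (basic_iter r f s y (equid_nodes n s T) (Suc j) t - w t)
        \<le> (real r ^ Suc r * (L * (C * (T - s) ^ ?m)) + (1 + real r ^ Suc r) * B * (T - s) ^ r) * (T - s)"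
        by (rule basic_iter_error[OF w \<rho>(2) n _ B(4)[OF w1] C(2)[OF w n] t]) (use C h in auto)
      also have "\<dots> = real r ^ Suc r * (L * C) * (T - s) ^ Suc ?m + (1 + real r ^ Suc r) * B * (T - s) ^ Suc r"
        by (simp add: algebra_simps)
      also have "\<dots> \<le> real r ^ Suc r * (L * C) * (T - s) ^ ?m' + (1 + real r ^ Suc r) * B * (T - s) ^ ?m'"
        using h C B lip_const(1) by (intro add_mono mult_left_mono power_decreasing) auto
      also have "\<dots> = ?C' * (T - s) ^ ?m'" by (simp only: distrib_right)
      finally show ?thesis .
    qed
    then show ?case using C' by blast
  qed
  from this[of "r + 1"] obtain C where C: "0 \<le> C" "\<And>s T y w n t. local_ivp \<rho> s T y w \<Longrightarrow> n \<le> r \<Longrightarrow>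
      r \<le> Suc n \<Longrightarrow> t \<in> {s..T} \<Longrightarrow>
      norm (basic_iter r f s y (equid_nodes n s T) (r + 1) t - w t) \<le> C * (T - s) ^ min (Suc (r + 1)) (Suc r)"
    by blast
  show ?thesis by (rule that[OF C(1) \<rho>]) (use C(2) in simp)
qed

text \<open>Three errors add up: replacing the computed approximation by the local solution costs
  \<open>O(h\<^sup>r\<^sup>+\<^sup>1) / h\<^sup>r\<close>, the divided difference of the local solution oscillates around its derivative, and
  this derivative is close to that of \<open>z\<close>. Each is made at most \<open>e / 3\<close> or a share of it.\<close>

lemma divided_diff_consistent:
  assumes "0 < e"
  obtains \<rho> where "0 < \<rho>"
    "\<And>s T y w. local_ivp \<rho> s T y w \<Longrightarrow>
       norm (divided_diff (\<lambda>t. f t (basic_iter r f s y (equid_nodes r s T) (r + 1) t)) (equid_nodes r s T) r 0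
         - total_deriv r (s, z s) /\<^sub>R fact r) \<le> e"
proof -
  define A where "A = (2 * real r) ^ r"
  have A: "0 < A" using r by (simp add: A_def)
  obtain C \<rho>0 where C: "0 \<le> C" "0 < \<rho>0" "\<rho>0 \<le> 1/2"
    "\<And>s T y w n t. local_ivp \<rho>0 s T y w \<Longrightarrow> n \<le> r \<Longrightarrow> r \<le> Suc n \<Longrightarrow> t \<in> {s..T} \<Longrightarrow>
       norm (basic_iter r f s y (equid_nodes n s T) (r + 1) t - w t) \<le> C * (T - s) ^ (r + 1)"
    by (rule basic_iter_consistent) (rule that)
  define \<omega> where "\<omega> = e / (6 * (A + 1))"
  have "0 < \<omega>" using assms A by (simp add: \<omega>_def)
  obtain \<rho>1 where \<rho>1: "0 < \<rho>1" "\<rho>1 \<le> 1/2"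
    "\<And>s T y w t t'. local_ivp \<rho>1 s T y w \<Longrightarrow> t \<in> {s..T} \<Longrightarrow> t' \<in> {s..T} \<Longrightarrow>
       norm (total_deriv r (t', w t') - total_deriv r (t, z t)) \<le> \<omega>"
    by (rule total_deriv_near_z[OF \<open>0 < \<omega>\<close> order_refl]) (rule that)
  define \<rho> where "\<rho> = min (min \<rho>0 \<rho>1) (e / (3 * (A * (L * C) + 1)))"
  have den: "0 < A * (L * C) + 1" using A C lip_const(1) by (intro add_nonneg_pos) auto
  show ?thesis
  proof (rule that[of \<rho>])
    show "0 < \<rho>" using C \<rho>1 assms den by (auto simp: \<rho>_def)
    fix s T y w assume w: "local_ivp \<rho> s T y w"
    have w0: "local_ivp \<rho>0 s T y w" and w1: "local_ivp \<rho>1 s T y w"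
      using local_ivp_mono[OF w] by (auto simp: \<rho>_def)
    note * = w[unfolded local_ivp_def ivp_solution_def]
    have sT: "s < T" using * by simp
    have traj: "trajectory_in f smooth_dom s T w" using local_ivp_trajectory[OF w1 \<rho>1(2)] .
    let ?s = "equid_nodes r s T" and ?l = "basic_iter r f s y (equid_nodes r s T) (r + 1)"
    let ?g = "\<lambda>u. f u (w u)"
    have "norm (divided_diff ?g ?s r 0 - total_deriv r (s, w s) /\<^sub>R fact r) \<le> (2 * real r) ^ r * (2 * \<omega>)"
    proof -
      have osc: "norm (total_deriv r (u, w u) - total_deriv r (s, w s)) \<le> 2 * \<omega>" if "u \<in> {s..T}" for u
        using \<rho>1(3)[OF w1, of s u] \<rho>1(3)[OF w1, of s s] that sT
          norm_triangle_ineq4[of "total_deriv r (u, w u) - total_deriv r (s, z s)" "total_deriv r (s, w s) - total_deriv r (s, z s)"] by simp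
      show ?thesis
        using divided_diff_derivative[OF sT r total_deriv(3)[OF _ traj] osc] by (simp add: total_deriv(1))
    qed
    then have 1: "norm (divided_diff ?g ?s r 0 - total_deriv r (s, w s) /\<^sub>R fact r) \<le> 2 * (A * \<omega>)" by (simp add: A_def)
    have "norm (total_deriv r (s, w s) /\<^sub>R fact r - total_deriv r (s, z s) /\<^sub>R fact r)
        = norm (total_deriv r (s, w s) - total_deriv r (s, z s)) / fact r"
      by (simp add: divide_inverse mult.commute flip: scaleR_diff_right)
    also have "\<dots> \<le> \<omega> / 1"
      using \<rho>1(3)[OF w1, of s s] sT \<open>0 < \<omega>\<close> by (intro frac_le) (auto simp: fact_ge_1)
    finally have 2: "norm (total_deriv r (s, w s) /\<^sub>R fact r - total_deriv r (s, z s) /\<^sub>R fact r) \<le> \<omega>" by simp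
    have "norm (divided_diff (\<lambda>u. f u (?l u) - ?g u) ?s r 0)
        \<le> (2 * real r / (T - s)) ^ r * (L * (C * (T - s) ^ (r + 1)))"
    proof (rule divided_diff_bound[OF sT r])
      fix j assume "j \<le> 0 + r"
      then have j: "?s j \<in> {s..T}" using sT by (intro equid_nodes_in) auto
      have "norm (f (?s j) (?l (?s j)) - ?g (?s j)) \<le> L * norm (?l (?s j) - w (?s j))"
        using * j by (intro lip_const(2) basic_iter_Rd) auto
      also have "\<dots> \<le> L * (C * (T - s) ^ (r + 1))"
        using C(4)[OF w0 _ _ j, of r] by (intro mult_left_mono lip_const(1)) auto
      finally show "norm (f (?s j) (?l (?s j)) - ?g (?s j)) \<le> L * (C * (T - s) ^ (r + 1))" .
    qed
    also have "\<dots> = A * (L * C) * (T - s)" using sT by (simp add: A_def power_divide)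
    also have "\<dots> \<le> (A * (L * C) + 1) * (e / (3 * (A * (L * C) + 1)))"
      using * A C lip_const(1) by (intro mult_mono) (auto simp: \<rho>_def)
    also have "\<dots> = e / 3" using den by (simp add: field_simps)
    finally have 3: "norm (divided_diff (\<lambda>u. f u (?l u)) ?s r 0 - divided_diff ?g ?s r 0) \<le> e / 3"
      by (simp add: divided_diff_diff)
    have "2 * (A * \<omega>) + \<omega> \<le> 2 * (A + 1) * \<omega>" using \<open>0 < \<omega>\<close> by (simp add: algebra_simps)
    also have "\<dots> = e / 3" using A by (simp add: \<omega>_def field_simps)
    finally have 4: "2 * (A * \<omega>) + \<omega> \<le> e / 3" .
    have tri: "norm (p - v) \<le> norm (p - q) + (norm (q - u) + norm (u - v))" for p q u v :: rvec
      by norm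
    have "norm (divided_diff (\<lambda>u. f u (?l u)) ?s r 0 - total_deriv r (s, z s) /\<^sub>R fact r) \<le>
      norm (divided_diff (\<lambda>u. f u (?l u)) ?s r 0 - divided_diff ?g ?s r 0) +
      (norm (divided_diff ?g ?s r 0 - total_deriv r (s, w s) /\<^sub>R fact r) +
       norm (total_deriv r (s, w s) /\<^sub>R fact r - total_deriv r (s, z s) /\<^sub>R fact r))"
      by (rule tri)
    with 1 2 3 4 \<open>0 < e\<close> show "norm (divided_diff (\<lambda>u. f u (?l u)) ?s r 0 - total_deriv r (s, z s) /\<^sub>R fact r) \<le> e"
      by linarith
  qed
qed

end

section \<open>Global convergence on fine meshes\<close>

text \<open>The recursion for the error is available only as long as the error is at most \<open>\<rho>\<close>, so the explicit
  bound and the validity of the next step are proved together.\<close>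

lemma accumulated_error_bound:
  fixes x e :: "nat \<Rightarrow> real"
  assumes nn: "0 \<le> L" "0 \<le> C" "0 \<le> H" and "e 0 = 0"
    and mono: "\<And>i. i < n \<Longrightarrow> x i \<le> x (Suc i)" and le: "\<And>i. i \<le> n \<Longrightarrow> x i \<le> b"
    and step: "\<And>i. i < n \<Longrightarrow> e i \<le> \<rho> \<Longrightarrow>
      e (Suc i) \<le> (1 + 2 * L * (x (Suc i) - x i)) * e i + C * (x (Suc i) - x i) * H"
    and small: "C * (b - x 0) * exp (2 * L * (b - x 0)) * H \<le> \<rho>"
  shows "i \<le> n \<Longrightarrow> e i \<le> \<rho>"
proof -
  have final: "C * (x i - x 0) * exp (2 * L * (x i - x 0)) * H \<le> \<rho>" if "i \<le> n" "x 0 \<le> x i" for i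
  proof -
    have "C * (x i - x 0) * exp (2 * L * (x i - x 0)) * H \<le> C * (b - x 0) * exp (2 * L * (b - x 0)) * H"
      using that le[OF that(1)] nn
      by (intro mult_right_mono mult_mono mult_left_mono) (auto intro!: mult_left_mono)
    with small show ?thesis by linarith
  qed
  have inv: "i \<le> n \<Longrightarrow> x 0 \<le> x i \<and> e i \<le> C * (x i - x 0) * exp (2 * L * (x i - x 0)) * H" for i
  proof (induction i)
    case 0
    then show ?case using \<open>e 0 = 0\<close> by simp
  next
    case (Suc i)
    let ?h = "x (Suc i) - x i" and ?E = "\<lambda>i. exp (2 * L * (x i - x 0))"
    have IH: "x 0 \<le> x i" "e i \<le> C * (x i - x 0) * ?E i * H" using Suc by auto
    have h: "0 \<le> ?h" using mono[of i] Suc by simp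
    have "e i \<le> \<rho>" using IH(2) final[of i] IH(1) Suc.prems by simp
    then have "e (Suc i) \<le> (1 + 2 * L * ?h) * e i + C * ?h * H" using Suc.prems by (intro step) auto
    also have "\<dots> \<le> exp (2 * L * ?h) * (C * (x i - x 0) * ?E i * H) + C * ?h * H"
    proof (intro add_mono order_refl)
      have "(1 + 2 * L * ?h) * e i \<le> (1 + 2 * L * ?h) * (C * (x i - x 0) * ?E i * H)"
        using nn h by (intro mult_left_mono IH) auto
      also have "\<dots> \<le> exp (2 * L * ?h) * (C * (x i - x 0) * ?E i * H)"
        using nn IH(1) by (intro mult_right_mono exp_ge_add_one_self) auto
      finally show "(1 + 2 * L * ?h) * e i \<le> exp (2 * L * ?h) * (C * (x i - x 0) * ?E i * H)" .
    qed
    also have "\<dots> = C * (x i - x 0) * ?E (Suc i) * H + C * ?h * 1 * H"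
      by (simp add: mult_ac right_diff_distrib flip: exp_add)
    also have "\<dots> \<le> C * (x i - x 0) * ?E (Suc i) * H + C * ?h * ?E (Suc i) * H"
      using nn h IH(1) by (intro add_left_mono mult_right_mono mult_left_mono) auto
    also have "\<dots> = C * (x (Suc i) - x 0) * ?E (Suc i) * H"
      by (simp flip: distrib_right distrib_left)
    finally show ?case using h IH(1) by simp
  qed
  show "i \<le> n \<Longrightarrow> e i \<le> \<rho>" using inv[of i] final[of i] by linarith
qed

lemma powr_root_le:
  assumes "0 < \<epsilon>" "0 \<le> H" "\<epsilon> \<le> H ^ (r + 1)"
  shows "\<epsilon> powr (1 / (real r + 1)) \<le> H"
proof -
  have "0 < H" using assms by (cases "H = 0") auto
  have "\<epsilon> powr (1 / (real r + 1)) \<le> (H ^ (r + 1)) powr (1 / (real r + 1))"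
    using assms by (intro powr_mono2) auto
  also have "\<dots> = (H powr (real r + 1)) powr (1 / (real r + 1))"
    using powr_realpow[OF \<open>0 < H\<close>, of "r + 1"] by (simp add: add.commute)
  also have "\<dots> = H" using \<open>0 < H\<close> by (simp add: powr_powr)
  finally show ?thesis .
qed

lemma powr_root_ge:
  assumes "0 \<le> H" "H ^ (r + 1) \<le> \<epsilon>"
  shows "H \<le> \<epsilon> powr (1 / (real r + 1))"
proof (cases "H = 0")
  case False
  then have "0 < H" using assms by simp
  have "H = (H powr (real r + 1)) powr (1 / (real r + 1))" using \<open>0 < H\<close> by (simp add: powr_powr)
  also have "\<dots> = (H ^ (r + 1)) powr (1 / (real r + 1))"
    using powr_realpow[OF \<open>0 < H\<close>, of "r + 1"] by (simp add: add.commute)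
  also have "\<dots> \<le> \<epsilon> powr (1 / (real r + 1))" using assms \<open>0 < H\<close> by (intro powr_mono2) auto
  finally show ?thesis .
qed simp

context smooth_ivp
begin

lemma small_steps:
  assumes "0 < \<rho>" "0 \<le> C"
  obtains H0 where "0 < H0" "\<And>H. 0 \<le> H \<Longrightarrow> H \<le> H0 \<Longrightarrow>
    H \<le> \<rho> \<and> L * H \<le> 1/2 \<and> H \<le> 1 \<and> C * (b - a) * exp (2 * L * (b - a)) * H \<le> \<rho>"
proof -
  define D where "D = C * (b - a) * exp (2 * L * (b - a))"
  have D: "0 \<le> D" using assms ab by (simp add: D_def)
  define H0 where "H0 = min (min \<rho> 1) (min (1 / (2 * (L + 1))) (\<rho> / (D + 1)))"
  show ?thesis
  proof (rule that[of H0])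
    show "0 < H0" using assms D lip_const(1) by (auto simp: H0_def)
    fix H assume H: "0 \<le> H" "H \<le> H0"
    have "L * H \<le> (L + 1) * (1 / (2 * (L + 1)))"
      using H lip_const(1) by (intro mult_mono) (auto simp: H0_def)
    also have "\<dots> = 1/2" using lip_const(1) by simp
    finally have "L * H \<le> 1/2" .
    moreover have "D * H \<le> (D + 1) * (\<rho> / (D + 1))"
      using H D by (intro mult_mono) (auto simp: H0_def)
    ultimately show "H \<le> \<rho> \<and> L * H \<le> 1/2 \<and> H \<le> 1 \<and> C * (b - a) * exp (2 * L * (b - a)) * H \<le> \<rho>"
      using H D by (simp add: H0_def D_def[symmetric])
  qed
qed

lemma local_ivp_ivp_sol:
  assumes "a \<le> s" "s < T" "T \<le> b" "T - s \<le> \<rho>" "L * (T - s) \<le> 1/2" "y \<in> Rd d" "norm (y - z s) \<le> \<rho>"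
  shows "local_ivp \<rho> s T y (ivp_sol d f s T y)"
  using assms ivp_sol[of s T y] by (auto simp: local_ivp_def)

lemma one_step_error:
  assumes w: "local_ivp \<rho> s T y w" and l: "norm (w T - l) \<le> C * (T - s) ^ (r + 1)"
    and H: "T - s \<le> H" "H \<le> 1" and "0 \<le> C"
  shows "norm (l - z T) \<le> (1 + 2 * L * (T - s)) * norm (y - z s) + C * (T - s) * H"
proof -
  have h: "0 < T - s" using w by (simp add: local_ivp_def)
  have "(T - s) ^ r \<le> (T - s) ^ 1" using h H r by (intro power_decreasing) auto
  then have "(T - s) * (T - s) ^ r \<le> (T - s) * H" using h H by (intro mult_left_mono) auto
  then have "C * (T - s) ^ (r + 1) \<le> C * (T - s) * H"
    using mult_left_mono[OF _ \<open>0 \<le> C\<close>] by (simp add: mult.assoc)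
  moreover have "norm (l - z T) \<le> norm (w T - z T) + norm (w T - l)" by norm
  ultimately show ?thesis using l local_ivp_stable(2)[OF w] by linarith
qed

section \<open>The adaptive mesh\<close>

lemma adapt_step_props:
  assumes x: "a \<le> x" "x \<le> b" and y: "y \<in> Rd d" and pos: "0 < \<epsilon>" "0 < \<beta>" "0 < \<phi>"
    and st: "adapt_step r b \<beta> \<phi> h f \<epsilon> (x, y) = (x', y')"
  shows "x \<le> x'" "x' \<le> b" "x < b \<Longrightarrow> x < x'"
    "x' - x \<le> (\<epsilon> / (8 / 3 * \<beta>)) powr (1 / (real r + 1))" "y' \<in> Rd d"
    "y' = basic_iter r f x y (equid_nodes (r - 1) x x') (r + 1) x'"
    "x = b \<Longrightarrow> y' = y"
proof -
  define xbar where "xbar = x + min (h \<epsilon>) (b - x)"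
  define G where "G = 8 / 3 * (norm (divided_diff
      (\<lambda>t. f t (basic_iter r f x y (equid_nodes r x xbar) (r + 1) t)) (equid_nodes r x xbar) r 0) + \<beta>) * (1 + \<phi>)"
  have x': "x' = x + min ((\<epsilon> / G) powr (1 / (real r + 1))) (b - x)"
    and y': "y' = basic_iter r f x y (equid_nodes (r - 1) x x') (r + 1) x'"
    using st by (auto simp: adapt_step_def Let_def G_def xbar_def)
  show "y' = basic_iter r f x y (equid_nodes (r - 1) x x') (r + 1) x'" by (rule y')
  have "8 / 3 * (0 + \<beta>) * 1 \<le> G" unfolding G_def using pos by (intro mult_mono add_mono) auto
  then have G: "8 / 3 * \<beta> \<le> G" by simp
  then have G0: "0 < G" using pos by linarith
  show *: "x \<le> x'" "x' \<le> b" using x by (auto simp: x')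
  show lt: "x < x'" if "x < b" using that pos G0 by (simp add: x')
  have "(\<epsilon> / G) powr (1 / (real r + 1)) \<le> (\<epsilon> / (8 / 3 * \<beta>)) powr (1 / (real r + 1))"
    using pos G G0 by (intro powr_mono2 divide_left_mono) auto
  then show "x' - x \<le> (\<epsilon> / (8 / 3 * \<beta>)) powr (1 / (real r + 1))" by (simp add: x')
  show eq: "x = b \<Longrightarrow> y' = y" using * by (simp add: y')
  show "y' \<in> Rd d"
  proof (cases "x = b")
    case False
    then show ?thesis unfolding y' using lt x y * by (intro basic_iter_Rd) auto
  qed (use eq y in simp)
qed

context
  fixes \<beta> \<phi> :: real and h :: "real \<Rightarrow> real" and \<epsilon> :: real
  assumes pos: "0 < \<epsilon>" "0 < \<beta>" "0 < \<phi>"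
begin

abbreviation "X i \<equiv> fst (adapt_state r a b \<eta> \<beta> \<phi> h f \<epsilon> i)"
abbreviation "Y i \<equiv> snd (adapt_state r a b \<eta> \<beta> \<phi> h f \<epsilon> i)"

lemma adapt_state_Suc:
  "adapt_step r b \<beta> \<phi> h f \<epsilon> (X i, Y i) = (X (Suc i), Y (Suc i))"
  by (simp add: adapt_state_def)

lemma adapt_state_range: "a \<le> X i \<and> X i \<le> b \<and> Y i \<in> Rd d"
proof (induction i)
  case 0
  then show ?case using ab \<eta> by (simp add: adapt_state_def)
next
  case (Suc i)
  then show ?case
    using adapt_step_props(1,2,5)[OF _ _ _ pos adapt_state_Suc[of i]] by auto
qed

lemmas adapt_state_props = adapt_step_props[OF _ _ _ pos adapt_state_Suc]

text \<open>Since the coefficient in the step-size formula is at least \<open>(8/3) \<beta>\<close>, all steps are at most a fixed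
  multiple of \<open>\<epsilon>\<^sup>1\<^sup>/\<^sup>(\<^sup>r\<^sup>+\<^sup>1\<^sup>)\<close>, however inaccurate the divided differences may be; therefore the computed values
  converge before anything is known about the adaptive mesh.\<close>

lemma adapt_state_converges:
  assumes "0 < \<rho>" "\<rho> \<le> 1/2" "0 \<le> C"
    and C: "\<And>s T y w n t. local_ivp \<rho> s T y w \<Longrightarrow> n \<le> r \<Longrightarrow> r \<le> Suc n \<Longrightarrow> t \<in> {s..T} \<Longrightarrow>
       norm (basic_iter r f s y (equid_nodes n s T) (r + 1) t - w t) \<le> C * (T - s) ^ (r + 1)"
    and H: "0 \<le> H" "H \<le> \<rho> \<and> L * H \<le> 1/2 \<and> H \<le> 1 \<and> C * (b - a) * exp (2 * L * (b - a)) * H \<le> \<rho>"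
      "(\<epsilon> / (8 / 3 * \<beta>)) powr (1 / (real r + 1)) \<le> H"
  shows "norm (Y i - z (X i)) \<le> \<rho>"
proof (rule accumulated_error_bound[where x = X and n = i and L = L and C = C and H = H and b = b])
  show "norm (Y 0 - z (X 0)) = 0" by (simp add: adapt_state_def z_start)
  show "C * (b - X 0) * exp (2 * L * (b - X 0)) * H \<le> \<rho>" using H by (simp add: adapt_state_def)
  fix j
  note R = adapt_state_range[of j]
  note P = adapt_state_props[of j]
  show "X j \<le> X (Suc j)" using P R by auto
  show "X j \<le> b" using R by auto
  assume near: "norm (Y j - z (X j)) \<le> \<rho>"
  show "norm (Y (Suc j) - z (X (Suc j))) \<le> (1 + 2 * L * (X (Suc j) - X j)) * norm (Y j - z (X j))
      + C * (X (Suc j) - X j) * H"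
  proof (cases "X j = b")
    case True
    then have "X (Suc j) = b" "Y (Suc j) = Y j" using P R by (auto intro: antisym)
    then show ?thesis using True by simp
  next
    case False
    then have lt: "X j < X (Suc j)" using P R by auto
    have step: "X (Suc j) - X j \<le> H" using P(4) R H(3) by linarith
    then have LH: "L * (X (Suc j) - X j) \<le> 1/2"
      using H(2) mult_left_mono[OF step lip_const(1)] by linarith
    have w: "local_ivp \<rho> (X j) (X (Suc j)) (Y j) (ivp_sol d f (X j) (X (Suc j)) (Y j))"
      using R lt P(2) step H(2) LH near by (intro local_ivp_ivp_sol) auto
    have yS: "Y (Suc j) = basic_iter r f (X j) (Y j) (equid_nodes (r - 1) (X j) (X (Suc j))) (r + 1) (X (Suc j))"
      using P(6) R by blast
    have "norm (Y (Suc j) - ivp_sol d f (X j) (X (Suc j)) (Y j) (X (Suc j))) \<le> C * (X (Suc j) - X j) ^ (r + 1)"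
      unfolding yS using lt by (intro C[OF w]) auto
    then show ?thesis
      using H(2) step \<open>0 \<le> C\<close> by (intro one_step_error[OF w]) (auto simp: norm_minus_commute)
  qed
qed (use assms lip_const(1) in auto)

end

section \<open>Cost coefficients of the exact solution\<close>

abbreviation "top_deriv t \<equiv> norm (total_deriv r (t, z t))"

lemma hderiv_z: "t \<in> {a..b} \<Longrightarrow> norm (hderiv {a..b} (r + 1) (ivp_sol d f a b \<eta>) t) = top_deriv t"
  using hderiv_trajectory(1)[OF ab z_trajectory] by (simp add: z_def)

lemma bdd_above_top_deriv:
  assumes "S \<subseteq> {a..b}"
  shows "bdd_above ((\<lambda>t. norm (hderiv {a..b} (r + 1) (ivp_sol d f a b \<eta>) t)) ` S)"
proof -
  obtain B where B: "0 \<le> B" "\<And>t. t \<in> {a..b} \<Longrightarrow> norm (total_deriv r (t, z t)) \<le> B"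
    by (rule total_deriv_z_bounded[OF order_refl]) (rule that)
  show ?thesis
    by (rule bdd_aboveI2[of _ _ B]) (use assms B(2) hderiv_z in auto)
qed

lemma cbar_ge:
  assumes "a \<le> x i" "x i \<le> s" "s \<le> x (Suc i)" "x (Suc i) \<le> b" "0 < \<phi>"
  shows "2 * (top_deriv s / fact r + \<beta>) * (1 + \<phi>) \<le> cbar_coef d r a b \<eta> 2 \<beta> \<phi> f x i"
proof -
  have "norm (hderiv {a..b} (r + 1) (ivp_sol d f a b \<eta>) s)
      \<le> (SUP \<alpha>\<in>{x i..x (Suc i)}. norm (hderiv {a..b} (r + 1) (ivp_sol d f a b \<eta>) \<alpha>))"
    using assms by (intro cSUP_upper bdd_above_top_deriv) auto
  then have "top_deriv s \<le> (SUP \<alpha>\<in>{x i..x (Suc i)}. norm (hderiv {a..b} (r + 1) (ivp_sol d f a b \<eta>) \<alpha>))"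
    using hderiv_z[of s] assms by simp
  then show ?thesis
    unfolding cbar_coef_def using assms(5)
    by (intro mult_right_mono mult_left_mono add_right_mono) (auto simp: divide_right_mono)
qed

lemma cbar_le_Nbar:
  assumes "a \<le> x i" "x i \<le> x (Suc i)" "x (Suc i) \<le> b" "0 < \<phi>"
  shows "cbar_coef d r a b \<eta> 2 \<beta> \<phi> f x i \<le> Nbar d r a b \<eta> 2 \<beta> \<phi> f"
  unfolding cbar_coef_def Nbar_def using assms
  by (intro mult_right_mono mult_left_mono add_right_mono cSUP_subset_mono bdd_above_top_deriv) auto

lemma Nbar_attained:
  obtains t where "t \<in> {a..b}" "Nbar d r a b \<eta> 2 \<beta> \<phi> f = 2 * (top_deriv t / fact r + \<beta>) * (1 + \<phi>)"
    "\<And>s. s \<in> {a..b} \<Longrightarrow> top_deriv s \<le> top_deriv t"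
proof -
  have "continuous_on {a..b} (\<lambda>t. top_deriv t)"
    by (intro continuous_on_norm continuous_on_compose2[OF total_deriv(2)[OF order_refl]])
       (auto intro!: continuous_intros z_cont z_smooth_dom)
  then obtain t where t: "t \<in> {a..b}" "\<And>s. s \<in> {a..b} \<Longrightarrow> top_deriv s \<le> top_deriv t"
    using continuous_attains_sup[of "{a..b}" "\<lambda>t. top_deriv t"] ab by force
  have "(SUP s\<in>{a..b}. norm (hderiv {a..b} (r + 1) (ivp_sol d f a b \<eta>) s)) = (SUP s\<in>{a..b}. top_deriv s)"
    by (intro SUP_cong refl hderiv_z)
  also have "\<dots> = top_deriv t" using t by (intro cSup_eq_maximum) auto
  finally have "Nbar d r a b \<eta> 2 \<beta> \<phi> f = 2 * (top_deriv t / fact r + \<beta>) * (1 + \<phi>)"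
    by (simp add: Nbar_def)
  with t show ?thesis using that by blast
qed

lemma Nbar_pos: "0 < \<beta> \<Longrightarrow> 0 < \<phi> \<Longrightarrow> 0 < Nbar d r a b \<eta> 2 \<beta> \<phi> f"
  by (rule Nbar_attained[of \<beta> \<phi>]) (auto intro!: mult_pos_pos add_nonneg_pos)

section \<open>The adaptive mesh dominates every mesh of small cost\<close>

text \<open>The tolerance \<open>\<beta> / 5\<close> is a relative one in disguise: it is at most a fifth of the quantity
  \<open>\<parallel>z\<^sup>(\<^sup>r\<^sup>+\<^sup>1\<^sup>)\<parallel> / r! + \<beta>\<close> that the algorithm estimates.\<close>

definition dd_accurate :: "real \<Rightarrow> (real \<Rightarrow> real) \<Rightarrow> real \<Rightarrow> real \<Rightarrow> rvec \<Rightarrow> bool" where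
  "dd_accurate \<beta> h \<epsilon> s y \<longleftrightarrow> (let T = s + min (h \<epsilon>) (b - s) in
     norm (divided_diff (\<lambda>t. f t (basic_iter r f s y (equid_nodes r s T) (r + 1) t)) (equid_nodes r s T) r 0
       - total_deriv r (s, z s) /\<^sub>R fact r) \<le> \<beta> / 5)"

text \<open>The algorithm's coefficient is at most \<open>(8/3)(6/5)\<close> times \<open>c / 2\<close>, that is \<open>(8/5) c\<close>, and
  \<open>(8/5)(5/4)(1/2) = 1\<close>; hence a length of cost \<open>(5/4)(\<epsilon>/2)\<close> is not longer than the step that is taken.\<close>

lemma adapt_step_length:
  assumes pos: "0 < \<epsilon>" "0 < \<beta>" "0 < \<phi>" and acc: "dd_accurate \<beta> h \<epsilon> s y"
    and st: "adapt_step r b \<beta> \<phi> h f \<epsilon> (s, y) = (s', y')"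
    and c: "2 * (top_deriv s / fact r + \<beta>) * (1 + \<phi>) \<le> c"
    and l: "0 \<le> l" "l \<le> b - s" "c * l ^ (r + 1) \<le> 5/4 * (\<epsilon> / 2)"
  shows "s + l \<le> s'"
proof -
  define T where "T = s + min (h \<epsilon>) (b - s)"
  define D where "D = divided_diff (\<lambda>t. f t (basic_iter r f s y (equid_nodes r s T) (r + 1) t)) (equid_nodes r s T) r 0"
  define G where "G = 8 / 3 * (norm D + \<beta>) * (1 + \<phi>)"
  have s': "s' = s + min ((\<epsilon> / G) powr (1 / (real r + 1))) (b - s)"
    using st by (auto simp: adapt_step_def Let_def G_def D_def T_def)
  have G0: "0 < G" unfolding G_def using pos by (intro mult_pos_pos add_nonneg_pos) auto
  have "norm (D - total_deriv r (s, z s) /\<^sub>R fact r) \<le> \<beta> / 5"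
    using acc by (simp add: dd_accurate_def Let_def T_def D_def)
  then have "norm D \<le> norm (total_deriv r (s, z s) /\<^sub>R fact r) + \<beta> / 5"
    using norm_triangle_sub[of D "total_deriv r (s, z s) /\<^sub>R fact r"] by linarith
  moreover have "norm (total_deriv r (s, z s) /\<^sub>R fact r) = top_deriv s / fact r"
    by (simp add: divide_inverse mult.commute)
  moreover have "0 \<le> top_deriv s / fact r" by simp
  ultimately have "norm D + \<beta> \<le> 6/5 * (top_deriv s / fact r + \<beta>)" by argo
  then have "G \<le> 8 / 3 * (6/5 * (top_deriv s / fact r + \<beta>)) * (1 + \<phi>)"
    unfolding G_def using pos by (intro mult_right_mono mult_left_mono) auto
  also have "\<dots> = 8/5 * (2 * (top_deriv s / fact r + \<beta>) * (1 + \<phi>))" by simp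
  also have "\<dots> \<le> 8/5 * c" using c by (intro mult_left_mono) auto
  finally have "G * l ^ (r + 1) \<le> 8/5 * c * l ^ (r + 1)" using l by (intro mult_right_mono) auto
  also have "\<dots> \<le> \<epsilon>" using l(3) by (simp add: mult.assoc)
  finally have "l ^ (r + 1) \<le> \<epsilon> / G" using G0 by (simp add: field_simps)
  then have "l \<le> (\<epsilon> / G) powr (1 / (real r + 1))" by (intro powr_root_ge l)
  then show ?thesis using l(2) by (simp add: s')
qed

lemma eventually_dd_accurate:
  assumes \<beta>: "0 < \<beta>" and \<phi>: "0 < \<phi>" and h: "\<forall>\<epsilon>\<in>{0<..<1}. 0 < h \<epsilon>"
    "h \<in> O[at_right 0](\<lambda>\<epsilon>. \<epsilon> powr (1 / (real r + 1)))"
  shows "\<forall>\<^sub>F \<epsilon> in at_right 0. \<forall>i. fst (adapt_state r a b \<eta> \<beta> \<phi> h f \<epsilon> i) < b \<longrightarrow>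
    dd_accurate \<beta> h \<epsilon> (fst (adapt_state r a b \<eta> \<beta> \<phi> h f \<epsilon> i)) (snd (adapt_state r a b \<eta> \<beta> \<phi> h f \<epsilon> i))"
proof -
  have "0 < \<beta> / 5" using \<beta> by simp
  obtain \<rho>1 where \<rho>1: "0 < \<rho>1" "\<And>s T y w. local_ivp \<rho>1 s T y w \<Longrightarrow>
       norm (divided_diff (\<lambda>t. f t (basic_iter r f s y (equid_nodes r s T) (r + 1) t)) (equid_nodes r s T) r 0
         - total_deriv r (s, z s) /\<^sub>R fact r) \<le> \<beta> / 5"
    by (rule divided_diff_consistent[OF \<open>0 < \<beta> / 5\<close>]) (rule that)
  obtain C \<rho>2 where C: "0 \<le> C" "0 < \<rho>2" "\<rho>2 \<le> 1/2"
    "\<And>s T y w n t. local_ivp \<rho>2 s T y w \<Longrightarrow> n \<le> r \<Longrightarrow> r \<le> Suc n \<Longrightarrow> t \<in> {s..T} \<Longrightarrow>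
       norm (basic_iter r f s y (equid_nodes n s T) (r + 1) t - w t) \<le> C * (T - s) ^ (r + 1)"
    by (rule basic_iter_consistent) (rule that)
  define \<rho> where "\<rho> = min \<rho>1 \<rho>2"
  have \<rho>: "0 < \<rho>" "\<rho> \<le> 1/2" "\<rho> \<le> \<rho>1" "\<rho> \<le> \<rho>2" using \<rho>1 C by (auto simp: \<rho>_def)
  obtain H where H: "0 < H" "\<And>H'. 0 \<le> H' \<Longrightarrow> H' \<le> H \<Longrightarrow>
    H' \<le> \<rho> \<and> L * H' \<le> 1/2 \<and> H' \<le> 1 \<and> C * (b - a) * exp (2 * L * (b - a)) * H' \<le> \<rho>"
    by (rule small_steps[OF \<rho>(1) C(1)]) (rule that)
  obtain c where c: "0 < c" "\<forall>\<^sub>F \<epsilon> in at_right 0. norm (h \<epsilon>) \<le> c * norm (\<epsilon> powr (1 / (real r + 1)))"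
    using landau_o.bigE[OF h(2)] by metis
  define e0 where "e0 = min 1 (min (H ^ (r + 1) * (8 / 3 * \<beta>)) ((H / c) ^ (r + 1)))"
  have "0 < e0" using H(1) \<beta> c(1) by (simp add: e0_def)
  then have "\<forall>\<^sub>F \<epsilon> in at_right 0. \<epsilon> \<in> {0<..<e0}" by (rule eventually_at_right_real)
  with c(2) show ?thesis
  proof eventually_elim
    case (elim \<epsilon>)
    then have e: "0 < \<epsilon>" "\<epsilon> < 1" "\<epsilon> < H ^ (r + 1) * (8 / 3 * \<beta>)" "\<epsilon> < (H / c) ^ (r + 1)"
      by (auto simp: e0_def)
    have "\<epsilon> powr (1 / (real r + 1)) \<le> H / c" using e H(1) c(1) by (intro powr_root_le) auto
    then have "c * \<epsilon> powr (1 / (real r + 1)) \<le> H" using c(1) by (simp add: field_simps)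
    then have hH: "h \<epsilon> \<le> H" using elim(1) by simp
    have h0: "0 < h \<epsilon>" using h(1) e by simp
    have "\<epsilon> / (8 / 3 * \<beta>) \<le> H ^ (r + 1)" using e \<beta> by (simp add: field_simps)
    then have step: "(\<epsilon> / (8 / 3 * \<beta>)) powr (1 / (real r + 1)) \<le> H"
      using e \<beta> H(1) by (intro powr_root_le) auto
    note pos = e(1) \<beta> \<phi>
    show ?case
    proof (intro allI impI)
      fix i
      let ?s = "fst (adapt_state r a b \<eta> \<beta> \<phi> h f \<epsilon> i)" and ?y = "snd (adapt_state r a b \<eta> \<beta> \<phi> h f \<epsilon> i)"
      assume lt: "?s < b"
      note R = adapt_state_range[OF pos, of h i]
      have near: "norm (?y - z ?s) \<le> \<rho>"
      proof (rule adapt_state_converges[OF pos \<rho>(1,2) C(1)])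
        show "\<And>s T y w n t. local_ivp \<rho> s T y w \<Longrightarrow> n \<le> r \<Longrightarrow> r \<le> Suc n \<Longrightarrow> t \<in> {s..T} \<Longrightarrow>
           norm (basic_iter r f s y (equid_nodes n s T) (r + 1) t - w t) \<le> C * (T - s) ^ (r + 1)"
          using C(4) local_ivp_mono[OF _ \<rho>(4)] by blast
      qed (use H step in auto)
      let ?T = "?s + min (h \<epsilon>) (b - ?s)"
      have T: "?s < ?T" "?T \<le> b" "0 \<le> ?T - ?s" "?T - ?s \<le> H" using lt h0 hH by auto
      have "local_ivp \<rho> ?s ?T ?y (ivp_sol d f ?s ?T ?y)"
        using R T near H(2)[OF T(3,4)] by (intro local_ivp_ivp_sol) auto
      from \<rho>1(2)[OF local_ivp_mono[OF this \<rho>(3)]]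
      show "dd_accurate \<beta> h \<epsilon> ?s ?y" by (simp add: dd_accurate_def Let_def)
    qed
  qed
qed

lemma weak_mesh_mono: "is_weak_mesh a b m x \<Longrightarrow> i \<le> j \<Longrightarrow> j \<le> m \<Longrightarrow> x i \<le> x j"
proof (induction j)
  case (Suc j)
  then show ?case by (cases "i = Suc j") (auto simp: is_weak_mesh_def intro: order_trans)
qed simp

lemma weak_mesh_range: "is_weak_mesh a b m x \<Longrightarrow> i \<le> m \<Longrightarrow> a \<le> x i \<and> x i \<le> b"
  using weak_mesh_mono[of m x 0 i] weak_mesh_mono[of m x i m] by (simp add: is_weak_mesh_def)

text \<open>If the adaptive node has already passed the cell, nothing is to be shown. Otherwise it lies in
  the cell, whose coefficient bounds the local derivative at that node, and the rest of the cell is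
  covered by the next step.\<close>

lemma adapt_dominates:
  assumes pos: "0 < \<epsilon>" "0 < \<beta>" "0 < \<phi>"
    and acc: "\<forall>i. fst (adapt_state r a b \<eta> \<beta> \<phi> h f \<epsilon> i) < b \<longrightarrow>
      dd_accurate \<beta> h \<epsilon> (fst (adapt_state r a b \<eta> \<beta> \<phi> h f \<epsilon> i)) (snd (adapt_state r a b \<eta> \<beta> \<phi> h f \<epsilon> i))"
    and x: "is_weak_mesh a b m x"
    and cost: "\<And>i. i < m \<Longrightarrow> cbar_coef d r a b \<eta> 2 \<beta> \<phi> f x i * mesh_step x i ^ (r + 1) \<le> 5/4 * (\<epsilon> / 2)"
  shows "i \<le> m \<Longrightarrow> x i \<le> fst (adapt_state r a b \<eta> \<beta> \<phi> h f \<epsilon> i)"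
proof (induction i)
  case 0
  then show ?case using x by (simp add: adapt_state_def is_weak_mesh_def)
next
  case (Suc i)
  let ?s = "fst (adapt_state r a b \<eta> \<beta> \<phi> h f \<epsilon> i)" and ?y = "snd (adapt_state r a b \<eta> \<beta> \<phi> h f \<epsilon> i)"
  have IH: "x i \<le> ?s" using Suc by simp
  note R = adapt_state_range[OF pos, of h i]
  note st = adapt_state_Suc[OF pos, of h i]
  have xb: "a \<le> x i" "x (Suc i) \<le> b" "x i \<le> x (Suc i)"
    using weak_mesh_range[OF x] weak_mesh_mono[OF x, of i "Suc i"] Suc.prems by auto
  show ?case
  proof (cases "?s < x (Suc i)")
    case False
    then show ?thesis using adapt_state_props(1)[OF pos, of h i] R by linarith
  next
    case True
    let ?c = "cbar_coef d r a b \<eta> 2 \<beta> \<phi> f x i" and ?l = "x (Suc i) - ?s"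
    have c: "2 * (top_deriv ?s / fact r + \<beta>) * (1 + \<phi>) \<le> ?c"
      using xb IH True pos by (intro cbar_ge) auto
    have "0 \<le> 2 * (top_deriv ?s / fact r + \<beta>) * (1 + \<phi>)" using pos by auto
    then have c0: "0 \<le> ?c" using c by linarith
    have "?c * ?l ^ (r + 1) \<le> ?c * mesh_step x i ^ (r + 1)"
      using c0 True IH by (intro mult_left_mono power_mono) (auto simp: mesh_step_def)
    also have "\<dots> \<le> 5/4 * (\<epsilon> / 2)" using Suc.prems by (intro cost) auto
    finally have "?s + ?l \<le> fst (adapt_state r a b \<eta> \<beta> \<phi> h f \<epsilon> (Suc i))"
      using True xb acc by (intro adapt_step_length[OF pos _ st c]) auto
    then show ?thesis by simp
  qed
qed

lemma mstar_le:
  assumes pos: "0 < \<epsilon>" "0 < \<beta>" "0 < \<phi>" and "b \<le> fst (adapt_state r a b \<eta> \<beta> \<phi> h f \<epsilon> m)"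
  shows "mstar r a b \<eta> \<beta> \<phi> h f \<epsilon> \<le> enat m"
proof -
  have "fst (adapt_state r a b \<eta> \<beta> \<phi> h f \<epsilon> m) = b"
    using assms(4) adapt_state_range[OF pos, of h m] by auto
  then show ?thesis
    unfolding mstar_def by (intro INF_lower) (simp add: adapt_mesh_def)
qed

section \<open>Counting subintervals\<close>

lemma equid_cost_iff:
  assumes "0 < N" "0 < \<epsilon>" "1 \<le> m"
  shows "N * ((b - a) / real m) ^ (r + 1) \<le> \<epsilon> \<longleftrightarrow> (b - a) * (N / \<epsilon>) powr (1 / (real r + 1)) \<le> real m"
proof -
  define q where "q = (N / \<epsilon>) powr (1 / (real r + 1))"
  have q: "0 < q" using assms by (simp add: q_def)
  have "q ^ (r + 1) = q powr (real r + 1)" using powr_realpow[OF q, of "r + 1"] by (simp add: add.commute)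
  also have "\<dots> = N / \<epsilon>" using assms by (simp add: q_def powr_powr)
  finally have qp: "q ^ (r + 1) = N / \<epsilon>" .
  have "N * ((b - a) / real m) ^ (r + 1) \<le> \<epsilon> \<longleftrightarrow> ((b - a) * q) ^ (r + 1) \<le> real m ^ (r + 1)"
    unfolding power_mult_distrib qp power_divide using assms by (simp add: field_simps)
  also have "\<dots> \<longleftrightarrow> (b - a) * q \<le> real m"
    using ab q by (intro power_mono_iff) auto
  finally show ?thesis by (simp add: q_def)
qed

lemma Least_real_ge:
  assumes "0 < A"
  shows "(LEAST m. 1 \<le> m \<and> A \<le> real m) = nat \<lceil>A\<rceil>"
  using assms by (intro Least_equality) linarith+

lemma mbar_equid_eq:
  assumes "0 < \<beta>" "0 < \<phi>" "0 < \<epsilon>"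
  shows "mbar_equid d r a b \<eta> 2 \<beta> \<phi> f \<epsilon>
    = nat \<lceil>(b - a) * (Nbar d r a b \<eta> 2 \<beta> \<phi> f / \<epsilon>) powr (1 / (real r + 1))\<rceil>"
proof -
  have N: "0 < Nbar d r a b \<eta> 2 \<beta> \<phi> f" using assms by (intro Nbar_pos)
  then have A: "0 < (b - a) * (Nbar d r a b \<eta> 2 \<beta> \<phi> f / \<epsilon>) powr (1 / (real r + 1))"
    using ab assms by simp
  have "(\<lambda>m. 1 \<le> m \<and> Nbar d r a b \<eta> 2 \<beta> \<phi> f * ((b - a) / real m) ^ (r + 1) \<le> \<epsilon>)
      = (\<lambda>m. 1 \<le> m \<and> (b - a) * (Nbar d r a b \<eta> 2 \<beta> \<phi> f / \<epsilon>) powr (1 / (real r + 1)) \<le> real m)"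
    by (intro ext conj_cong refl equid_cost_iff N \<open>0 < \<epsilon>\<close>)
  from arg_cong[OF this, of Least] show ?thesis
    unfolding mbar_equid_def Least_real_ge[OF A] .
qed

lemma uniform_mesh_step: "mesh_step (uniform_mesh a b m) i = (b - a) / real m"
  unfolding mesh_step_def uniform_mesh_def of_nat_Suc distrib_right by simp

lemma is_mesh_uniform:
  assumes "1 \<le> m"
  shows "is_mesh a b m (uniform_mesh a b m)"
proof -
  have "uniform_mesh a b m i < uniform_mesh a b m (Suc i)" for i
  proof -
    have "0 < (b - a) / real m" using ab assms by simp
    then have "0 < mesh_step (uniform_mesh a b m) i" unfolding uniform_mesh_step .
    then show ?thesis unfolding mesh_step_def by simp
  qed
  then show ?thesis using assms by (simp add: is_mesh_def) (simp add: uniform_mesh_def)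
qed

lemma is_weak_mesh_uniform: "1 \<le> m \<Longrightarrow> is_weak_mesh a b m (uniform_mesh a b m)"
  using is_mesh_uniform[of m] by (auto simp: is_mesh_def is_weak_mesh_def less_imp_le)

lemma mesh_cell:
  assumes x: "is_weak_mesh a b m x" and "0 < m" "t \<in> {a..b}"
  obtains i where "i < m" "t \<in> {x i..x (Suc i)}"
proof -
  have "\<exists>i<n. t \<in> {x i..x (Suc i)}" if "0 < n" "t \<in> {x 0..x n}" for n
    using that
  proof (induction n)
    case (Suc n)
    show ?case
    proof (cases "0 < n \<and> t \<le> x n")
      case True
      then show ?thesis using Suc by (auto simp: less_Suc_eq)
    next
      case False
      then show ?thesis using Suc.prems by (intro exI[of _ n]) auto
    qed
  qed simp
  from this[of m] show ?thesis using assms that by (auto simp: is_weak_mesh_def)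
qed

lemma kbar_le_mesh_cost:
  assumes x: "is_weak_mesh a b m x" "admissible ell K k0 m x" and m: "1 \<le> m" and pos: "0 < \<beta>" "0 < \<phi>"
  shows "kbar d r a b \<eta> ell K k0 2 \<beta> \<phi> f m
    \<le> Max ((\<lambda>i. cbar_coef d r a b \<eta> 2 \<beta> \<phi> f x i * mesh_step x i ^ (r + 1)) ` {..<m})"
  unfolding kbar_def
proof (rule cInf_lower)
  show "bdd_below {Max ((\<lambda>i. cbar_coef d r a b \<eta> 2 \<beta> \<phi> f x i * mesh_step x i ^ (r + 1)) ` {..<m}) | x.
            is_weak_mesh a b m x \<and> admissible ell K k0 m x}"
  proof (rule bdd_belowI[of _ 0], clarify)
    fix x assume x: "is_weak_mesh a b m x"
    have x01: "a \<le> x 0" "x 0 \<le> x (Suc 0)" "x (Suc 0) \<le> b"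
      using weak_mesh_range[OF x] weak_mesh_mono[OF x, of 0 "Suc 0"] m by auto
    have "0 \<le> 2 * (top_deriv (x 0) / fact r + \<beta>) * (1 + \<phi>)" using pos by auto
    also have "\<dots> \<le> cbar_coef d r a b \<eta> 2 \<beta> \<phi> f x 0" using x01 pos by (intro cbar_ge) auto
    finally have "0 \<le> cbar_coef d r a b \<eta> 2 \<beta> \<phi> f x 0 * mesh_step x 0 ^ (r + 1)"
      using x01 by (intro mult_nonneg_nonneg) (auto simp: mesh_step_def)
    also have "\<dots> \<le> Max ((\<lambda>i. cbar_coef d r a b \<eta> 2 \<beta> \<phi> f x i * mesh_step x i ^ (r + 1)) ` {..<m})"
      using m by (intro Max_ge) auto
    finally show "0 \<le> Max ((\<lambda>i. cbar_coef d r a b \<eta> 2 \<beta> \<phi> f x i * mesh_step x i ^ (r + 1)) ` {..<m})" .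
  qed
qed (use x in blast)

lemma kbar_le_equid:
  assumes adm: "admissible ell K k0 m (uniform_mesh a b m)" and m: "1 \<le> m" and pos: "0 < \<beta>" "0 < \<phi>"
  shows "kbar d r a b \<eta> ell K k0 2 \<beta> \<phi> f m \<le> Nbar d r a b \<eta> 2 \<beta> \<phi> f * ((b - a) / real m) ^ (r + 1)"
proof -
  let ?x = "uniform_mesh a b m"
  note x = is_weak_mesh_uniform[OF m]
  have "Max ((\<lambda>i. cbar_coef d r a b \<eta> 2 \<beta> \<phi> f ?x i * mesh_step ?x i ^ (r + 1)) ` {..<m})
      \<le> Nbar d r a b \<eta> 2 \<beta> \<phi> f * ((b - a) / real m) ^ (r + 1)"
  proof (rule Max.boundedI; clarify?)
    fix i assume "i < m"
    then have "a \<le> ?x i" "?x i \<le> ?x (Suc i)" "?x (Suc i) \<le> b"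
      using weak_mesh_range[OF x] weak_mesh_mono[OF x, of i "Suc i"] by auto
    then show "cbar_coef d r a b \<eta> 2 \<beta> \<phi> f ?x i * mesh_step ?x i ^ (r + 1)
        \<le> Nbar d r a b \<eta> 2 \<beta> \<phi> f * ((b - a) / real m) ^ (r + 1)"
      unfolding uniform_mesh_step using pos ab by (intro mult_right_mono cbar_le_Nbar) auto
  qed (use m in \<open>auto simp: lessThan_empty_iff\<close>)
  with kbar_le_mesh_cost[OF x adm m pos] show ?thesis by linarith
qed

lemma mbar_equid_cost:
  assumes "0 < \<beta>" "0 < \<phi>" "0 < \<epsilon>"
  shows "1 \<le> mbar_equid d r a b \<eta> 2 \<beta> \<phi> f \<epsilon> \<and>
    Nbar d r a b \<eta> 2 \<beta> \<phi> f * ((b - a) / real (mbar_equid d r a b \<eta> 2 \<beta> \<phi> f \<epsilon>)) ^ (r + 1) \<le> \<epsilon>"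
proof -
  let ?N = "Nbar d r a b \<eta> 2 \<beta> \<phi> f" and ?m = "mbar_equid d r a b \<eta> 2 \<beta> \<phi> f \<epsilon>"
  have N: "0 < ?N" using assms by (intro Nbar_pos)
  have A: "0 < (b - a) * (?N / \<epsilon>) powr (1 / (real r + 1))" using ab assms N by simp
  then have 1: "1 \<le> ?m" "(b - a) * (?N / \<epsilon>) powr (1 / (real r + 1)) \<le> real ?m"
    unfolding mbar_equid_eq[OF assms] by linarith+
  then show ?thesis using equid_cost_iff[OF N \<open>0 < \<epsilon>\<close> 1(1)] by simp
qed

text \<open>The infimum in the optimal cost need not be attained, which is why the mesh obtained here has
  the slightly larger cost \<open>(5/4) \<epsilon>\<close>.\<close>

lemma mbar_properties:
  assumes adm: "\<And>m. 1 \<le> m \<Longrightarrow> admissible ell K k0 m (uniform_mesh a b m)"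
    and pos: "0 < \<beta>" "0 < \<phi>" "0 < \<epsilon>"
  shows "mbar d r a b \<eta> ell K k0 2 \<beta> \<phi> f \<epsilon> \<le> mbar_equid d r a b \<eta> 2 \<beta> \<phi> f \<epsilon>"
    and "\<exists>x. is_weak_mesh a b (mbar d r a b \<eta> ell K k0 2 \<beta> \<phi> f \<epsilon>) x \<and>
      (\<forall>i<mbar d r a b \<eta> ell K k0 2 \<beta> \<phi> f \<epsilon>.
         cbar_coef d r a b \<eta> 2 \<beta> \<phi> f x i * mesh_step x i ^ (r + 1) \<le> 5/4 * \<epsilon>)"
proof -
  let ?P = "\<lambda>m. 1 \<le> m \<and> kbar d r a b \<eta> ell K k0 2 \<beta> \<phi> f m \<le> \<epsilon>"
  let ?e = "mbar_equid d r a b \<eta> 2 \<beta> \<phi> f \<epsilon>" and ?m = "mbar d r a b \<eta> ell K k0 2 \<beta> \<phi> f \<epsilon>"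
  have e: "1 \<le> ?e" using mbar_equid_cost[OF pos] by simp
  have P: "?P ?e"
    using mbar_equid_cost[OF pos] kbar_le_equid[OF adm[OF e] e pos(1,2)] by linarith
  then show "?m \<le> ?e" unfolding mbar_def by (rule Least_le)
  have Pm: "?P ?m" unfolding mbar_def using P by (rule LeastI)
  let ?c = "\<lambda>x. Max ((\<lambda>i. cbar_coef d r a b \<eta> 2 \<beta> \<phi> f x i * mesh_step x i ^ (r + 1)) ` {..<?m})"
  have lt: "Inf {?c x | x. is_weak_mesh a b ?m x \<and> admissible ell K k0 ?m x} < 5/4 * \<epsilon>"
    using Pm pos unfolding kbar_def by auto
  have "{?c x | x. is_weak_mesh a b ?m x \<and> admissible ell K k0 ?m x} \<noteq> {}"
    using is_weak_mesh_uniform adm Pm by blast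
  from cInf_lessD[OF this lt] obtain x where x: "is_weak_mesh a b ?m x" "?c x < 5/4 * \<epsilon>"
    by force
  have "cbar_coef d r a b \<eta> 2 \<beta> \<phi> f x i * mesh_step x i ^ (r + 1) \<le> 5/4 * \<epsilon>" if "i < ?m" for i
  proof -
    have "cbar_coef d r a b \<eta> 2 \<beta> \<phi> f x i * mesh_step x i ^ (r + 1) \<le> ?c x"
      using that by (intro Max_ge) auto
    with x(2) show ?thesis by linarith
  qed
  with x(1) show "\<exists>x. is_weak_mesh a b ?m x \<and> (\<forall>i<?m.
         cbar_coef d r a b \<eta> 2 \<beta> \<phi> f x i * mesh_step x i ^ (r + 1) \<le> 5/4 * \<epsilon>)" by blast
qed

section \<open>Methods on uniform meshes\<close>

lemma c_coef_local:
  assumes w: "local_ivp \<rho> (x i) (x (Suc i)) y (local_sol d M \<eta> f m x i)" and \<rho>: "\<rho> \<le> 1/2"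
  shows "c_coef d r 2 \<beta> M \<eta> f m x i = ereal 2 * (ereal (1 / fact r) *
    (SUP t\<in>{x i..x (Suc i)}. ereal (norm (total_deriv r (t, local_sol d M \<eta> f m x i t)))) + ereal \<beta>)"
proof -
  have lt: "x i < x (Suc i)" using w by (simp add: local_ivp_def)
  note traj = local_ivp_trajectory[OF w \<rho>]
  have "(SUP t\<in>{x i..x (Suc i)}. ereal (norm (hderiv {x i..x (Suc i)} (r + 1) (local_sol d M \<eta> f m x i) t)))
      = (SUP t\<in>{x i..x (Suc i)}. ereal (norm (total_deriv r (t, local_sol d M \<eta> f m x i t))))"
    by (intro SUP_cong refl) (simp only: hderiv_trajectory(1)[OF lt traj])
  then show ?thesis
    using hderiv_trajectory(2)[OF lt traj] by (simp only: c_coef_def Let_def if_True)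
qed

lemma c_coef_le:
  assumes w: "local_ivp \<rho> (x i) (x (Suc i)) y (local_sol d M \<eta> f m x i)" and \<rho>: "\<rho> \<le> 1/2"
    and B: "\<And>t. t \<in> {x i..x (Suc i)} \<Longrightarrow> norm (total_deriv r (t, local_sol d M \<eta> f m x i t)) \<le> B"
  shows "c_coef d r 2 \<beta> M \<eta> f m x i \<le> ereal (2 * (B / fact r + \<beta>))"
proof -
  have "c_coef d r 2 \<beta> M \<eta> f m x i \<le> ereal 2 * (ereal (1 / fact r) * ereal B + ereal \<beta>)"
    unfolding c_coef_local[OF w \<rho>]
    by (intro ereal_mult_left_mono add_right_mono SUP_least) (auto intro: B)
  then show ?thesis by simp
qed

lemma c_coef_ge:
  assumes w: "local_ivp \<rho> (x i) (x (Suc i)) y (local_sol d M \<eta> f m x i)" and \<rho>: "\<rho> \<le> 1/2"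
    and t: "t \<in> {x i..x (Suc i)}"
  shows "ereal (2 * (norm (total_deriv r (t, local_sol d M \<eta> f m x i t)) / fact r + \<beta>)) \<le> c_coef d r 2 \<beta> M \<eta> f m x i"
proof -
  have "ereal 2 * (ereal (1 / fact r) * ereal (norm (total_deriv r (t, local_sol d M \<eta> f m x i t))) + ereal \<beta>)
      \<le> c_coef d r 2 \<beta> M \<eta> f m x i"
    unfolding c_coef_local[OF w \<rho>] using t
    by (intro ereal_mult_left_mono add_right_mono SUP_upper) auto
  then show ?thesis by simp
qed

text \<open>This bound holds without any closeness to \<open>z\<close>, and also when the coefficient is infinite. It
  excludes that a coarse mesh satisfies the stopping criterion by accident.\<close>

lemma c_coef_ge_beta:
  assumes "x i \<le> x (Suc i)"
  shows "ereal (2 * \<beta>) \<le> c_coef d r 2 \<beta> M \<eta> f m x i"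
proof (cases "hdifferentiable_on {x i..x (Suc i)} (r + 1) (local_sol d M \<eta> f m x i)")
  case True
  let ?g = "\<lambda>t. ereal (norm (hderiv {x i..x (Suc i)} (r + 1) (local_sol d M \<eta> f m x i) t))"
  have "0 \<le> ?g (x i)" by simp
  also have "\<dots> \<le> (SUP t\<in>{x i..x (Suc i)}. ?g t)" using assms by (intro SUP_upper) auto
  finally have "ereal 2 * (0 + ereal \<beta>) \<le> ereal 2 * (ereal (1 / fact r) * (SUP t\<in>{x i..x (Suc i)}. ?g t) + ereal \<beta>)"
    by (intro ereal_mult_left_mono add_right_mono ereal_0_le_mult) auto
  then show ?thesis using True by (simp add: c_coef_def Let_def del: hderiv.simps)
qed (simp add: c_coef_def)

context
  fixes M :: ivp_method and \<beta> :: real and ell :: "nat \<Rightarrow> real"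
    and K :: "(real \<Rightarrow> rvec \<Rightarrow> rvec) \<Rightarrow> real" and k0 :: "(real \<Rightarrow> rvec \<Rightarrow> rvec) \<Rightarrow> nat"
  assumes M: "is_method d r a b \<eta> M" and A: "assumption_A d r a b \<eta> ell K k0 2 \<beta> M"
    and adm: "\<And>m. 1 \<le> m \<Longrightarrow> admissible ell (K f) (k0 f) m (uniform_mesh a b m)" and \<beta>: "0 < \<beta>"
begin

abbreviation "U m \<equiv> uniform_mesh a b m"

abbreviation "loc m i \<equiv> local_sol d M \<eta> f m (U m) i"

lemma method_one_step:
  obtains m0 where "\<And>m i. m0 \<le> m \<Longrightarrow> 1 \<le> m \<Longrightarrow> i < m \<Longrightarrow>
    ereal (norm (loc m i (U m (Suc i)) - M f m (U m) i (U m (Suc i))))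
      \<le> c_coef d r 2 \<beta> M \<eta> f m (U m) i * ereal (((b - a) / real m) ^ (r + 1))"
proof -
  obtain m0 where m0: "\<forall>m\<ge>m0. \<forall>x. is_mesh a b m x \<and> admissible ell (K f) (k0 f) m x \<longrightarrow>
        (\<forall>i<m. (SUP t\<in>{x i..x (Suc i)}. ereal (norm (local_sol d M \<eta> f m x i t - M f m x i t)))
                 \<le> c_coef d r 2 \<beta> M \<eta> f m x i * ereal (mesh_step x i ^ (r + 1)))"
    using A f unfolding assumption_A_def by blast
  show ?thesis
  proof (rule that[of m0])
    fix m i assume m: "m0 \<le> m" "1 \<le> m" "i < m"
    have "U m i \<le> U m (Suc i)" using is_weak_mesh_uniform[OF m(2)] m(3) by (simp add: is_weak_mesh_def)
    then have "ereal (norm (loc m i (U m (Suc i)) - M f m (U m) i (U m (Suc i))))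
      \<le> (SUP t\<in>{U m i..U m (Suc i)}. ereal (norm (loc m i t - M f m (U m) i t)))"
      by (intro SUP_upper2[of "U m (Suc i)"]) auto
    also have "\<dots> \<le> c_coef d r 2 \<beta> M \<eta> f m (U m) i * ereal (mesh_step (U m) i ^ (r + 1))"
      using m0 m is_mesh_uniform[OF m(2)] adm[OF m(2)] by blast
    finally show "ereal (norm (loc m i (U m (Suc i)) - M f m (U m) i (U m (Suc i))))
      \<le> c_coef d r 2 \<beta> M \<eta> f m (U m) i * ereal (((b - a) / real m) ^ (r + 1))"
      unfolding uniform_mesh_step .
  qed
qed

lemma node_value_Rd:
  assumes "1 \<le> m" "i \<le> m"
  shows "node_value M \<eta> f m (U m) i \<in> Rd d"
proof (cases i)
  case (Suc j)
  have "U m j \<le> U m (Suc j)"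
    using is_weak_mesh_uniform[OF assms(1)] Suc assms(2) by (simp add: is_weak_mesh_def)
  then have "M f m (U m) j (U m (Suc j)) \<in> Rd d"
    using M f is_mesh_uniform[OF assms(1)] Suc assms(2) unfolding is_method_def by fastforce
  then show ?thesis by (simp add: Suc node_value_def)
qed (simp add: node_value_def \<eta>)

text \<open>The local error assumption is void when the local solution lacks a derivative. Convergence is
  therefore established cell by cell: closeness to \<open>z\<close> places the local solution in the domain of
  smoothness, which makes the coefficient finite and bounded, which keeps the next node close.\<close>

lemma method_converges:
  assumes "0 < \<rho>"
  obtains m1 where "1 \<le> m1" "\<And>m i. m1 \<le> m \<Longrightarrow> i < m \<Longrightarrow>
    local_ivp \<rho> (U m i) (U m (Suc i)) (node_value M \<eta> f m (U m) i) (loc m i)"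
proof -
  obtain B \<rho>0 where B: "0 \<le> B" "0 < \<rho>0" "\<rho>0 \<le> 1/2"
    "\<And>s T y w t. local_ivp \<rho>0 s T y w \<Longrightarrow> t \<in> {s..T} \<Longrightarrow> norm (total_deriv r (t, w t)) \<le> B"
    by (rule total_deriv_bounded[OF order_refl]) (rule that)
  obtain m0 where m0: "\<And>m i. m0 \<le> m \<Longrightarrow> 1 \<le> m \<Longrightarrow> i < m \<Longrightarrow>
    ereal (norm (loc m i (U m (Suc i)) - M f m (U m) i (U m (Suc i))))
      \<le> c_coef d r 2 \<beta> M \<eta> f m (U m) i * ereal (((b - a) / real m) ^ (r + 1))"
    by (rule method_one_step) (rule that)
  define \<rho>' where "\<rho>' = min \<rho> \<rho>0"
  have \<rho>': "0 < \<rho>'" "\<rho>' \<le> \<rho>" "\<rho>' \<le> \<rho>0" "\<rho>' \<le> 1/2" using assms B by (auto simp: \<rho>'_def)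
  define C where "C = 2 * (B / fact r + \<beta>)"
  have C: "0 \<le> C" using B \<beta> by (simp add: C_def)
  obtain H0 where H0: "0 < H0" "\<And>H. 0 \<le> H \<Longrightarrow> H \<le> H0 \<Longrightarrow>
    H \<le> \<rho>' \<and> L * H \<le> 1/2 \<and> H \<le> 1 \<and> C * (b - a) * exp (2 * L * (b - a)) * H \<le> \<rho>'"
    by (rule small_steps[OF \<rho>'(1) C]) (rule that)
  define m1 where "m1 = max (max 1 m0) (nat \<lceil>(b - a) / H0\<rceil>)"
  show ?thesis
  proof (rule that[of m1])
    show "1 \<le> m1" by (simp add: m1_def)
    fix m i assume m: "m1 \<le> m" and i: "i < m"
    have m': "1 \<le> m" "m0 \<le> m" "nat \<lceil>(b - a) / H0\<rceil> \<le> m" using m by (auto simp: m1_def)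
    define H where "H = (b - a) / real m"
    have "(b - a) / H0 \<le> real m" using m'(3) by linarith
    then have HH0: "H \<le> H0" using H0(1) m'(1) by (simp add: H_def field_simps)
    have Hp: "0 < H" using ab m'(1) by (simp add: H_def)
    have H: "H \<le> \<rho>'" "L * H \<le> 1/2" "H \<le> 1" "C * (b - a) * exp (2 * L * (b - a)) * H \<le> \<rho>'"
      using H0(2)[OF less_imp_le[OF Hp] HH0] by auto
    have step: "U m (Suc j) - U m j = H" for j
      using uniform_mesh_step[of m j] by (simp add: mesh_step_def H_def)
    have range: "a \<le> U m j" "U m j \<le> b" if "j \<le> m" for j
      using weak_mesh_range[OF is_weak_mesh_uniform[OF m'(1)] that] by auto
    have U0: "U m 0 = a" by (simp add: uniform_mesh_def)
    let ?y = "node_value M \<eta> f m (U m)"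
    have local: "local_ivp \<rho>' (U m j) (U m (Suc j)) (?y j) (loc m j)"
      if "j < m" "norm (?y j - z (U m j)) \<le> \<rho>'" for j
      unfolding local_sol_def
      using that range[of j] range[of "Suc j"] step[of j] H Hp node_value_Rd[OF m'(1), of j]
      by (intro local_ivp_ivp_sol) auto
    have near: "norm (?y j - z (U m j)) \<le> \<rho>'" if "j \<le> m" for j
      using that
    proof (rule accumulated_error_bound[where x = "U m" and n = m and L = L and C = C and H = H and b = b, rotated -1])
      show "norm (?y 0 - z (U m 0)) = 0" by (simp add: U0 z_start node_value_def)
      show "C * (b - U m 0) * exp (2 * L * (b - U m 0)) * H \<le> \<rho>'" using H(4) by (simp add: U0)
      show "U m j \<le> U m (Suc j)" for j using step[of j] Hp by simp
      fix j assume j: "j < m" and near: "norm (?y j - z (U m j)) \<le> \<rho>'"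
      note w = local[OF j near]
      have "c_coef d r 2 \<beta> M \<eta> f m (U m) j \<le> ereal C"
        unfolding C_def using B(4)[OF local_ivp_mono[OF w \<rho>'(3)]] by (intro c_coef_le[OF w \<rho>'(4)])
      then have "c_coef d r 2 \<beta> M \<eta> f m (U m) j * ereal (H ^ (r + 1)) \<le> ereal C * ereal (H ^ (r + 1))"
        using Hp by (intro ereal_mult_right_mono) auto
      with m0[OF m'(2,1) j] have "norm (loc m j (U m (Suc j)) - ?y (Suc j)) \<le> C * H ^ (r + 1)"
        unfolding H_def[symmetric] by (simp add: node_value_def)
           (metis ereal_less_eq(3) order_trans)
      then show "norm (?y (Suc j) - z (U m (Suc j))) \<le> (1 + 2 * L * (U m (Suc j) - U m j)) * norm (?y j - z (U m j))
          + C * (U m (Suc j) - U m j) * H"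
        using H C by (intro one_step_error[OF w]) (auto simp: step)
    qed (use range lip_const(1) C Hp in auto)
    show "local_ivp \<rho> (U m i) (U m (Suc i)) (?y i) (loc m i)"
      using local[OF i near] i \<rho>'(2) local_ivp_mono by fastforce
  qed
qed

text \<open>On fine meshes the coefficients of local solutions lie between \<open>N / 4\<close> (on a cell where the derivative
  of \<open>z\<close> is maximal) and \<open>N\<close> (on all cells), where \<open>N\<close> is the coefficient of the equidistant cost.
  That only fine meshes matter follows from the lower bound \<open>2 \<beta>\<close> of all coefficients.\<close>

lemma mhat_bounds:
  assumes \<phi>: "0 < \<phi>" "\<phi> < 1"
  shows "\<forall>\<^sub>F \<epsilon> in at_right 0.
    real (mhat_equid d r a b \<eta> 2 \<beta> M f \<epsilon>)
      \<le> real_of_int \<lceil>(b - a) * (Nbar d r a b \<eta> 2 \<beta> \<phi> f / \<epsilon>) powr (1 / (real r + 1))\<rceil> \<and>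
    real_of_int \<lceil>(b - a) * (Nbar d r a b \<eta> 2 \<beta> \<phi> f / \<epsilon>) powr (1 / (real r + 1))\<rceil>
      \<le> 5 * real (mhat_equid d r a b \<eta> 2 \<beta> M f \<epsilon>)"
proof -
  let ?N = "Nbar d r a b \<eta> 2 \<beta> \<phi> f"
  obtain t where t: "t \<in> {a..b}" "?N = 2 * (top_deriv t / fact r + \<beta>) * (1 + \<phi>)"
    "\<And>s. s \<in> {a..b} \<Longrightarrow> top_deriv s \<le> top_deriv t"
    by (rule Nbar_attained) (rule that)
  have N: "0 < ?N" using \<beta> \<phi> by (intro Nbar_pos)
  \<comment> \<open>The upper estimate needs \<open>e \<le> \<phi> \<beta>\<close>, the lower one \<open>e \<le> \<beta> / 2\<close>.\<close>
  define e where "e = \<phi> * \<beta> / 2"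
  have e: "0 < e" "e \<le> \<beta> / 2" "e \<le> \<phi> * \<beta>" using \<beta> \<phi> by (auto simp: e_def)
  have e_fact: "e / fact r \<le> e" using e(1) fact_ge_1[of r, where 'a = real] by (simp add: field_simps)
  obtain \<rho> where \<rho>: "0 < \<rho>" "\<rho> \<le> 1/2"
    "\<And>s T y w t t'. local_ivp \<rho> s T y w \<Longrightarrow> t \<in> {s..T} \<Longrightarrow> t' \<in> {s..T} \<Longrightarrow>
       norm (total_deriv r (t', w t') - total_deriv r (t, z t)) \<le> e"
    by (rule total_deriv_near_z[OF e(1) order_refl]) (rule that)
  obtain m1 where m1: "1 \<le> m1" "\<And>m i. m1 \<le> m \<Longrightarrow> i < m \<Longrightarrow>
    local_ivp \<rho> (U m i) (U m (Suc i)) (node_value M \<eta> f m (U m) i) (loc m i)"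
    by (rule method_converges[OF \<rho>(1)]) (rule that)
  \<comment> \<open>Below this \<open>\<epsilon>\<close>, uniform meshes of cost at most \<open>\<epsilon>\<close> have more than \<open>m1\<close> subintervals.\<close>
  define e0 where "e0 = min ?N (2 * \<beta>) * ((b - a) / real m1) ^ (r + 1)"
  have "0 < e0" using N \<beta> ab m1(1) by (simp add: e0_def)
  then have "\<forall>\<^sub>F \<epsilon> in at_right 0. \<epsilon> \<in> {0<..<e0}" by (rule eventually_at_right_real)
  then show ?thesis
  proof eventually_elim
    case (elim \<epsilon>)
    then have \<epsilon>: "0 < \<epsilon>" "\<epsilon> < e0" by auto
    let ?A = "(b - a) * (?N / \<epsilon>) powr (1 / (real r + 1))"
    define cost where "cost m = Max ((\<lambda>i. c_coef d r 2 \<beta> M \<eta> f m (U m) i * ereal (((b - a) / real m) ^ (r + 1))) ` {..<m})" for m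
    let ?P = "\<lambda>m. 1 \<le> m \<and> cost m \<le> ereal \<epsilon>"
    have mhat: "mhat_equid d r a b \<eta> 2 \<beta> M f \<epsilon> = (LEAST m. ?P m)"
      unfolding mhat_equid_def Let_def uniform_mesh_step cost_def ..
    have cost_le: "cost m \<le> ereal v" if "1 \<le> m"
      "\<And>i. i < m \<Longrightarrow> c_coef d r 2 \<beta> M \<eta> f m (U m) i * ereal (((b - a) / real m) ^ (r + 1)) \<le> ereal v" for m v
      unfolding cost_def using that by (intro Max.boundedI) (auto simp: lessThan_empty_iff)
    have large: "real m1 < (b - a) * (N' / \<epsilon>) powr (1 / (real r + 1))"
      if "N' \<in> {?N, 2 * \<beta>}" for N'
    proof -
      have "e0 \<le> N' * ((b - a) / real m1) ^ (r + 1)"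
        unfolding e0_def using that ab by (intro mult_right_mono) auto
      then have "\<not> N' * ((b - a) / real m1) ^ (r + 1) \<le> \<epsilon>" using \<epsilon> by linarith
      then show ?thesis using equid_cost_iff[of N' \<epsilon> m1] that N \<beta> \<epsilon>(1) m1(1) by auto
    qed
    define q where "q = nat \<lceil>?A\<rceil>"
    have A0: "real m1 < ?A" by (rule large) simp
    have q: "?A \<le> real q" "m1 \<le> q" "1 \<le> q" using A0 m1(1) unfolding q_def by linarith+
    have qQ: "real q = real_of_int \<lceil>?A\<rceil>" using A0 unfolding q_def by linarith
    have "?P q"
    proof (intro conjI q(3) cost_le)
      fix i assume i: "i < q"
      note w = m1(2)[OF q(2) i]
      have "norm (total_deriv r (s, loc q i s)) \<le> top_deriv t + e" if s: "s \<in> {U q i..U q (Suc i)}" for s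
      proof -
        have "s \<in> {a..b}" using w s by (auto simp: local_ivp_def)
        then show ?thesis
          using \<rho>(3)[OF w s s] t(3)[of s] norm_triangle_sub[of "total_deriv r (s, loc q i s)" "total_deriv r (s, z s)"] by linarith
      qed
      then have "c_coef d r 2 \<beta> M \<eta> f q (U q) i \<le> ereal (2 * ((top_deriv t + e) / fact r + \<beta>))"
        by (rule c_coef_le[OF w \<rho>(2)])
      also have "2 * ((top_deriv t + e) / fact r + \<beta>) \<le> ?N"
      proof -
        define \<theta> where "\<theta> = top_deriv t / fact r"
        have 1: "0 \<le> \<phi> * \<theta>" using \<phi> by (simp add: \<theta>_def)
        have 2: "(top_deriv t + e) / fact r \<le> \<theta> + \<phi> * \<beta>"
          using e_fact e unfolding \<theta>_def add_divide_distrib by linarith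
        have "2 * ((top_deriv t + e) / fact r + \<beta>) \<le> 2 * ((\<theta> + \<phi> * \<beta>) + \<beta> + \<phi> * \<theta>)"
          by (intro mult_left_mono) (use add_mono[OF 2 1] in simp_all)
        also have "\<dots> = ?N" unfolding t(2) \<theta>_def[symmetric] by algebra
        finally show ?thesis .
      qed
      finally have "c_coef d r 2 \<beta> M \<eta> f q (U q) i \<le> ereal ?N" by simp
      then have "c_coef d r 2 \<beta> M \<eta> f q (U q) i * ereal (((b - a) / real q) ^ (r + 1))
          \<le> ereal ?N * ereal (((b - a) / real q) ^ (r + 1))"
        using ab by (intro ereal_mult_right_mono) auto
      also have "\<dots> \<le> ereal \<epsilon>" using equid_cost_iff[OF N \<epsilon>(1) q(3)] q(1) by simp
      finally show "c_coef d r 2 \<beta> M \<eta> f q (U q) i * ereal (((b - a) / real q) ^ (r + 1)) \<le> ereal \<epsilon>" .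
    qed
    define m where "m = (LEAST m. ?P m)"
    have "m \<le> q" unfolding m_def using \<open>?P q\<close> by (rule Least_le)
    have Pm: "1 \<le> m" "cost m \<le> ereal \<epsilon>" using LeastI[of ?P, OF \<open>?P q\<close>] by (auto simp: m_def)
    have lower: "(b - a) * (N' / \<epsilon>) powr (1 / (real r + 1)) \<le> real m"
      if "0 < N'" "i < m" "ereal N' \<le> c_coef d r 2 \<beta> M \<eta> f m (U m) i" for N' i
    proof -
      have "ereal N' * ereal (((b - a) / real m) ^ (r + 1))
          \<le> c_coef d r 2 \<beta> M \<eta> f m (U m) i * ereal (((b - a) / real m) ^ (r + 1))"
        using that ab by (intro ereal_mult_right_mono) auto
      also have "\<dots> \<le> cost m" unfolding cost_def using that by (intro Max_ge) auto
      also note Pm(2)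
      finally show ?thesis using equid_cost_iff[OF that(1) \<epsilon>(1) Pm(1)] by simp
    qed
    have weak: "is_weak_mesh a b m (U m)" by (rule is_weak_mesh_uniform[OF Pm(1)])
    have "(b - a) * (2 * \<beta> / \<epsilon>) powr (1 / (real r + 1)) \<le> real m"
      using \<beta> Pm(1) weak by (intro lower[of _ 0] c_coef_ge_beta) (auto simp: is_weak_mesh_def)
    then have "m1 \<le> m" using large[of "2 * \<beta>"] by simp
    obtain i where i: "i < m" "t \<in> {U m i..U m (Suc i)}"
      using mesh_cell[OF weak _ t(1)] Pm(1) by (metis less_le_trans zero_less_one)
    note w = m1(2)[OF \<open>m1 \<le> m\<close> i(1)]
    have "top_deriv t - e \<le> norm (total_deriv r (t, loc m i t))"
      using \<rho>(3)[OF w i(2) i(2)] norm_triangle_sub[of "total_deriv r (t, z t)" "total_deriv r (t, loc m i t)"]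
      by (simp add: norm_minus_commute)
    then have "(top_deriv t - e) / fact r \<le> norm (total_deriv r (t, loc m i t)) / fact r"
      by (intro divide_right_mono) auto
    moreover have "?N / 4 \<le> 2 * ((top_deriv t - e) / fact r + \<beta>)"
    proof -
      have "0 \<le> top_deriv t / fact r + \<beta>" using \<beta> by simp
      then have "?N \<le> 2 * (top_deriv t / fact r + \<beta>) * 2" unfolding t(2) using \<phi> by (intro mult_left_mono) auto
      moreover have "0 \<le> top_deriv t / fact r" by simp
      ultimately show ?thesis using e e_fact unfolding diff_divide_distrib by argo
    qed
    ultimately have "?N / 4 \<le> 2 * (norm (total_deriv r (t, loc m i t)) / fact r + \<beta>)" by argo
    then have "ereal (?N / 4) \<le> ereal (2 * (norm (total_deriv r (t, loc m i t)) / fact r + \<beta>))" by simp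
    also have "\<dots> \<le> c_coef d r 2 \<beta> M \<eta> f m (U m) i" by (rule c_coef_ge[OF w \<rho>(2) i(2)])
    finally have low: "(b - a) * (?N / 4 / \<epsilon>) powr (1 / (real r + 1)) \<le> real m"
      using N by (intro lower[OF _ i(1)]) auto
    \<comment> \<open>The root of \<open>1/4\<close> is replaced by a bound independent of \<open>r\<close>.\<close>
    have "1 / 4 \<le> (1 / 4) powr (1 / (real r + 1))"
      using powr_mono'[of "1 / (real r + 1)" 1 "1 / 4"] by simp
    then have "1 / 4 * (?N / \<epsilon>) powr (1 / (real r + 1)) \<le> (1 / 4) powr (1 / (real r + 1)) * (?N / \<epsilon>) powr (1 / (real r + 1))"
      by (intro mult_right_mono) auto
    also have "\<dots> = (?N / 4 / \<epsilon>) powr (1 / (real r + 1))"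
      using N \<epsilon>(1) by (simp flip: powr_mult)
    finally have "(b - a) * (1 / 4 * (?N / \<epsilon>) powr (1 / (real r + 1))) \<le> (b - a) * (?N / 4 / \<epsilon>) powr (1 / (real r + 1))"
      using ab by (intro mult_left_mono) auto
    with low have "?A \<le> 4 * real m" by simp
    then have "real_of_int \<lceil>?A\<rceil> \<le> 5 * real m" using Pm(1) by linarith
    then show ?case using \<open>m \<le> q\<close> qQ unfolding mhat m_def[symmetric] by simp
  qed
qed

end

lemma mbar_equid_theta:
  assumes pos: "0 < \<beta>" "0 < \<phi>" "0 < \<epsilon>" and \<kappa>: "0 < \<kappa>" "\<kappa> \<le> 1"
  defines "Q \<equiv> real_of_int \<lceil>(b - a) * (Nbar d r a b \<eta> 2 \<beta> \<phi> f / \<epsilon>) powr (1 / (real r + 1))\<rceil>"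
  shows "Q \<le> real (mbar_equid d r a b \<eta> 2 \<beta> \<phi> f (\<kappa> * \<epsilon>))"
    and "real (mbar_equid d r a b \<eta> 2 \<beta> \<phi> f (\<kappa> * \<epsilon>)) \<le> (1 / \<kappa> + 1) * Q"
proof -
  let ?N = "Nbar d r a b \<eta> 2 \<beta> \<phi> f" and ?p = "1 / (real r + 1)"
  let ?A = "(b - a) * (?N / \<epsilon>) powr ?p" and ?A' = "(b - a) * (?N / (\<kappa> * \<epsilon>)) powr ?p"
  have N: "0 < ?N" using pos by (intro Nbar_pos)
  have A: "0 < ?A" using N ab pos by simp
  have mult: "(?N / (\<kappa> * \<epsilon>)) powr ?p = (1 / \<kappa>) powr ?p * (?N / \<epsilon>) powr ?p"
    using N pos \<kappa> by (simp flip: powr_mult)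
  have \<kappa>1: "1 \<le> 1 / \<kappa>" using \<kappa> by simp
  have "1 \<le> (1 / \<kappa>) powr ?p" using \<kappa>1 by (intro ge_one_powr_ge_zero) auto
  moreover have "(1 / \<kappa>) powr ?p \<le> (1 / \<kappa>) powr 1" using \<kappa>1 by (intro powr_mono) auto
  ultimately have b: "1 \<le> (1 / \<kappa>) powr ?p" "(1 / \<kappa>) powr ?p \<le> 1 / \<kappa>" using \<kappa> by auto
  have A': "?A' = (1 / \<kappa>) powr ?p * ?A" unfolding mult by simp
  have AA': "?A \<le> ?A'" "?A' \<le> 1 / \<kappa> * ?A"
    unfolding A' using mult_right_mono[OF b(1), of ?A] mult_right_mono[OF b(2), of ?A] A by auto
  have "0 < \<kappa> * \<epsilon>" using pos \<kappa> by simp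
  then have e: "real (mbar_equid d r a b \<eta> 2 \<beta> \<phi> f (\<kappa> * \<epsilon>)) = real_of_int \<lceil>?A'\<rceil>"
    unfolding mbar_equid_eq[OF pos(1,2) \<open>0 < \<kappa> * \<epsilon>\<close>] using A AA' by simp
  show "Q \<le> real (mbar_equid d r a b \<eta> 2 \<beta> \<phi> f (\<kappa> * \<epsilon>))"
    unfolding e Q_def using AA'(1) by (simp add: ceiling_mono)
  have "1 \<le> \<lceil>?A\<rceil>" using iffD2[OF zero_less_ceiling A] by linarith
  then have Q: "1 \<le> Q" "?A \<le> Q" unfolding Q_def by (simp_all only: le_of_int_ceiling of_int_1_le_iff)
  have "real_of_int \<lceil>?A'\<rceil> \<le> 1 / \<kappa> * ?A + 1" using AA'(2) by linarith
  also have "\<dots> \<le> 1 / \<kappa> * Q + Q" using Q \<kappa> by (intro add_mono mult_left_mono) auto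
  finally show "real (mbar_equid d r a b \<eta> 2 \<beta> \<phi> f (\<kappa> * \<epsilon>)) \<le> (1 / \<kappa> + 1) * Q"
    unfolding e by (simp only: distrib_right mult_1)
qed

lemma mstar_le_mbar_le_mbar_equid:
  assumes pos: "0 < \<beta>" "0 < \<phi>" and \<kappa>: "0 < \<kappa>" "\<kappa> \<le> 1/2"
    and adm: "\<And>m. 1 \<le> m \<Longrightarrow> admissible ell K k0 m (uniform_mesh a b m)"
    and h: "\<forall>\<epsilon>\<in>{0<..<1}. 0 < h \<epsilon>" "h \<in> O[at_right 0](\<lambda>\<epsilon>. \<epsilon> powr (1 / (real r + 1)))"
  shows "\<forall>\<^sub>F \<epsilon> in at_right 0.
     mstar r a b \<eta> \<beta> \<phi> h f \<epsilon> \<le> enat (mbar d r a b \<eta> ell K k0 2 \<beta> \<phi> f (\<kappa> * \<epsilon>)) \<and>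
     mbar d r a b \<eta> ell K k0 2 \<beta> \<phi> f (\<kappa> * \<epsilon>) \<le> mbar_equid d r a b \<eta> 2 \<beta> \<phi> f (\<kappa> * \<epsilon>)"
  using eventually_dd_accurate[OF pos h] eventually_at_right_less[of 0]
proof eventually_elim
  case (elim \<epsilon>)
  have \<kappa>\<epsilon>: "0 < \<kappa> * \<epsilon>" using elim(2) \<kappa> by simp
  let ?m = "mbar d r a b \<eta> ell K k0 2 \<beta> \<phi> f (\<kappa> * \<epsilon>)"
  note props = mbar_properties[OF adm pos \<kappa>\<epsilon>]
  obtain x where x: "is_weak_mesh a b ?m x"
    "\<forall>i<?m. cbar_coef d r a b \<eta> 2 \<beta> \<phi> f x i * mesh_step x i ^ (r + 1) \<le> 5/4 * (\<kappa> * \<epsilon>)"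
    using props(2) by blast
  have "\<kappa> * \<epsilon> \<le> \<epsilon> / 2" using mult_right_mono[OF \<kappa>(2), of \<epsilon>] elim(2) by simp
  then have cost: "cbar_coef d r a b \<eta> 2 \<beta> \<phi> f x i * mesh_step x i ^ (r + 1) \<le> 5/4 * (\<epsilon> / 2)" if "i < ?m" for i
    using x(2) that by force
  have "x ?m \<le> fst (adapt_state r a b \<eta> \<beta> \<phi> h f \<epsilon> ?m)"
    by (rule adapt_dominates[OF elim(2) pos elim(1) x(1) cost]) auto
  then have "mstar r a b \<eta> \<beta> \<phi> h f \<epsilon> \<le> enat ?m"
    using x(1) by (intro mstar_le elim(2) pos) (simp add: is_weak_mesh_def)
  then show ?case using props(1) by simp
qed

end

theorem mainTheorem5:
  fixes \<phi> \<kappa> :: real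
  assumes "0 < \<phi>" "\<phi> < 1" and "\<kappa> = (1 - \<phi>) / (2 * (1 + \<phi>))"
  shows "\<exists>c C. 0 < c \<and> 0 < C \<and>
    (\<forall>(a::real) (b::real) (d::nat) (r::nat) (\<eta>::rvec) (f :: real \<Rightarrow> rvec \<Rightarrow> rvec)
       (\<beta>::real) (ell :: nat \<Rightarrow> real) (K :: (real \<Rightarrow> rvec \<Rightarrow> rvec) \<Rightarrow> real) (k0 :: (real \<Rightarrow> rvec \<Rightarrow> rvec) \<Rightarrow> nat)
       (h :: real \<Rightarrow> real) (M :: ivp_method).
       a < b \<and> 1 \<le> d \<and> 1 \<le> r \<and> \<eta> \<in> Rd d \<and> f \<in> F_class d r a b \<eta> \<and> 0 < \<beta> \<and>
       decseq ell \<and> ell \<longlonglongrightarrow> 0 \<and>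
       (\<forall>\<epsilon>\<in>{0<..<1}. 0 < h \<epsilon>) \<and> h \<in> O[at_right 0](\<lambda>\<epsilon>. \<epsilon> powr (1 / (real r + 1))) \<and>
       (\<forall>m\<ge>1. admissible ell (K f) (k0 f) m (uniform_mesh a b m)) \<and>
       (\<forall>\<^sub>F \<epsilon> in at_right 0. \<forall>m. mstar r a b \<eta> \<beta> \<phi> h f \<epsilon> = enat m \<longrightarrow>
          admissible ell (K f) (k0 f) m (adapt_mesh r a b \<eta> \<beta> \<phi> h f \<epsilon>)) \<and>
       is_method d r a b \<eta> M \<and> assumption_A d r a b \<eta> ell K k0 2 \<beta> M
     \<longrightarrow>
       (\<forall>\<^sub>F \<epsilon> in at_right 0.
          mstar r a b \<eta> \<beta> \<phi> h f \<epsilon> \<le> enat (mbar d r a b \<eta> ell (K f) (k0 f) 2 \<beta> \<phi> f (\<kappa> * \<epsilon>)) \<and>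
          mbar d r a b \<eta> ell (K f) (k0 f) 2 \<beta> \<phi> f (\<kappa> * \<epsilon>) \<le> mbar_equid d r a b \<eta> 2 \<beta> \<phi> f (\<kappa> * \<epsilon>)) \<and>
       theta_with c C
         (\<lambda>\<epsilon>. real (mbar_equid d r a b \<eta> 2 \<beta> \<phi> f (\<kappa> * \<epsilon>)))
         (\<lambda>\<epsilon>. real_of_int \<lceil>(b - a) * (Nbar d r a b \<eta> 2 \<beta> \<phi> f / \<epsilon>) powr (1 / (real r + 1))\<rceil>) \<and>
       theta_with c C
         (\<lambda>\<epsilon>. real_of_int \<lceil>(b - a) * (Nbar d r a b \<eta> 2 \<beta> \<phi> f / \<epsilon>) powr (1 / (real r + 1))\<rceil>)
         (\<lambda>\<epsilon>. real (mhat_equid d r a b \<eta> 2 \<beta> M f \<epsilon>)))"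
proof -
  have "0 < \<kappa>" using assms by simp
  moreover have "\<kappa> \<le> 1/2" unfolding assms(3) using assms(1) by (simp add: divide_le_eq)
  ultimately have \<kappa>: "0 < \<kappa>" "\<kappa> \<le> 1/2" by auto
  show ?thesis
  proof (rule exI[of _ 1], rule exI[of _ "1 / \<kappa> + 5"], intro conjI allI impI)
    show "0 < 1 / \<kappa> + 5" using \<kappa> by (simp add: add_pos_pos)
  next
    fix a b :: real and d r :: nat and \<eta> :: rvec and f :: "real \<Rightarrow> rvec \<Rightarrow> rvec"
      and \<beta> :: real and ell :: "nat \<Rightarrow> real" and K :: "(real \<Rightarrow> rvec \<Rightarrow> rvec) \<Rightarrow> real"
      and k0 :: "(real \<Rightarrow> rvec \<Rightarrow> rvec) \<Rightarrow> nat" and h :: "real \<Rightarrow> real" and M :: ivp_method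
    let ?Q = "\<lambda>\<epsilon>. real_of_int \<lceil>(b - a) * (Nbar d r a b \<eta> 2 \<beta> \<phi> f / \<epsilon>) powr (1 / (real r + 1))\<rceil>"
    assume H: "a < b \<and> 1 \<le> d \<and> 1 \<le> r \<and> \<eta> \<in> Rd d \<and> f \<in> F_class d r a b \<eta> \<and> 0 < \<beta> \<and>
       decseq ell \<and> ell \<longlonglongrightarrow> 0 \<and>
       (\<forall>\<epsilon>\<in>{0<..<1}. 0 < h \<epsilon>) \<and> h \<in> O[at_right 0](\<lambda>\<epsilon>. \<epsilon> powr (1 / (real r + 1))) \<and>
       (\<forall>m\<ge>1. admissible ell (K f) (k0 f) m (uniform_mesh a b m)) \<and>
       (\<forall>\<^sub>F \<epsilon> in at_right 0. \<forall>m. mstar r a b \<eta> \<beta> \<phi> h f \<epsilon> = enat m \<longrightarrow>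
          admissible ell (K f) (k0 f) m (adapt_mesh r a b \<eta> \<beta> \<phi> h f \<epsilon>)) \<and>
       is_method d r a b \<eta> M \<and> assumption_A d r a b \<eta> ell K k0 2 \<beta> M"
    then interpret smooth_ivp d r a b \<eta> f by unfold_locales auto
    have \<beta>: "0 < \<beta>" and h: "\<forall>\<epsilon>\<in>{0<..<1}. 0 < h \<epsilon>" "h \<in> O[at_right 0](\<lambda>\<epsilon>. \<epsilon> powr (1 / (real r + 1)))"
      and adm: "\<And>m. 1 \<le> m \<Longrightarrow> admissible ell (K f) (k0 f) m (uniform_mesh a b m)"
      and M: "is_method d r a b \<eta> M" "assumption_A d r a b \<eta> ell K k0 2 \<beta> M"
      using H by auto
    show "\<forall>\<^sub>F \<epsilon> in at_right 0.
          mstar r a b \<eta> \<beta> \<phi> h f \<epsilon> \<le> enat (mbar d r a b \<eta> ell (K f) (k0 f) 2 \<beta> \<phi> f (\<kappa> * \<epsilon>)) \<and>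
          mbar d r a b \<eta> ell (K f) (k0 f) 2 \<beta> \<phi> f (\<kappa> * \<epsilon>) \<le> mbar_equid d r a b \<eta> 2 \<beta> \<phi> f (\<kappa> * \<epsilon>)"
      by (rule mstar_le_mbar_le_mbar_equid[OF \<beta> \<open>0 < \<phi>\<close> \<kappa> adm h])
    show "theta_with 1 (1 / \<kappa> + 5) (\<lambda>\<epsilon>. real (mbar_equid d r a b \<eta> 2 \<beta> \<phi> f (\<kappa> * \<epsilon>))) ?Q"
      unfolding theta_with_def using eventually_at_right_less[of 0]
    proof eventually_elim
      case (elim \<epsilon>)
      have \<kappa>1: "\<kappa> \<le> 1" using \<kappa> by simp
      note * = mbar_equid_theta[OF \<beta> \<open>0 < \<phi>\<close> elim \<kappa>(1) \<kappa>1]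
      have "0 \<le> (b - a) * (Nbar d r a b \<eta> 2 \<beta> \<phi> f / \<epsilon>) powr (1 / (real r + 1))" using ab by simp
      then have "0 \<le> ?Q \<epsilon>" by linarith
      then have "(1 / \<kappa> + 1) * ?Q \<epsilon> \<le> (1 / \<kappa> + 5) * ?Q \<epsilon>" by (intro mult_right_mono) auto
      with * show ?case by auto
    qed
    show "theta_with 1 (1 / \<kappa> + 5) ?Q (\<lambda>\<epsilon>. real (mhat_equid d r a b \<eta> 2 \<beta> M f \<epsilon>))"
      unfolding theta_with_def
    proof (rule eventually_mono[OF mhat_bounds[OF M _ \<beta> \<open>0 < \<phi>\<close> \<open>\<phi> < 1\<close>]])
      show "1 \<le> m \<Longrightarrow> admissible ell (K f) (k0 f) m (uniform_mesh a b m)" for m by (rule adm)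
    next
      fix \<epsilon>
      assume elim: "real (mhat_equid d r a b \<eta> 2 \<beta> M f \<epsilon>) \<le> ?Q \<epsilon> \<and>
        ?Q \<epsilon> \<le> 5 * real (mhat_equid d r a b \<eta> 2 \<beta> M f \<epsilon>)"
      have "5 * real (mhat_equid d r a b \<eta> 2 \<beta> M f \<epsilon>) \<le> (1 / \<kappa> + 5) * real (mhat_equid d r a b \<eta> 2 \<beta> M f \<epsilon>)"
        using \<kappa> by (intro mult_right_mono) auto
      with elim show "1 * real (mhat_equid d r a b \<eta> 2 \<beta> M f \<epsilon>) \<le> ?Q \<epsilon> \<and>
        ?Q \<epsilon> \<le> (1 / \<kappa> + 5) * real (mhat_equid d r a b \<eta> 2 \<beta> M f \<epsilon>)" by auto
    qed
  qed simp
qed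

end
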